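(* Consider the (ON/OFF-BMAP)/D/1/$K$ queue described in the context, and suppose: $\lambda>1$; there is a nonnegative random variable $Y\in\mathcal{S}$ with $\sum_{l=k+1}^\infty\boldsymbol{\alpha}(l)=O(\mathbb{P}(Y>k))$ and $\sum_{l=k+1}^\infty\boldsymbol{\Lambda}(l)=O(\mathbb{P}(Y>k))$ (entrywise); $\mathbb{E}[A]<\mathbb{E}[I^{\rm off}]$; and for every $m\in\mathbb{Z}$, $I_m^{\rm on}$ is independent of the $m$th BMAP $\{(N_{m,n},J_{m,n});n\ge0\}$. Further suppose (i) $I^{\rm on}\in\mathcal{C}$; (ii) $\mathbb{E}[I^{\rm on}]<\infty$; and (iii) $\mathbb{P}(Y>x)=o(\mathbb{P}(I^{\rm on}>x))$. Then $$P_{\rm loss}^{(K)}\sim\frac{(\lambda-1)\mathbb{E}[I^{\rm on}]}{\mathbb{E}[A]+\mathbb{E}[I^{\rm on}]}\,\mathbb{P}\big(I^{\rm on}_{\rm e}>K/(\lambda-1)\big)\quad(K\to\infty).$$ If in addition $\boldsymbol{\alpha}(k)=\boldsymbol{\phi}\boldsymbol{\Lambda}(k)$ for $k\ge1$, then $P_{\rm loss}^{(K)}\sim\frac{\lambda-1}{\lambda}\mathbb{P}(I^{\rm on}_{\rm e}>K/(\lambda-1))$.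
   Context: Discrete time, slots $[n,n+1]$. ON/OFF-BMAP: on- and off-periods alternate, indexed by $m\in\mathbb{Z}$; no arrivals in off-slots. The $m$th BMAP is $\{(N_{m,n},J_{m,n});n\ge0\}$ with $N_{m,n}$ the number of arrivals in the $n$th slot of the $m$th on-period and $J_{m,n}\in\mathbb{D}=\{0,\dots,d-1\}$, $\mathbb{P}(N_{m,0}=k,J_{m,0}=i)=\alpha_i(k)$, $\mathbb{P}(N_{m,n}=k,J_{m,n}=j\mid J_{m,n-1}=i,\text{past})=\Lambda_{i,j}(k)$ ($k\ge1,n\ge1$); $\sum_k\boldsymbol{\alpha}(k)$ a probability vector, $\sum_k\boldsymbol{\Lambda}(k)$ irreducible stochastic with stationary vector $\boldsymbol{\phi}$, $\lambda=\boldsymbol{\phi}\sum_kk\boldsymbol{\Lambda}(k)\mathbf{e}$. $I_m^{\rm on}\ge1$ is the $m$th on-period length; the tuples $\{I_m^{\rm on},(N_{m,n},J_{m,n})_{0\le n<I_m^{\rm on}}\}$ are i.i.d. over $m$; off-period lengths $I_m^{\rm off}$ are i.i.d. (independent of on-period data). $A_m=\sum_{n=0}^{I_m^{\rm on}-1}(N_{m,n}-1)$. Queue with capacity $K$, unit service times: $L_{m+1}^{(K)}=(\min(L_m^{(K)}+A_{m+1},K)-I_{m+1}^{\rm off})^+$; $P_{\rm loss}^{(K)}=\mathbb{E}[(L_{m-1}^{(K)}+A_m-K)^+]/\mathbb{E}[A_m+I_m^{\rm on}]$ in stationarity. Generic copies $A,I^{\rm on},I^{\rm off}$; equilibrium r.v.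 $X_{\rm e}$: $\mathbb{P}(X_{\rm e}\le x)=\frac1{\mathbb{E}X}\int_0^x\mathbb{P}(X>y)dy$. Classes: $\mathcal{S}$: positive tail, $\mathbb{P}(X_1+X_2>x)\sim2\mathbb{P}(X>x)$ for independent copies. $\mathcal{C}$: positive tail, $\lim_{v\downarrow1}\liminf_{x\to\infty}\mathbb{P}(X>vx)/\mathbb{P}(X>x)=1$. *)

theory Defs
  imports "HOL-Probability.Probability" "HOL-Library.Landau_Symbols"
begin

definition mat_power :: "real^'d^'d \<Rightarrow> nat \<Rightarrow> real^'d^'d" where
  "mat_power P n = ((\<lambda>X. X ** P) ^^ n) (mat 1)"

definition irreducible_mat :: "real^'d^'d \<Rightarrow> bool" where
  "irreducible_mat P \<longleftrightarrow> (\<forall>i j. \<exists>n. mat_power P n $ i $ j > 0)"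

definition stochastic_mat :: "real^'d^'d \<Rightarrow> bool" where
  "stochastic_mat P \<longleftrightarrow> (\<forall>i j. P $ i $ j \<ge> 0) \<and> (\<forall>i. (\<Sum>j\<in>UNIV. P $ i $ j) = 1)"

definition prob_vector :: "real^'d \<Rightarrow> bool" where
  "prob_vector v \<longleftrightarrow> (\<forall>i. v $ i \<ge> 0) \<and> (\<Sum>i\<in>UNIV. v $ i) = 1"

definition rv_tail :: "'a measure \<Rightarrow> ('a \<Rightarrow> real) \<Rightarrow> real \<Rightarrow> real" where
  "rv_tail M X x = measure M {\<omega> \<in> space M. X \<omega> > x}"

definition positive_tail :: "'a measure \<Rightarrow> ('a \<Rightarrow> real) \<Rightarrow> bool" where
  "positive_tail M X \<longleftrightarrow> (\<forall>x. rv_tail M X x > 0)"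

text \<open>Class S: positive tail and P(X1+X2 > x) ~ 2 P(X > x) for independent copies X1, X2
  (the law of X1+X2 is that of fst+snd under the product of two copies of the law of X).\<close>
definition subexponential :: "'a measure \<Rightarrow> ('a \<Rightarrow> real) \<Rightarrow> bool" where
  "subexponential M X \<longleftrightarrow> positive_tail M X \<and>
     ((\<lambda>x. measure (distr M borel X \<Otimes>\<^sub>M distr M borel X) {p. fst p + snd p > x})
        \<sim>[at_top] (\<lambda>x. 2 * rv_tail M X x))"

definition consistent_variation :: "'a measure \<Rightarrow> ('a \<Rightarrow> real) \<Rightarrow> bool" where
  "consistent_variation M X \<longleftrightarrow> positive_tail M X \<and>
     ((\<lambda>v. Liminf at_top (\<lambda>x. ereal (rv_tail M X (v * x) / rv_tail M X x)))
        \<longlongrightarrow> ereal 1) (at_right 1)"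

definition equilibrium_tail :: "'a measure \<Rightarrow> ('a \<Rightarrow> real) \<Rightarrow> real \<Rightarrow> real" where
  "equilibrium_tail M X x =
     1 - (1 / integral\<^sup>L M X) * (\<integral>y\<in>{0..x}. rv_tail M X y \<partial>lborel)"

text \<open>Net input during an on-period: A = sum_{n < I_on} (N_n - 1).\<close>
definition onoff_A :: "(nat \<Rightarrow> 'a \<Rightarrow> nat) \<Rightarrow> ('a \<Rightarrow> nat) \<Rightarrow> 'a \<Rightarrow> int" where
  "onoff_A N Ion \<omega> = (\<Sum>n<Ion \<omega>. int (N n \<omega>) - 1)"

definition queue_step :: "nat \<Rightarrow> nat \<Rightarrow> int \<Rightarrow> nat \<Rightarrow> nat" where
  "queue_step K l a off = nat (min (int l + a) (int K) - int off)"

text \<open>pi (supported on {0..K}) is a stationary distribution of the embedded chain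
  L^{(K)}_m, whose transitions are driven by the independent pair (A_{m+1}, I^off_{m+1}).\<close>
definition stationary_queue_dist ::
  "'a measure \<Rightarrow> nat \<Rightarrow> ('a \<Rightarrow> int) \<Rightarrow> ('a \<Rightarrow> nat) \<Rightarrow> (nat \<Rightarrow> real) \<Rightarrow> bool" where
  "stationary_queue_dist M K A Ioff \<pi> \<longleftrightarrow>
     (\<forall>l\<le>K. \<pi> l \<ge> 0) \<and> (\<Sum>l\<le>K. \<pi> l) = 1 \<and>
     (\<forall>l'\<le>K. \<pi> l' = (\<Sum>l\<le>K. \<pi> l *
         measure M {\<omega> \<in> space M. queue_step K l (A \<omega>) (Ioff \<omega>) = l'}))"

text \<open>P_loss = E[(L_{m-1} + A_m - K)^+] / E[A_m + I^on_m], where L_{m-1} ~ pi is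
  independent of A_m.\<close>
definition loss_probability ::
  "'a measure \<Rightarrow> nat \<Rightarrow> ('a \<Rightarrow> int) \<Rightarrow> ('a \<Rightarrow> nat) \<Rightarrow> (nat \<Rightarrow> real) \<Rightarrow> real" where
  "loss_probability M K A Ion \<pi> =
     (\<Sum>l\<le>K. \<pi> l * (\<integral>\<omega>. real_of_int (max 0 (int l + A \<omega> - int K)) \<partial>M))
     / (\<integral>\<omega>. real_of_int (A \<omega>) + real (Ion \<omega>) \<partial>M)"

end

theory Submission
  imports Defs
begin

text \<open>
  Write \<open>\<mu> = lam - 1\<close>, \<open>T x = E (A - x)\<^sup>+\<close>, \<open>U c = \<pi> [c, K]\<close>, and let \<open>\<delta> > 0\<close> be the excess of \<open>E (min Ioff b)\<close>
  over \<open>E A\<close> for a large truncation level \<open>b\<close>. Balancing the test function \<open>l \<mapsto> (l - c)\<^sup>+\<close> in stationarity gives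
  \<open>loss + \<delta> U c \<le> (\<Sum>l<c. \<pi> l T (c - l)) + b (U c - U (c + b))\<close>.
  Averaged over equally spaced levels this yields first \<open>U c = O (T c)\<close> uniformly in \<open>K\<close>, and then, with
  levels close to \<open>K\<close>, that the loss is asymptotically at most \<open>T K\<close>; it is at least \<open>T K\<close> because \<open>L \<ge> 0\<close>.

  It remains to see that \<open>P (A > x) \<sim> P (Ion > x / \<mu>)\<close>, which integrates to \<open>T K \<sim> \<mu> E Ion P (Ion\<^sub>e > K / \<mu>)\<close>.
  The lower bound is the law of large numbers, obtained from the Poisson equation of the modulating chain and
  exponential moments of truncated arrivals. For the upper bound, \<open>Ion\<close> well below \<open>x / \<mu>\<close> is excluded by the
  law of large numbers when it is of order \<open>x\<close>, and by a Chernoff bound of order \<open>(Ion / x)\<^sup>k\<close> with large \<open>k\<close> when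
  it is much smaller, unless a single batch is of order \<open>x\<close>, which is negligible by hypothesis on \<open>Y\<close>.
\<close>

section \<open>Consistently varying tails\<close>

text \<open>The obstacle in the drift inequality is the mass just below a level c: there
  \<open>T (c - l)\<close> is of order \<open>T 0\<close>, and the boundary term
  \<open>b (U c - U (c + b))\<close> is not small against \<open>T K\<close> either, so a single
  level gives no sharp bound. Over m levels of spacing b each state is close to at most one of the
  levels above it, and the boundary terms telescope; both effects then cost only
  \<open>(T 0 + b) / m + T b\<close> times a tail mass, and this factor is as small as desired. All
  constants are free of \<open>K\<close>. For the net input, batches have only a finite mean, so
  exponential moments exist only after truncation. The Chernoff exponent k is one more than an
  exponent p for which \<open>y^p P (Ion > y)\<close> is almost increasing. The truncated moment
  \<open>E (Ion^k; Ion \<le> \<eta> x)\<close> is then at most a constant times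
  \<open>\<eta> x^k P (Ion > x)\<close>, and the remaining factor \<open>\<eta>\<close> makes this
  range negligible. Batches of size at least 1 make the net input monotone in \<open>Ion\<close>, so
  that a random on-period can be compared with a fixed number of slots, which is independent of
  \<open>Ion\<close>.\<close>

definition cons_var :: "(real \<Rightarrow> real) \<Rightarrow> bool" where
  "cons_var F \<longleftrightarrow> (\<forall>\<epsilon>>0. \<exists>v>1. \<forall>\<^sub>F x in at_top. F x \<le> (1 + \<epsilon>) * F (v * x))"

lemma cons_varD:
  assumes "cons_var F" "\<epsilon> > 0"
  obtains v where "v > 1" "\<forall>\<^sub>F x in at_top. F x \<le> (1 + \<epsilon>) * F (v * x)"
  using assms unfolding cons_var_def by blast

lemma eventually_at_top_scale:
  assumes "(c::real) > 0" "\<forall>\<^sub>F x in at_top. P x"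
  shows "\<forall>\<^sub>F x in at_top. P (c * x)"
  using assms(2) filterlim_tendsto_pos_mult_at_top[OF tendsto_const assms(1) filterlim_ident]
  by (auto simp: filterlim_iff)

text \<open>One v per tolerance is all that later arguments use, and the product form avoids
  quotients: it survives rescaling, integration of tails, and passage to an asymptotically equal
  function.\<close>

lemma consistent_variation_imp_cons_var:
  assumes "consistent_variation M X"
  shows "cons_var (rv_tail M X)"
  unfolding cons_var_def
proof (intro allI impI)
  fix \<epsilon> :: real assume e: "\<epsilon> > 0"
  let ?F = "rv_tail M X"
  have pos: "?F x > 0" for x
    using assms by (auto simp: consistent_variation_def positive_tail_def)
  have "((\<lambda>v. Liminf at_top (\<lambda>x. ereal (?F (v * x) / ?F x))) \<longlongrightarrow> ereal 1) (at_right 1)"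
    using assms by (simp add: consistent_variation_def)
  moreover have "ereal (1 / (1 + \<epsilon>)) < ereal 1"
    using e by simp
  ultimately have "\<forall>\<^sub>F v in at_right 1. ereal (1 / (1 + \<epsilon>)) < Liminf at_top (\<lambda>x. ereal (?F (v * x) / ?F x))"
    by (rule order_tendstoD(1))
  then obtain b where b: "b > 1"
    "\<And>v. v > 1 \<Longrightarrow> v < b \<Longrightarrow> ereal (1 / (1 + \<epsilon>)) < Liminf at_top (\<lambda>x. ereal (?F (v * x) / ?F x))"
    unfolding eventually_at_right_field by blast
  define v where "v = (1 + b) / 2"
  have v: "v > 1" "v < b" using b(1) by (auto simp: v_def)
  from less_LiminfD[OF b(2)[OF v]]
  have "\<forall>\<^sub>F x in at_top. 1 / (1 + \<epsilon>) < ?F (v * x) / ?F x" by simp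
  then have "\<forall>\<^sub>F x in at_top. ?F x \<le> (1 + \<epsilon>) * ?F (v * x)"
  proof eventually_elim
    case (elim x)
    then show ?case using e pos[of x] by (simp add: field_simps)
  qed
  with v show "\<exists>v>1. \<forall>\<^sub>F x in at_top. ?F x \<le> (1 + \<epsilon>) * ?F (v * x)" by blast
qed

text \<open>Dominated variation: iterating one step of ratio v, which costs a factor 2, until
  \<open>v ^ n\<close> exceeds c costs only the fixed factor \<open>2 ^ n\<close>.\<close>

lemma cons_var_dominated:
  assumes "cons_var F" "antimono F" "\<And>x. F x \<ge> 0"
  obtains \<kappa> where "\<kappa> > 0" "\<forall>\<^sub>F x in at_top. F x \<le> \<kappa> * F (c * x)"
proof -
  obtain v where v: "v > 1" "\<forall>\<^sub>F x in at_top. F x \<le> (1 + 1) * F (v * x)"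
    using cons_varD[OF assms(1), of 1] by auto
  have ev: "\<forall>\<^sub>F x in at_top. F x \<le> 2 ^ n * F (v ^ n * x)" for n
  proof (induction n)
    case (Suc n)
    have "\<forall>\<^sub>F x in at_top. F (v ^ n * x) \<le> 2 * F (v * (v ^ n * x))"
      using eventually_at_top_scale[OF _ v(2), of "v ^ n"] v(1) by simp
    with Suc show ?case
    proof eventually_elim
      case (elim x)
      have "F x \<le> 2 ^ n * (2 * F (v * (v ^ n * x)))"
        using elim by (meson mult_left_mono order_trans zero_le_numeral zero_le_power)
      then show ?case by (simp add: mult_ac)
    qed
  qed simp
  obtain n where n: "c < v ^ n" using real_arch_pow[OF v(1)] by blast
  have "\<forall>\<^sub>F x in at_top. F x \<le> 2 ^ n * F (c * x)"
    using ev[of n] eventually_ge_at_top[of 0]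
  proof eventually_elim
    case (elim x)
    have "c * x \<le> v ^ n * x" using n elim by (intro mult_right_mono) auto
    then have "F (v ^ n * x) \<le> F (c * x)" using assms(2) by (auto simp: antimono_def)
    then have "2 ^ n * F (v ^ n * x) \<le> 2 ^ n * F (c * x)" by simp
    with elim show ?case by linarith
  qed
  then show ?thesis using that[of "2 ^ n"] by simp
qed

text \<open>Long-tailedness: a fixed shift is eventually absorbed by a dilation, since
  \<open>x \<le> v * (x - r)\<close> as soon as \<open>x \<ge> v * r / (v - 1)\<close>.\<close>

lemma cons_var_shift:
  assumes "cons_var F" "antimono F" "\<And>x. F x \<ge> 0" "\<epsilon> > 0"
  shows "\<forall>\<^sub>F x in at_top. F (x - r) \<le> (1 + \<epsilon>) * F x"
proof -
  obtain v where v: "v > 1" "\<forall>\<^sub>F x in at_top. F x \<le> (1 + \<epsilon>) * F (v * x)"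
    using cons_varD[OF assms(1,4)] by blast
  have "filterlim (\<lambda>x::real. - r + x) at_top at_top"
    by (intro filterlim_tendsto_add_at_top[OF tendsto_const] filterlim_ident)
  then have "\<forall>\<^sub>F x in at_top. F (- r + x) \<le> (1 + \<epsilon>) * F (v * (- r + x))"
    using v(2) by (auto simp: filterlim_iff)
  then show ?thesis using eventually_ge_at_top[of "v * r / (v - 1)"]
  proof eventually_elim
    case (elim x)
    have "x \<le> v * (- r + x)" using elim(2) v(1) by (simp add: field_simps)
    then have "F (v * (- r + x)) \<le> F x" using assms(2) by (auto simp: antimono_def)
    then have "(1 + \<epsilon>) * F (v * (- r + x)) \<le> (1 + \<epsilon>) * F x" using assms(4) by simp
    with elim(1) show ?case by simp
  qed
qed

text \<open>A Potter-type bound: doubling the argument divides \<open>F\<close> by at most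
  \<open>\<kappa>\<close>, while the power gains \<open>2 ^ p > \<kappa>\<close>. Hence
  \<open>z ^ p * F z\<close> is increasing up to a constant, which lets truncated moments of order
  above p be read off at their upper end.\<close>

lemma cons_var_potter:
  assumes "cons_var F" "antimono F" "\<And>x. F x > 0" "\<And>x. F x \<le> 1"
  shows "\<exists>p C. C > 0 \<and> (\<forall>y z. 0 \<le> y \<longrightarrow> y \<le> z \<longrightarrow> 1 \<le> z \<longrightarrow> y ^ p * F y \<le> C * (z ^ p * F z))"
proof -
  have nn: "F x \<ge> 0" for x using assms(3)[of x] by simp
  have mono: "F y \<le> F x" if "x \<le> y" for x y using assms(2) that by (auto simp: antimono_def)
  obtain \<kappa> where k: "\<kappa> > 0" "\<forall>\<^sub>F x in at_top. F x \<le> \<kappa> * F (2 * x)"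
    using cons_var_dominated[OF assms(1,2) nn] by blast
  then obtain z1 where "\<And>x. x \<ge> z1 \<Longrightarrow> F x \<le> \<kappa> * F (2 * x)"
    unfolding eventually_at_top_linorder by blast
  then obtain z0 where z0: "z0 \<ge> 1" "\<And>x. x \<ge> z0 \<Longrightarrow> F x \<le> \<kappa> * F (2 * x)"
    by (metis max.cobounded1 max.cobounded2 order_trans)
  obtain p where p: "\<kappa> < 2 ^ p" using real_arch_pow[of 2 \<kappa>] by auto
  \<comment> \<open>Full doublings cost nothing, so the factor does not depend on n; the single
    \<open>2 ^ p\<close> pays for the last, incomplete doubling.\<close>
  have large: "y ^ p * F y \<le> 2 ^ p * (z ^ p * F z)" if "z0 \<le> y" "y \<le> z" "z \<le> 2 ^ n * y" for y z n
    using that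
  proof (induction n arbitrary: y)
    case 0
    then have "z = y" by simp
    moreover have "1 * (y ^ p * F y) \<le> 2 ^ p * (y ^ p * F y)"
      using nn[of y] z0(1) 0 by (intro mult_right_mono) auto
    ultimately show ?case by simp
  next
    case (Suc n)
    have y: "y \<ge> 1" using Suc.prems z0 by linarith
    show ?case
    proof (cases "z \<le> 2 * y")
      case True
      have "F y \<le> \<kappa> * F (2 * y)" using z0(2) Suc.prems by simp
      also have "\<dots> \<le> 2 ^ p * F z" using p k(1) True mono[of z "2*y"] nn by (intro mult_mono) auto
      finally have "y ^ p * F y \<le> z ^ p * (2 ^ p * F z)"
        using y Suc.prems nn by (intro mult_mono power_mono) auto
      then show ?thesis by (simp add: mult_ac)
    next
      case False
      have "F y \<le> \<kappa> * F (2 * y)" using z0(2) Suc.prems by simp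
      also have "\<dots> \<le> 2 ^ p * F (2 * y)" using p nn by (intro mult_right_mono) auto
      finally have "y ^ p * F y \<le> y ^ p * (2 ^ p * F (2 * y))"
        using y by (intro mult_left_mono) auto
      also have "\<dots> = (2 * y) ^ p * F (2 * y)" by (simp add: power_mult_distrib)
      also have "\<dots> \<le> 2 ^ p * (z ^ p * F z)"
        using Suc.prems False y by (intro Suc.IH) auto
      finally show ?thesis .
    qed
  qed
  have large': "y ^ p * F y \<le> 2 ^ p * (z ^ p * F z)" if "z0 \<le> y" "y \<le> z" for y z
  proof -
    obtain n where "z / y < 2 ^ n" using real_arch_pow[of 2 "z / y"] by auto
    then have "z \<le> 2 ^ n * y" using that z0 by (simp add: field_simps)
    then show ?thesis using large that by blast
  qed
  \<comment> \<open>Large enough for all three positions of y and z relative to \<open>z0\<close>.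
    When both lie below it, \<open>y ^ p * F y \<le> z0 ^ p\<close>, whereas
    \<open>z ^ p * F z \<ge> F z0\<close> because \<open>z \<ge> 1\<close>.\<close>
  define C where "C = 2 ^ p * z0 ^ p / F z0"
  have z0p: "z0 ^ p \<ge> 1" using z0(1) by simp
  have C: "C > 0" using assms(3)[of z0] z0 by (auto simp: C_def)
  have small: "y ^ p * F y \<le> z0 ^ p" if "0 \<le> y" "y \<le> z0" for y
    using mult_mono[of "y ^ p" "z0 ^ p" "F y" 1] that assms(4)[of y] nn[of y] power_mono[of y z0 p]
    by (smt (verit, best) mult_cancel_left2 zero_le_power)
  have "y ^ p * F y \<le> C * (z ^ p * F z)" if yz: "0 \<le> y" "y \<le> z" "1 \<le> z" for y z
  proof -
    have zF: "z ^ p * F z \<ge> 0" using yz nn by simp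
    consider "z0 \<le> y" | "y \<le> z0" "z0 \<le> z" | "z \<le> z0" using yz by linarith
    then show ?thesis
    proof cases
      case 1
      have "1 \<le> z0 ^ p / F z0" using z0p assms(3,4)[of z0] by (simp add: field_simps)
      then have "2 ^ p * 1 \<le> 2 ^ p * (z0 ^ p / F z0)" by (intro mult_left_mono) auto
      then have "2 ^ p * (z ^ p * F z) \<le> C * (z ^ p * F z)"
        using zF by (intro mult_right_mono) (auto simp: C_def)
      with large'[OF 1 yz(2)] show ?thesis by linarith
    next
      case 2
      have "y ^ p * F y \<le> z0 ^ p" using small yz 2 by simp
      also have "\<dots> = (z0 ^ p * F z0) / F z0" using assms(3)[of z0] by simp
      also have "\<dots> \<le> (2 ^ p * (z ^ p * F z)) / F z0"
        using large'[of z0 z] 2 assms(3)[of z0] by (intro divide_right_mono) auto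
      also have "\<dots> = 1 * (2 ^ p * (z ^ p * F z) / F z0)" by simp
      also have "\<dots> \<le> z0 ^ p * (2 ^ p * (z ^ p * F z) / F z0)"
        using z0p zF assms(3)[of z0] by (intro mult_right_mono) auto
      finally show ?thesis by (simp add: C_def mult_ac)
    next
      case 3
      have "y ^ p * F y \<le> z0 ^ p" using small yz 3 by simp
      also have "\<dots> = z0 ^ p / F z0 * (1 * F z0)" using assms(3)[of z0] by simp
      also have "\<dots> \<le> z0 ^ p / F z0 * (z ^ p * F z)"
        using yz 3 mono[of z z0] nn z0p assms(3)[of z0] by (intro mult_left_mono mult_mono) auto
      also have "\<dots> \<le> 2 ^ p * (z0 ^ p / F z0 * (z ^ p * F z))"
        using mult_right_mono[of 1 "2 ^ p" "z0 ^ p / F z0 * (z ^ p * F z)"] zF z0p assms(3)[of z0] by simp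
      finally show ?thesis by (simp add: C_def mult_ac)
    qed
  qed
  with C show ?thesis by blast
qed

lemma cons_var_scale:
  assumes F: "cons_var F" and c: "c > 0"
  shows "cons_var (\<lambda>x. F (c * x))"
  unfolding cons_var_def
proof (intro allI impI)
  fix \<epsilon> :: real assume "\<epsilon> > 0"
  then obtain v where v: "v > 1" "\<forall>\<^sub>F x in at_top. F x \<le> (1 + \<epsilon>) * F (v * x)"
    using cons_varD[OF F] by blast
  from eventually_at_top_scale[OF c v(2)]
  have "\<forall>\<^sub>F x in at_top. F (c * x) \<le> (1 + \<epsilon>) * F (c * (v * x))"
    by (simp only: mult.left_commute)
  with v(1) show "\<exists>v>1. \<forall>\<^sub>F x in at_top. F (c * x) \<le> (1 + \<epsilon>) * F (c * (v * x))" by blast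
qed

lemma cons_var_asymp:
  assumes G: "cons_var G" and nn: "\<And>x. T x \<ge> 0"
    and TG: "\<And>\<epsilon>. \<epsilon> > 0 \<Longrightarrow> \<forall>\<^sub>F x in at_top. T x \<le> (1 + \<epsilon>) * G x"
    and GT: "\<And>\<epsilon>. \<epsilon> > 0 \<Longrightarrow> \<forall>\<^sub>F x in at_top. G x \<le> (1 + \<epsilon>) * T x"
  shows "cons_var T"
  unfolding cons_var_def
proof (intro allI impI)
  fix \<epsilon> :: real assume \<epsilon>: "\<epsilon> > 0"
  \<comment> \<open>For e at most 1 the three comparisons together cost
    \<open>(1 + e)^3 \<le> 1 + 7 e\<close>.\<close>
  define e where "e = min 1 (\<epsilon> / 7)"
  have e: "e > 0" "(1 + e) * ((1 + e) * (1 + e)) \<le> 1 + \<epsilon>"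
  proof -
    show "e > 0" using \<epsilon> by (simp add: e_def)
    have "e \<le> 1" "e \<le> \<epsilon> / 7" by (auto simp: e_def)
    moreover have "e * e \<le> e * 1" "e * (e * e) \<le> e * (1 * 1)"
      using \<open>e > 0\<close> \<open>e \<le> 1\<close> by (intro mult_left_mono mult_mono; simp)+
    ultimately show "(1 + e) * ((1 + e) * (1 + e)) \<le> 1 + \<epsilon>" by (simp add: algebra_simps)
  qed
  obtain v where v: "v > 1" "\<forall>\<^sub>F x in at_top. G x \<le> (1 + e) * G (v * x)"
    using cons_varD[OF G e(1)] by blast
  have "\<forall>\<^sub>F x in at_top. G (v * x) \<le> (1 + e) * T (v * x)"
    using v(1) by (intro eventually_at_top_scale[OF _ GT[OF e(1)]]) auto
  with v(2) TG[OF e(1)] have "\<forall>\<^sub>F x in at_top. T x \<le> (1 + \<epsilon>) * T (v * x)"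
  proof eventually_elim
    case (elim x)
    have "T x \<le> (1 + e) * ((1 + e) * ((1 + e) * T (v * x)))"
      using elim e(1) by (meson add_pos_pos mult_left_mono less_imp_le order_trans zero_less_one)
    also have "\<dots> = ((1 + e) * ((1 + e) * (1 + e))) * T (v * x)" by (simp only: mult.assoc)
    also have "\<dots> \<le> (1 + \<epsilon>) * T (v * x)" by (rule mult_right_mono[OF e(2) nn])
    finally show ?case .
  qed
  with v(1) show "\<exists>v>1. \<forall>\<^sub>F x in at_top. T x \<le> (1 + \<epsilon>) * T (v * x)" by blast
qed

section \<open>Stop-loss transforms\<close>

text \<open>Two readings make this the central quantity: it is the integrated tail of X beyond x,
  hence the equilibrium tail without its normalisation, and for X the net input it is the mean
  overflow of one on-period that starts with x free places.\<close>

definition stop_loss :: "'a measure \<Rightarrow> ('a \<Rightarrow> real) \<Rightarrow> real \<Rightarrow> real" where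
  "stop_loss M X x = (\<integral>\<omega>. max 0 (X \<omega> - x) \<partial>M)"

context prob_space
begin

lemma rv_tail_nonneg: "rv_tail M X x \<ge> 0"
  and rv_tail_le_1: "rv_tail M X x \<le> 1"
  by (simp_all add: rv_tail_def)

lemma antimono_rv_tail:
  assumes [measurable]: "random_variable borel X"
  shows "antimono (rv_tail M X)"
  unfolding antimono_def rv_tail_def by (auto intro!: finite_measure_mono)

lemma measurable_rv_tail:
  assumes "random_variable borel X"
  shows "rv_tail M X \<in> borel_measurable borel"
proof -
  have "mono (\<lambda>z. - rv_tail M X z)"
    using antimono_rv_tail[OF assms] by (auto simp: mono_def antimono_def)
  then have "(\<lambda>z. - rv_tail M X z) \<in> borel_measurable borel"
    by (rule borel_measurable_mono)
  then have "(\<lambda>z. - (- rv_tail M X z)) \<in> borel_measurable borel"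
    by (rule borel_measurable_uminus)
  then show ?thesis by simp
qed

lemma integrable_stop_loss:
  fixes X :: "'a \<Rightarrow> real"
  assumes "integrable M X"
  shows "integrable M (\<lambda>\<omega>. max 0 (X \<omega> - x))"
  by (intro integrable_max integrable_const Bochner_Integration.integrable_diff assms)

text \<open>Tonelli on the region \<open>x \<le> z < X\<close>. Staying in the extended nonnegative
  reals leaves measurability as the only condition.\<close>

lemma stop_loss_layer_cake:
  assumes [measurable]: "random_variable borel X"
  shows "(\<integral>\<^sup>+\<omega>. ennreal (max 0 (X \<omega> - x)) \<partial>M)
       = (\<integral>\<^sup>+z. indicator {x..} z * ennreal (rv_tail M X z) \<partial>lborel)"
proof -
  interpret P: pair_sigma_finite M lborel ..
  have "(\<integral>\<^sup>+\<omega>. ennreal (max 0 (X \<omega> - x)) \<partial>M)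
      = (\<integral>\<^sup>+\<omega>. (\<integral>\<^sup>+z. indicator {x..<X \<omega>} z \<partial>lborel) \<partial>M)"
    by (intro nn_integral_cong) (auto simp: max_def)
  also have "\<dots> = (\<integral>\<^sup>+\<omega>. (\<integral>\<^sup>+z. indicator {x..} z * indicator {p \<in> space M \<times> UNIV. snd p < X (fst p)} (\<omega>, z) \<partial>lborel) \<partial>M)"
    by (intro nn_integral_cong) (auto split: split_indicator)
  also have "\<dots> = (\<integral>\<^sup>+z. (\<integral>\<^sup>+\<omega>. indicator {x..} z * indicator {p \<in> space M \<times> UNIV. snd p < X (fst p)} (\<omega>, z) \<partial>M) \<partial>lborel)"
  proof -
    have *: "{p \<in> space M \<times> UNIV. snd p < X (fst p)} = {p \<in> space (M \<Otimes>\<^sub>M lborel). snd p < X (fst p)}"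
      by (simp add: space_pair_measure)
    have [measurable]: "{p \<in> space M \<times> UNIV. snd p < X (fst p)} \<in> sets (M \<Otimes>\<^sub>M lborel)"
      unfolding * by measurable
    show ?thesis by (intro P.Fubini'[symmetric]) measurable
  qed
  also have "\<dots> = (\<integral>\<^sup>+z. indicator {x..} z * ennreal (rv_tail M X z) \<partial>lborel)"
  proof (intro nn_integral_cong)
    fix z
    have "(\<integral>\<^sup>+\<omega>. indicator {p \<in> space M \<times> UNIV. snd p < X (fst p)} (\<omega>, z) \<partial>M)
        = (\<integral>\<^sup>+\<omega>. indicator {\<omega> \<in> space M. X \<omega> > z} \<omega> \<partial>M)"
      by (intro nn_integral_cong) (auto split: split_indicator)
    also have "\<dots> = ennreal (rv_tail M X z)"
      by (subst nn_integral_indicator) (auto simp: rv_tail_def emeasure_eq_measure)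
    finally show "(\<integral>\<^sup>+\<omega>. indicator {x..} z * indicator {p \<in> space M \<times> UNIV. snd p < X (fst p)} (\<omega>, z) \<partial>M)
       = indicator {x..} z * ennreal (rv_tail M X z)"
      by (auto split: split_indicator)
  qed
  finally show ?thesis .
qed

lemma stop_loss_nonneg: "stop_loss M X x \<ge> 0"
  by (simp add: stop_loss_def)

lemma ennreal_stop_loss:
  assumes "integrable M X"
  shows "ennreal (stop_loss M X x) = (\<integral>\<^sup>+z. indicator {x..} z * ennreal (rv_tail M X z) \<partial>lborel)"
proof -
  have "X \<in> borel_measurable M" using assms by auto
  then show ?thesis
    unfolding stop_loss_def
    by (subst nn_integral_eq_integral[OF integrable_stop_loss[OF assms], symmetric])
       (simp_all only: stop_loss_layer_cake, simp)
qed

text \<open>Only tails on \<open>[x, \<infinity>)\<close> enter the layer-cake integral, so an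
  eventual tail inequality is inherited with the same constant.\<close>

lemma stop_loss_mono_tail:
  assumes X: "integrable M X" and Z: "integrable M Z" and c: "c \<ge> 0"
    and le: "\<And>z. z \<ge> x \<Longrightarrow> rv_tail M X z \<le> c * rv_tail M Z z"
  shows "stop_loss M X x \<le> c * stop_loss M Z x"
proof -
  have [measurable]: "Z \<in> borel_measurable M" using Z by auto
  have [measurable]: "rv_tail M Z \<in> borel_measurable borel" by (intro measurable_rv_tail) simp
  have "ennreal (stop_loss M X x) \<le> (\<integral>\<^sup>+z. ennreal c * (indicator {x..} z * ennreal (rv_tail M Z z)) \<partial>lborel)"
    unfolding ennreal_stop_loss[OF X]
    using le c by (intro nn_integral_mono)
      (auto split: split_indicator simp: ennreal_mult[symmetric] rv_tail_nonneg intro!: ennreal_leI)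
  also have "\<dots> = ennreal c * ennreal (stop_loss M Z x)"
    unfolding ennreal_stop_loss[OF Z] by (subst nn_integral_cmult) auto
  also have "\<dots> = ennreal (c * stop_loss M Z x)"
    using c by (simp add: ennreal_mult stop_loss_nonneg)
  finally show ?thesis using c stop_loss_nonneg by (simp add: ennreal_le_iff)
qed

lemma stop_loss_tail_le:
  assumes X: "integrable M X" and Z: "integrable M Z" and \<epsilon>: "\<epsilon> > 0"
    and le: "\<forall>\<^sub>F x in at_top. rv_tail M X x \<le> (1 + \<epsilon>) * rv_tail M Z x"
  shows "\<forall>\<^sub>F x in at_top. stop_loss M X x \<le> (1 + \<epsilon>) * stop_loss M Z x"
proof -
  obtain x0 where "\<And>x. x \<ge> x0 \<Longrightarrow> rv_tail M X x \<le> (1 + \<epsilon>) * rv_tail M Z x"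
    using le unfolding eventually_at_top_linorder by blast
  then have "stop_loss M X x \<le> (1 + \<epsilon>) * stop_loss M Z x" if "x \<ge> x0" for x
    using that \<epsilon> by (intro stop_loss_mono_tail[OF X Z]) auto
  then show ?thesis unfolding eventually_at_top_linorder by blast
qed

lemma antimono_stop_loss:
  assumes "integrable M X"
  shows "antimono (stop_loss M X)"
  unfolding antimono_def stop_loss_def
  by (auto intro!: integral_mono integrable_stop_loss assms)

lemma stop_loss_pos:
  assumes X: "integrable M X" and pos: "positive_tail M X"
  shows "stop_loss M X x > 0"
proof -
  have [measurable]: "X \<in> borel_measurable M" using X by auto
  have "0 < rv_tail M X (x + 1)" using pos by (simp add: positive_tail_def)
  also have "\<dots> = (\<integral>\<omega>. indicator {\<omega> \<in> space M. X \<omega> > x + 1} \<omega> \<partial>M)"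
    by (simp add: rv_tail_def Int_absorb2)
  also have "\<dots> \<le> stop_loss M X x"
    unfolding stop_loss_def
    by (intro integral_mono integrable_stop_loss X)
       (auto split: split_indicator simp: emeasure_eq_measure)
  finally show ?thesis .
qed

lemma stop_loss_tendsto_0:
  assumes X: "integrable M X"
  shows "(stop_loss M X \<longlongrightarrow> 0) at_top"
proof -
  have [measurable]: "X \<in> borel_measurable M" using X by auto
  have "((\<lambda>x. \<integral>\<omega>. max 0 (X \<omega> - x) \<partial>M) \<longlongrightarrow> (\<integral>\<omega>. 0 \<partial>M)) at_top"
  proof (rule integral_dominated_convergence_at_top[where w="\<lambda>\<omega>. \<bar>X \<omega>\<bar>"])
    show "\<forall>\<^sub>F x in at_top. AE \<omega> in M. norm (max 0 (X \<omega> - x)) \<le> \<bar>X \<omega>\<bar>"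
      using eventually_ge_at_top[of 0] by eventually_elim auto
    show "AE \<omega> in M. ((\<lambda>x. max 0 (X \<omega> - x)) \<longlongrightarrow> 0) at_top"
    proof (intro AE_I2)
      fix \<omega>
      show "((\<lambda>x. max 0 (X \<omega> - x)) \<longlongrightarrow> 0) at_top"
        by (rule tendsto_eventually) (use eventually_ge_at_top[of "X \<omega>"] in eventually_elim, auto)
    qed
  qed (use X in auto)
  then show ?thesis by (simp add: stop_loss_def[abs_def])
qed

text \<open>The tail inequality compares X with \<open>X / v\<close>, and the transform of
  \<open>X / v\<close> at x is that of X at \<open>v * x\<close> divided by v; the division can only
  help.\<close>

lemma cons_var_stop_loss:
  assumes X: "integrable M X" and cv: "cons_var (rv_tail M X)"
  shows "cons_var (stop_loss M X)"
  unfolding cons_var_def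
proof (intro allI impI)
  fix \<epsilon> :: real assume e: "\<epsilon> > 0"
  obtain v where v: "v > 1" "\<forall>\<^sub>F x in at_top. rv_tail M X x \<le> (1 + \<epsilon>) * rv_tail M X (v * x)"
    using cons_varD[OF cv e] by blast
  then obtain x0 where x0: "\<And>x. x \<ge> x0 \<Longrightarrow> rv_tail M X x \<le> (1 + \<epsilon>) * rv_tail M X (v * x)"
    unfolding eventually_at_top_linorder by blast
  have "stop_loss M X x \<le> (1 + \<epsilon>) * stop_loss M X (v * x)" if x: "x \<ge> x0" for x
  proof -
    have "stop_loss M X x \<le> (1 + \<epsilon>) * stop_loss M (\<lambda>\<omega>. X \<omega> / v) x"
    proof (rule stop_loss_mono_tail)
      fix z assume "z \<ge> x"
      moreover have "rv_tail M (\<lambda>\<omega>. X \<omega> / v) z = rv_tail M X (v * z)"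
        using v(1) by (simp add: rv_tail_def field_simps)
      ultimately show "rv_tail M X z \<le> (1 + \<epsilon>) * rv_tail M (\<lambda>\<omega>. X \<omega> / v) z"
        using x0[of z] x by simp
    qed (use e X in auto)
    also have "stop_loss M (\<lambda>\<omega>. X \<omega> / v) x \<le> stop_loss M X (v * x)"
      unfolding stop_loss_def
    proof (intro integral_mono)
      fix \<omega>
      have "max 0 (X \<omega> - v * x) = v * max 0 (X \<omega> / v - x)"
        using v(1) by (auto simp: max_def field_simps)
      then show "max 0 (X \<omega> / v - x) \<le> max 0 (X \<omega> - v * x)"
        using v(1) by (simp add: mult_le_cancel_right1)
    qed (use X in auto)
    finally show ?thesis using e by simp
  qed
  then show "\<exists>v>1. \<forall>\<^sub>F x in at_top. stop_loss M X x \<le> (1 + \<epsilon>) * stop_loss M X (v * x)"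
    using v(1) unfolding eventually_at_top_linorder by blast
qed

text \<open>Splitting the layer-cake integral for the mean at x turns the complement used in
  \<open>equilibrium_tail\<close> into the integral over the far tail.\<close>

lemma stop_loss_equilibrium_tail:
  assumes X: "integrable M X" and nn: "\<And>\<omega>. \<omega> \<in> space M \<Longrightarrow> X \<omega> \<ge> 0"
    and mean: "expectation X > 0" and x: "x \<ge> 0"
  shows "expectation X * equilibrium_tail M X x = stop_loss M X x"
proof -
  let ?F = "rv_tail M X"
  have [measurable]: "X \<in> borel_measurable M" using X by auto
  have [measurable]: "?F \<in> borel_measurable borel" by (intro measurable_rv_tail) simp
  have E: "stop_loss M X 0 = expectation X"
    unfolding stop_loss_def using nn by (intro Bochner_Integration.integral_cong) auto
  have "set_integrable lborel {0..x} ?F"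
    unfolding set_integrable_def real_scaleR_def
  proof (rule Bochner_Integration.integrable_bound)
    show "integrable lborel (indicat_real {0..x})"
      by (rule integrable_real_indicator) (simp_all add: x)
  qed (auto simp: rv_tail_nonneg rv_tail_le_1 split: split_indicator)
  then have I: "ennreal (\<integral>y\<in>{0..x}. ?F y \<partial>lborel) = (\<integral>\<^sup>+y. ennreal (indicator {0..x} y * ?F y) \<partial>lborel)"
    unfolding set_lebesgue_integral_def set_integrable_def real_scaleR_def
    by (intro nn_integral_eq_integral[symmetric]) (auto simp: rv_tail_nonneg)
  have Inn: "(\<integral>y\<in>{0..x}. ?F y \<partial>lborel) \<ge> 0"
    unfolding set_lebesgue_integral_def by (intro integral_nonneg_AE) (auto simp: rv_tail_nonneg)
  have "ennreal (stop_loss M X 0)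
      = (\<integral>\<^sup>+y. ennreal (indicator {0..x} y * ?F y) + indicator {x..} y * ennreal (?F y) \<partial>lborel)"
    unfolding ennreal_stop_loss[OF X]
  proof (rule nn_integral_cong_AE)
    \<comment> \<open>The ranges \<open>[0, x]\<close> and \<open>[x, \<infinity>)\<close> overlap
      in the null set \<open>{x}\<close>.\<close>
    have "AE y in lborel. y \<noteq> x" by (rule AE_lborel_singleton)
    then show "AE y in lborel. indicator {0..} y * ennreal (?F y) =
      ennreal (indicator {0..x} y * ?F y) + indicator {x..} y * ennreal (?F y)"
    proof eventually_elim
      case (elim y)
      then show ?case using x by (auto split: split_indicator)
    qed
  qed
  also have "\<dots> = ennreal (\<integral>y\<in>{0..x}. ?F y \<partial>lborel) + ennreal (stop_loss M X x)"
    unfolding I ennreal_stop_loss[OF X] by (subst nn_integral_add) auto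
  finally have "stop_loss M X 0 = (\<integral>y\<in>{0..x}. ?F y \<partial>lborel) + stop_loss M X x"
    using Inn stop_loss_nonneg[of X] by (simp add: ennreal_plus[symmetric] del: ennreal_plus)
  then show ?thesis
    using mean unfolding E equilibrium_tail_def by (simp add: field_simps)
qed

end

section \<open>A drift inequality and its consequences\<close>

text \<open>Wherever l lies, the distances to the levels above it are spaced by b, so the i-th of
  them is at least \<open>i * b\<close>. The bound is therefore free of l and c; levels not above l
  are dropped one at a time by the induction.\<close>

lemma sum_translates_le:
  fixes T :: "real \<Rightarrow> real"
  assumes T: "antimono T" "\<And>x. T x \<ge> 0"
  shows "(\<Sum>i<m. if l < c + i * b then T (real (c + i * b) - real l) else 0) \<le> (\<Sum>i<m. T (real (i * b)))"
proof (induction m arbitrary: c)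
  case (Suc m)
  show ?case
  proof (cases "l < c")
    case True
    show ?thesis
    proof (intro sum_mono)
      fix i
      have "real (i * b) \<le> real (c + i * b) - real l" using True by simp
      then show "(if l < c + i * b then T (real (c + i * b) - real l) else 0) \<le> T (real (i * b))"
        using T by (auto simp: antimono_def)
    qed
  next
    case False
    have "(\<Sum>i<Suc m. if l < c + i * b then T (real (c + i * b) - real l) else 0)
        = (\<Sum>i<m. if l < (c + b) + i * b then T (real ((c + b) + i * b) - real l) else 0)"
    proof -
      have "c + Suc i * b = (c + b) + i * b" for i by simp
      then show ?thesis using False by (simp only: sum.lessThan_Suc_shift) simp
    qed
    also have "\<dots> \<le> (\<Sum>i<m. T (real (i * b)))" by (rule Suc.IH)
    also have "\<dots> \<le> (\<Sum>i<Suc m. T (real (i * b)))" using T(2) by simp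
    finally show ?thesis .
  qed
qed simp

text \<open>Averaging the drift inequality over the levels \<open>c, c + b, \<dots>, c + (m - 1) b\<close> telescopes its
  boundary term and smears out the mass that sits just below a single level.\<close>

lemma drift_average:
  fixes T :: "real \<Rightarrow> real" and p :: "nat \<Rightarrow> real" and K :: nat
  defines "U \<equiv> \<lambda>c. \<Sum>l\<in>{c..K}. p l"
  assumes T: "antimono T" "\<And>x. T x \<ge> 0" and p: "\<And>l. l \<le> K \<Longrightarrow> p l \<ge> 0" and \<delta>: "\<delta> \<ge> 0"
    and m: "m \<ge> 1" "T 0 + real b + real m * T (real b) \<le> real m * \<epsilon>" and yc: "y \<le> c"
    and drift: "\<And>i. i < m \<Longrightarrow> V + \<delta> * U (c + i * b)
        \<le> (\<Sum>l\<in>{..K} \<inter> {..<c + i * b}. p l * T (real (c + i * b) - real l))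
          + real b * (U (c + i * b) - U (c + i * b + b))"
  shows "V + \<delta> * U (c + m * b) \<le> (\<Sum>l\<in>{..K} \<inter> {..<y}. p l * T (real c - real l)) + \<epsilon> * U y"
proof -
  have U_mono: "U c' \<le> U c" if "c \<le> c'" for c c'
    unfolding U_def using that p by (intro sum_mono2) auto
  have U_nn: "U c \<ge> 0" for c unfolding U_def using p by (intro sum_nonneg) auto
  let ?X = "\<Sum>l\<in>{..K} \<inter> {..<y}. p l * T (real c - real l)"
  \<comment> \<open>States below y keep their own distance to the lowest level c. States from y on
    may lie near some level and are bounded collectively, at the price of their whole mass
    \<open>U y\<close>.\<close>
  have inner: "(\<Sum>i<m. \<Sum>l\<in>{..K} \<inter> {..<c + i * b}. p l * T (real (c + i * b) - real l))
      \<le> real m * ?X + U y * (\<Sum>i<m. T (real (i * b)))"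
  proof -
    have "(\<Sum>i<m. \<Sum>l\<in>{..K} \<inter> {..<c + i * b}. p l * T (real (c + i * b) - real l))
        = (\<Sum>i<m. \<Sum>l\<le>K. p l * (if l < c + i * b then T (real (c + i * b) - real l) else 0))"
      by (simp only: sum.inter_restrict[OF finite_atMost]) (auto intro!: sum.cong)
    also have "\<dots> = (\<Sum>l\<le>K. p l * (\<Sum>i<m. if l < c + i * b then T (real (c + i * b) - real l) else 0))"
      unfolding sum_distrib_left by (rule sum.swap)
    also have "\<dots> = (\<Sum>l\<in>{..K} \<inter> {..<y}. p l * (\<Sum>i<m. if l < c + i * b then T (real (c + i * b) - real l) else 0))
       + (\<Sum>l\<in>{y..K}. p l * (\<Sum>i<m. if l < c + i * b then T (real (c + i * b) - real l) else 0))"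
    proof -
      have "{..K} = ({..K} \<inter> {..<y}) \<union> {y..K}" by auto
      then show ?thesis by (subst sum.union_disjoint[symmetric]) auto
    qed
    also have "\<dots> \<le> (\<Sum>l\<in>{..K} \<inter> {..<y}. p l * (real m * T (real c - real l)))
       + (\<Sum>l\<in>{y..K}. p l * (\<Sum>i<m. T (real (i * b))))"
    proof (rule add_mono; rule sum_mono; rule mult_left_mono)
      fix l assume l: "l \<in> {..K} \<inter> {..<y}"
      have "(\<Sum>i<m. if l < c + i * b then T (real (c + i * b) - real l) else 0) \<le> (\<Sum>i<m. T (real c - real l))"
        using l yc T by (intro sum_mono) (auto simp: antimono_def)
      then show "(\<Sum>i<m. if l < c + i * b then T (real (c + i * b) - real l) else 0) \<le> real m * T (real c - real l)"
        by simp
    next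
      fix l
      show "(\<Sum>i<m. if l < c + i * b then T (real (c + i * b) - real l) else 0) \<le> (\<Sum>i<m. T (real (i * b)))"
        by (rule sum_translates_le[OF T])
    qed (use p in auto)
    also have "\<dots> = real m * ?X + U y * (\<Sum>i<m. T (real (i * b)))"
    proof -
      have "(\<Sum>l\<in>{..K} \<inter> {..<y}. p l * (real m * T (real c - real l))) = real m * ?X"
        by (simp add: sum_distrib_left mult_ac)
      moreover have "(\<Sum>l\<in>{y..K}. p l * (\<Sum>i<m. T (real (i * b)))) = U y * (\<Sum>i<m. T (real (i * b)))"
        by (simp only: U_def sum_distrib_right)
      ultimately show ?thesis by simp
    qed
    finally show ?thesis .
  qed
  \<comment> \<open>Only the term \<open>i = 0\<close> can be large; every other argument is at
    least b.\<close>
  have sumT: "(\<Sum>i<m. T (real (i * b))) \<le> T 0 + real m * T (real b)"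
  proof -
    have "(\<Sum>i<m. T (real (i * b))) \<le> (\<Sum>i<m. (if i = 0 then T 0 else 0) + T (real b))"
    proof (intro sum_mono)
      fix i
      have "b \<le> i * b" if "i \<noteq> 0" using that by simp
      then have "real b \<le> real (i * b)" if "i \<noteq> 0" using that of_nat_le_iff by blast
      then show "T (real (i * b)) \<le> (if i = 0 then T 0 else 0) + T (real b)"
        using T by (auto simp: antimono_def)
    qed
    also have "\<dots> = T 0 + real m * T (real b)"
      using m(1) by (simp add: sum.distrib sum.delta)
    finally show ?thesis .
  qed
  have "real m * (V + \<delta> * U (c + m * b)) = (\<Sum>i<m. V + \<delta> * U (c + m * b))" by simp
  also have "\<dots> \<le> (\<Sum>i<m. V + \<delta> * U (c + i * b))"
    using \<delta> by (intro sum_mono add_left_mono mult_left_mono U_mono) auto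
  also have "\<dots> \<le> (\<Sum>i<m. (\<Sum>l\<in>{..K} \<inter> {..<c + i * b}. p l * T (real (c + i * b) - real l))
          + real b * (U (c + i * b) - U (c + i * b + b)))"
    by (intro sum_mono drift) auto
  also have "\<dots> = (\<Sum>i<m. (\<Sum>l\<in>{..K} \<inter> {..<c + i * b}. p l * T (real (c + i * b) - real l)))
          + real b * (\<Sum>i<m. U (c + i * b) - U (c + Suc i * b))"
    by (simp add: sum.distrib sum_distrib_left add_ac)
  also have "(\<Sum>i<m. U (c + i * b) - U (c + Suc i * b)) = U c - U (c + m * b)"
    using sum_lessThan_telescope'[of "\<lambda>i. U (c + i * b)" m] by simp
  also have "(\<Sum>i<m. \<Sum>l\<in>{..K} \<inter> {..<c + i * b}. p l * T (real (c + i * b) - real l))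
      + real b * (U c - U (c + m * b))
      \<le> (real m * ?X + U y * (T 0 + real m * T (real b))) + real b * U y"
  proof (intro add_mono)
    show "(\<Sum>i<m. \<Sum>l\<in>{..K} \<inter> {..<c + i * b}. p l * T (real (c + i * b) - real l))
        \<le> real m * ?X + U y * (T 0 + real m * T (real b))"
      using inner mult_left_mono[OF sumT U_nn[of y]] by linarith
    show "real b * (U c - U (c + m * b)) \<le> real b * U y"
      using U_mono[OF yc] U_nn[of "c + m * b"] by (intro mult_left_mono) auto
  qed
  also have "\<dots> = real m * ?X + U y * (T 0 + real b + real m * T (real b))"
    by (simp add: algebra_simps)
  also have "\<dots> \<le> real m * ?X + U y * (real m * \<epsilon>)"
    using m(2) U_nn by (intro add_left_mono mult_left_mono) auto
  also have "\<dots> = real m * (?X + \<epsilon> * U y)" by (simp add: algebra_simps)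
  finally show ?thesis using m(1) by (simp add: mult_le_cancel_left_pos)
qed

text \<open>The averaged inequality is used twice. With levels near 2y it bounds \<open>U\<close>
  near 2y through \<open>T y\<close> and a small multiple of \<open>U y\<close>, which closes a
  strong induction for \<open>U K x \<le> C * T x\<close>. With levels ending at \<open>K\<close>,
  this a priori bound shows that all states above some fixed \<open>x0\<close> contribute little;
  the states below \<open>x0\<close> contribute \<open>T (K - O(1))\<close>, which is close to
  \<open>T K\<close> by long-tailedness.\<close>

lemma drift_imp_loss_bound:
  fixes T :: "real \<Rightarrow> real" and p :: "nat \<Rightarrow> nat \<Rightarrow> real" and V :: "nat \<Rightarrow> real"
  defines "U \<equiv> \<lambda>K c. \<Sum>l\<in>{c..K}. p K l"
  assumes T: "antimono T" "\<And>x. T x > 0" "(T \<longlongrightarrow> 0) at_top" "cons_var T"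
    and p: "\<And>K l. l \<le> K \<Longrightarrow> p K l \<ge> 0" "\<And>K. (\<Sum>l\<le>K. p K l) = 1" and \<delta>: "\<delta> > 0"
    and V: "\<And>K. V K \<ge> 0"
    and drift: "\<And>K c b. b \<ge> b0 \<Longrightarrow> c \<le> K \<Longrightarrow> V K + \<delta> * U K c
        \<le> (\<Sum>l\<in>{..K} \<inter> {..<c}. p K l * T (real c - real l))
          + real b * (U K c - U K (c + b))"
    and \<epsilon>: "\<epsilon> > 0"
  shows "\<forall>\<^sub>F K in sequentially. V K \<le> (1 + \<epsilon>) * T (real K)"
proof -
  have Tnn: "T x \<ge> 0" for x using T(2)[of x] by simp
  have Tmono: "T y \<le> T x" if "x \<le> y" for x y using T(1) that by (auto simp: antimono_def)
  have U_mono: "U K c' \<le> U K c" if "c \<le> c'" for K c c'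
    unfolding U_def using that p by (intro sum_mono2) auto
  have U_nn: "U K c \<ge> 0" for K c unfolding U_def using p by (intro sum_nonneg) auto
  have part_le: "(\<Sum>l\<in>{..K} \<inter> {..<y}. p K l) \<le> 1" for K y
    unfolding p(2)[of K, symmetric] using p by (intro sum_mono2) auto
  have U_le: "U K c \<le> 1" for K c
    unfolding U_def p(2)[of K, symmetric] using p by (intro sum_mono2) auto
  \<comment> \<open>For levels beyond \<open>K\<close> both masses vanish and the right-hand side is
    nonnegative. Dropping \<open>V\<close> thus frees the first averaging from the restriction that
    its levels stay below \<open>K\<close>.\<close>
  have drift': "\<delta> * U K c \<le> (\<Sum>l\<in>{..K} \<inter> {..<c}. p K l * T (real c - real l))
          + real b * (U K c - U K (c + b))" if "b \<ge> b0" for K c b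
  proof (cases "c \<le> K")
    case True
    then show ?thesis using drift[OF that True] V[of K] by linarith
  next
    case False
    then have "U K c = 0" "U K (c + b) = 0" by (auto simp: U_def)
    moreover have "(\<Sum>l\<in>{..K} \<inter> {..<c}. p K l * T (real c - real l)) \<ge> 0"
      using p Tnn by (intro sum_nonneg) auto
    ultimately show ?thesis by simp
  qed
  \<comment> \<open>First b, to make \<open>T b\<close> small, then m, to dominate
    \<open>T 0 + b\<close>; the order matters because b enters the condition on m.\<close>
  have choose: "\<exists>b m. b \<ge> b0 \<and> m \<ge> 1 \<and> T 0 + real b + real m * T (real b) \<le> real m * \<epsilon>'" if "\<epsilon>' > 0" for \<epsilon>'
  proof -
    have "\<forall>\<^sub>F b in sequentially. T (real b) < \<epsilon>' / 2"
      using filterlim_compose[OF T(3) filterlim_real_sequentially] that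
      by (intro order_tendstoD) auto
    then have "\<forall>\<^sub>F b in sequentially. T (real b) < \<epsilon>' / 2 \<and> b \<ge> b0"
      using eventually_ge_at_top[of b0] by eventually_elim simp
    then obtain b where b: "T (real b) < \<epsilon>' / 2" "b \<ge> b0"
      using eventually_happens[of _ sequentially] by auto
    obtain m :: nat where m: "(T 0 + real b) / (\<epsilon>' / 2) < real m" using reals_Archimedean2 by blast
    have "T 0 + real b < real m * (\<epsilon>' / 2)" using m that by (simp add: field_simps)
    moreover have "real m * T (real b) \<le> real m * (\<epsilon>' / 2)" using b by (intro mult_left_mono) auto
    moreover have "m \<ge> 1"
    proof -
      have "(T 0 + real b) / (\<epsilon>' / 2) > 0" using T(2)[of 0] that by simp
      then show ?thesis using m by (cases m) auto
    qed
    moreover have "real m * (\<epsilon>' / 2) + real m * (\<epsilon>' / 2) = real m * \<epsilon>'" by simp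
    ultimately have "T 0 + real b + real m * T (real b) \<le> real m * \<epsilon>'" "m \<ge> 1"
      by linarith+
    with b(2) show ?thesis by blast
  qed
  obtain \<kappa> where \<kappa>: "\<kappa> > 0" "\<forall>\<^sub>F x in at_top. T x \<le> \<kappa> * T (4 * x)"
    using cons_var_dominated[OF T(4,1) Tnn] by blast
  then obtain x1 where x1: "\<And>x. x \<ge> x1 \<Longrightarrow> T x \<le> \<kappa> * T (4 * x)"
    unfolding eventually_at_top_linorder by blast
  obtain C where C: "C > 0" "\<And>K x. U K x \<le> C * T (real x)"
  proof -
    \<comment> \<open>This makes the recursion close: after the factor \<open>\<kappa>\<close> lost
      between \<open>T y\<close> and \<open>T x\<close>, the induction hypothesis uses half of
      \<open>\<delta> * C\<close>, and the other half, at least \<open>\<kappa>\<close>, pays for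
      the direct term.\<close>
    define e1 where "e1 = \<delta> / (2 * \<kappa>)"
    have "e1 > 0" using \<delta> \<kappa> by (simp add: e1_def)
    then obtain b m where bm: "b \<ge> b0" "m \<ge> 1" "T 0 + real b + real m * T (real b) \<le> real m * e1"
      using choose by blast
    define r where "r = m * b"
    \<comment> \<open>A state below y is at distance at least y from every level from 2y on.\<close>
    have step: "\<delta> * U K (2 * y + r) \<le> T (real y) + e1 * U K y" for K y
    proof -
      have "0 + \<delta> * U K (2 * y + m * b)
          \<le> (\<Sum>l\<in>{..K} \<inter> {..<y}. p K l * T (real (2 * y) - real l)) + e1 * U K y"
        unfolding U_def
      proof (rule drift_average[OF T(1) Tnn])
        fix i
        show "0 + \<delta> * (\<Sum>l\<in>{2 * y + i * b..K}. p K l)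
           \<le> (\<Sum>l\<in>{..K} \<inter> {..<2 * y + i * b}. p K l * T (real (2 * y + i * b) - real l))
             + real b * ((\<Sum>l\<in>{2 * y + i * b..K}. p K l) - (\<Sum>l\<in>{2 * y + i * b + b..K}. p K l))"
          using drift'[OF bm(1), of K "2 * y + i * b"] by (simp add: U_def)
      qed (use p \<delta> bm in auto)
      also have "(\<Sum>l\<in>{..K} \<inter> {..<y}. p K l * T (real (2 * y) - real l))
          \<le> (\<Sum>l\<in>{..K} \<inter> {..<y}. p K l * T (real y))"
        using p by (intro sum_mono mult_left_mono Tmono) auto
      also have "\<dots> \<le> 1 * T (real y)"
        unfolding sum_distrib_right[symmetric] using part_le Tnn by (intro mult_right_mono) auto
      finally show ?thesis by (simp add: r_def)
    qed
    define n0 where "n0 = max (max r (nat \<lceil>x1\<rceil>)) 3"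
    have n0: "n0 \<ge> r" "real n0 \<ge> x1" "n0 \<ge> 3" unfolding n0_def by linarith+
    define C where "C = max (1 / T (real (3 * n0 + 3))) (2 * \<kappa> / \<delta>)"
    have C: "C > 0" "C * T (real (3 * n0 + 3)) \<ge> 1" "\<delta> * C \<ge> 2 * \<kappa>"
    proof -
      have "C \<ge> 2 * \<kappa> / \<delta>" "C \<ge> 1 / T (real (3 * n0 + 3))" by (auto simp: C_def)
      then show "C * T (real (3 * n0 + 3)) \<ge> 1" "\<delta> * C \<ge> 2 * \<kappa>"
        using \<delta> T(2)[of "real (3 * n0 + 3)"] by (simp_all add: field_simps)
      show "C > 0" using \<open>C \<ge> 2 * \<kappa> / \<delta>\<close> \<delta> \<kappa>(1) divide_pos_pos[of "2 * \<kappa>" \<delta>] by linarith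
    qed
    have "U K x \<le> C * T (real x)" for K x
    proof (induction x rule: less_induct)
      case (less x)
      show ?case
      proof (cases "x < 3 * n0 + 3")
        case True
        then have "C * T (real (3 * n0 + 3)) \<le> C * T (real x)"
          using C by (intro mult_left_mono Tmono) auto
        then show ?thesis using C(2) U_le[of K x] by linarith
      next
        case False
        \<comment> \<open>A third leaves room for the block of length r above 2y, while
          \<open>x \<le> 4 * y\<close> keeps the scale change within the constant
          \<open>\<kappa>\<close>; here \<open>y \<ge> n0 \<ge> 3\<close> covers the remainder of
          the division.\<close>
        define y where "y = x div 3"
        have y: "y < x" "y \<ge> n0" "2 * y + r \<le> x" "x \<le> 4 * y"
          using False n0 unfolding y_def by linarith+
        have "\<delta> * U K x \<le> \<delta> * U K (2 * y + r)"
          using \<delta> y by (intro mult_left_mono U_mono) auto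
        also have "\<dots> \<le> T (real y) + e1 * U K y" by (rule step)
        also have "\<dots> \<le> T (real y) + e1 * (C * T (real y))"
          using less.IH[OF y(1)] \<open>e1 > 0\<close> by simp
        also have "\<dots> = (1 + e1 * C) * T (real y)" by (simp add: algebra_simps)
        also have "\<dots> \<le> (1 + e1 * C) * (\<kappa> * T (real x))"
        proof (intro mult_left_mono)
          have "T (real y) \<le> \<kappa> * T (4 * real y)" using x1[of "real y"] y n0 by simp
          also have "\<dots> \<le> \<kappa> * T (real x)" using y \<kappa> by (intro mult_left_mono Tmono) auto
          finally show "T (real y) \<le> \<kappa> * T (real x)" .
        qed (use \<open>e1 > 0\<close> C in auto)
        also have "\<dots> = (\<kappa> + \<delta> * C / 2) * T (real x)"
          using \<kappa>(1) by (simp add: e1_def field_simps)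
        also have "\<dots> \<le> (\<delta> * C) * T (real x)"
          using C(3) Tnn by (intro mult_right_mono) auto
        finally show ?thesis using \<delta> by (simp add: mult.assoc)
      qed
    qed
    with C(1) show ?thesis using that by blast
  qed
  \<comment> \<open>Three errors of size \<open>\<epsilon> / 3\<close> are allowed: the shift in the
    argument of \<open>T\<close>, the states between \<open>x0\<close> and y, and the smearing term
    \<open>e1 * U K y\<close>.\<close>
  define e1 where "e1 = \<epsilon> / (3 * (C * \<kappa>))"
  have e1: "e1 > 0" "e1 * (C * \<kappa>) = \<epsilon> / 3" using C \<kappa> \<epsilon> by (auto simp: e1_def)
  obtain b m where bm: "b \<ge> b0" "m \<ge> 1" "T 0 + real b + real m * T (real b) \<le> real m * e1"
    using choose[OF e1(1)] by blast
  define r where "r = m * b"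
  have "\<forall>\<^sub>F x in sequentially. T (real x) < e1"
    using filterlim_compose[OF T(3) filterlim_real_sequentially] e1(1)
    by (intro order_tendstoD) auto
  \<comment> \<open>By the a priori bound, the mass above \<open>x0\<close> is at most
    \<open>C * e1\<close> for every \<open>K\<close>.\<close>
  then obtain x0 where x0: "T (real x0) < e1"
    using eventually_happens[of _ sequentially] by auto
  have "\<forall>\<^sub>F x in at_top. T (x - real (r + x0)) \<le> (1 + \<epsilon> / 3) * T x"
    using cons_var_shift[OF T(4,1) Tnn] \<epsilon> by simp
  then have "\<forall>\<^sub>F K in sequentially. T (real K - real (r + x0)) \<le> (1 + \<epsilon> / 3) * T (real K)"
    using filterlim_real_sequentially by (auto simp: filterlim_iff)
  moreover have "\<forall>\<^sub>F K in sequentially. K \<ge> max (4 * r + 2 * x0 + 2) (nat \<lceil>4 * x1\<rceil>)"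
    by (rule eventually_ge_at_top)
  ultimately show ?thesis
  proof eventually_elim
    case (elim K)
    have K: "K \<ge> 4 * r + 2 * x0 + 2" "real K \<ge> 4 * x1"
      using elim(2) by (simp, simp add: nat_le_iff ceiling_le_iff)
    \<comment> \<open>The m levels start at c and stay below \<open>K\<close>, where the drift
      inequality with the loss term is available, and \<open>c + m * b\<close> is exactly
      \<open>K\<close>. Halving \<open>K\<close> for y keeps both y and \<open>c - y\<close> above
      \<open>K / 4\<close>.\<close>
    define c where "c = K - r"
    define y where "y = K div 2"
    have y2: "2 * y \<le> K" "K \<le> 2 * y + 1" unfolding y_def by linarith+
    have cr: "c + r = K" using K(1) unfolding c_def by simp
    then have crr: "real c + real r = real K" by (metis of_nat_add)
    have "real K \<ge> 4 * real r + 2 * real x0 + 2" "2 * real y \<le> real K" "real K \<le> 2 * real y + 1"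
      using K(1) y2 by linarith+
    with crr cr y2 K(1) have cy: "y \<le> c" "c + m * b = K" "x0 \<le> y" "real c - real y \<ge> real K / 4"
      "real y \<ge> real K / 4" "real c = real K - real r"
      unfolding r_def[symmetric] by linarith+
    have "V K + \<delta> * U K (c + m * b)
          \<le> (\<Sum>l\<in>{..K} \<inter> {..<y}. p K l * T (real c - real l)) + e1 * U K y"
      unfolding U_def
    proof (rule drift_average[OF T(1) Tnn])
      fix i assume i: "i < m"
      have "i * b \<le> m * b" using i by (intro mult_right_mono) auto
      then have "c + i * b \<le> K" using cy(2) by linarith
      from drift[OF bm(1) this] show "V K + \<delta> * (\<Sum>l\<in>{c + i * b..K}. p K l)
         \<le> (\<Sum>l\<in>{..K} \<inter> {..<c + i * b}. p K l * T (real (c + i * b) - real l))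
           + real b * ((\<Sum>l\<in>{c + i * b..K}. p K l) - (\<Sum>l\<in>{c + i * b + b..K}. p K l))"
        by (simp add: U_def)
    qed (use p \<delta> bm cy in auto)
    moreover have "(\<Sum>l\<in>{..K} \<inter> {..<y}. p K l * T (real c - real l))
        \<le> T (real c - real x0) + U K x0 * T (real c - real y)"
    proof -
      have "(\<Sum>l\<in>{..K} \<inter> {..<y}. p K l * T (real c - real l))
         = (\<Sum>l\<in>{..K} \<inter> {..<x0}. p K l * T (real c - real l)) + (\<Sum>l\<in>{..K} \<inter> {x0..<y}. p K l * T (real c - real l))"
      proof -
        have eq: "{..K} \<inter> {..<y} = ({..K} \<inter> {..<x0}) \<union> ({..K} \<inter> {x0..<y})" using cy(3) by auto
        show ?thesis unfolding eq by (rule sum.union_disjoint) auto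
      qed
      also have "\<dots> \<le> (\<Sum>l\<in>{..K} \<inter> {..<x0}. p K l * T (real c - real x0)) + (\<Sum>l\<in>{..K} \<inter> {x0..<y}. p K l * T (real c - real y))"
        by (rule add_mono; rule sum_mono; rule mult_left_mono[OF Tmono p(1)]) simp_all
      also have "\<dots> = (\<Sum>l\<in>{..K} \<inter> {..<x0}. p K l) * T (real c - real x0) + (\<Sum>l\<in>{..K} \<inter> {x0..<y}. p K l) * T (real c - real y)"
        by (simp only: sum_distrib_right)
      also have "\<dots> \<le> 1 * T (real c - real x0) + U K x0 * T (real c - real y)"
      proof (rule add_mono[OF mult_right_mono[OF part_le Tnn] mult_right_mono[OF _ Tnn]])
        show "(\<Sum>l\<in>{..K} \<inter> {x0..<y}. p K l) \<le> U K x0"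
          unfolding U_def using p(1) by (intro sum_mono2) auto
      qed
      finally show ?thesis by simp
    qed
    moreover have TK4: "T (real K / 4) \<le> \<kappa> * T (real K)" using x1[of "real K / 4"] K by simp
    moreover have "U K x0 * T (real c - real y) \<le> (C * e1) * (\<kappa> * T (real K))"
    proof (intro mult_mono)
      have "C * T (real x0) \<le> C * e1" using x0 C(1) by (intro mult_left_mono) auto
      with C(2)[of K x0] show "U K x0 \<le> C * e1" by linarith
      show "T (real c - real y) \<le> \<kappa> * T (real K)" using Tmono[OF cy(4)] TK4 by linarith
    qed (use C e1 Tnn in auto)
    moreover have "e1 * U K y \<le> e1 * (C * (\<kappa> * T (real K)))"
    proof (intro mult_left_mono)
      have "U K y \<le> C * T (real y)" by (rule C)
      also have "\<dots> \<le> C * (\<kappa> * T (real K))"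
        using Tmono[OF cy(5)] TK4 C(1) by (intro mult_left_mono) linarith+
      finally show "U K y \<le> C * (\<kappa> * T (real K))" .
    qed (use e1 in auto)
    moreover have "T (real c - real x0) \<le> (1 + \<epsilon> / 3) * T (real K)"
      using elim(1) cy(6) by (simp add: diff_diff_add)
    moreover have "\<delta> * U K (c + m * b) \<ge> 0" using \<delta> U_nn by simp
    ultimately have "V K \<le> (1 + \<epsilon> / 3) * T (real K) + (C * e1) * (\<kappa> * T (real K)) + e1 * (C * (\<kappa> * T (real K)))"
      by linarith
    also have "\<dots> = (1 + \<epsilon> / 3 + 2 * (e1 * (C * \<kappa>))) * T (real K)" by (simp add: algebra_simps)
    also have "\<dots> = (1 + \<epsilon>) * T (real K)" unfolding e1(2) by simp
    finally show ?case .
  qed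
qed

section \<open>The loss rate of the finite queue\<close>

lemma queue_step_le: "queue_step K l a off \<le> K"
  by (simp add: queue_step_def)

text \<open>Without the off-period, the excess of \<open>min (l + a) K\<close> over c is exactly
  this difference of positive parts, and serving during the off-period only lowers it. Truncated
  subtraction of naturals plays the role of the positive part.\<close>

lemma queue_step_below:
  assumes "l < c" "c \<le> K" "a \<ge> 0"
  shows "real (queue_step K l a off - c)
    \<le> max 0 (of_int a - (real c - real l)) - max 0 (of_int a - (real K - real l))"
proof -
  have "int (queue_step K l a off - c) \<le> max 0 (a - (int c - int l)) - max 0 (a - (int K - int l))"
    using assms unfolding queue_step_def by (simp add: nat_diff_distrib max_def min_def) linarith
  then have "real_of_int (int (queue_step K l a off - c))
     \<le> real_of_int (max 0 (a - (int c - int l)) - max 0 (a - (int K - int l)))"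
    by (rule of_int_le_iff[THEN iffD2])
  then show ?thesis by (simp add: of_int_max)
qed

text \<open>With service capped at b, a queue starting at \<open>c + b\<close> or higher cannot fall
  below c, so its excess changes linearly. From a state in \<open>[c, c + b)\<close> the truncation
  at c can add at most b, which the last term allows for. The cap also yields a finite mean when
  that of the off-period is infinite.\<close>

lemma queue_step_above:
  assumes "c \<le> l" "l \<le> K" "a \<ge> 0"
  shows "real (queue_step K l a off - c) \<le> real (l - c) + of_int a
    - max 0 (of_int a - (real K - real l)) - real (min off b) + (if l < c + b then real b else 0)"
proof -
  have "int (queue_step K l a off - c) \<le> int (l - c) + a - max 0 (a - (int K - int l)) - int (min off b)
     + (if l < c + b then int b else 0)"
    using assms unfolding queue_step_def by (auto simp: nat_diff_distrib max_def min_def split: if_splits)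
  then have "real_of_int (int (queue_step K l a off - c)) \<le> real_of_int (int (l - c) + a
     - max 0 (a - (int K - int l)) - int (min off b) + (if l < c + b then int b else 0))"
    by (rule of_int_le_iff[THEN iffD2])
  then show ?thesis by (simp add: of_int_max split: if_splits)
qed

section \<open>Stationary balance and the drift of the embedded chain\<close>

context prob_space
begin

lemma stationary_queue_balance:
  fixes f :: "nat \<Rightarrow> real"
  assumes [measurable]: "A \<in> M \<rightarrow>\<^sub>M count_space UNIV" "Ioff \<in> M \<rightarrow>\<^sub>M count_space UNIV"
    and stat: "stationary_queue_dist M K A Ioff \<pi>"
  shows "(\<Sum>l\<le>K. \<pi> l * f l) = (\<Sum>l\<le>K. \<pi> l * expectation (\<lambda>\<omega>. f (queue_step K l (A \<omega>) (Ioff \<omega>))))"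
proof -
  have E: "expectation (\<lambda>\<omega>. f (queue_step K l (A \<omega>) (Ioff \<omega>)))
      = (\<Sum>l'\<le>K. f l' * prob {\<omega> \<in> space M. queue_step K l (A \<omega>) (Ioff \<omega>) = l'})" for l
  proof -
    have "expectation (\<lambda>\<omega>. f (queue_step K l (A \<omega>) (Ioff \<omega>)))
       = expectation (\<lambda>\<omega>. \<Sum>l'\<le>K. f l' * indicator {\<omega> \<in> space M. queue_step K l (A \<omega>) (Ioff \<omega>) = l'} \<omega>)"
    proof (intro Bochner_Integration.integral_cong refl)
      fix \<omega> assume "\<omega> \<in> space M"
      then have "(\<Sum>l'\<le>K. f l' * indicator {\<omega> \<in> space M. queue_step K l (A \<omega>) (Ioff \<omega>) = l'} \<omega>)
        = (\<Sum>l'\<le>K. if l' = queue_step K l (A \<omega>) (Ioff \<omega>) then f l' else 0)"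
        by (intro sum.cong) auto
      also have "\<dots> = f (queue_step K l (A \<omega>) (Ioff \<omega>))"
        using queue_step_le[of K l "A \<omega>" "Ioff \<omega>"] by simp
      finally show "f (queue_step K l (A \<omega>) (Ioff \<omega>))
        = (\<Sum>l'\<le>K. f l' * indicator {\<omega> \<in> space M. queue_step K l (A \<omega>) (Ioff \<omega>) = l'} \<omega>)" ..
    qed
    also have "\<dots> = (\<Sum>l'\<le>K. f l' * prob {\<omega> \<in> space M. queue_step K l (A \<omega>) (Ioff \<omega>) = l'})"
    proof -
      have ev: "{\<omega> \<in> space M. queue_step K l (A \<omega>) (Ioff \<omega>) = l'} \<in> events" for l'
        by measurable
      have "expectation (\<lambda>\<omega>. \<Sum>l'\<le>K. f l' * indicator {\<omega> \<in> space M. queue_step K l (A \<omega>) (Ioff \<omega>) = l'} \<omega>)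
        = (\<Sum>l'\<le>K. expectation (\<lambda>\<omega>. f l' * indicator {\<omega> \<in> space M. queue_step K l (A \<omega>) (Ioff \<omega>) = l'} \<omega>))"
        by (rule Bochner_Integration.integral_sum, rule integrable_mult_right)
           (simp add: ev emeasure_eq_measure)
      also have "\<dots> = (\<Sum>l'\<le>K. f l' * prob {\<omega> \<in> space M. queue_step K l (A \<omega>) (Ioff \<omega>) = l'})"
        using ev by (simp add: Int_absorb2)
      finally show ?thesis .
    qed
    finally show ?thesis .
  qed
  have "(\<Sum>l'\<le>K. \<pi> l' * f l')
      = (\<Sum>l'\<le>K. \<Sum>l\<le>K. \<pi> l * (f l' * prob {\<omega> \<in> space M. queue_step K l (A \<omega>) (Ioff \<omega>) = l'}))"
  proof (intro sum.cong refl)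
    fix l' assume "l' \<in> {..K}"
    then have eq: "\<pi> l' = (\<Sum>l\<le>K. \<pi> l * prob {\<omega> \<in> space M. queue_step K l (A \<omega>) (Ioff \<omega>) = l'})"
      using stat by (simp add: stationary_queue_dist_def)
    show "\<pi> l' * f l' = (\<Sum>l\<le>K. \<pi> l * (f l' * prob {\<omega> \<in> space M. queue_step K l (A \<omega>) (Ioff \<omega>) = l'}))"
      by (subst eq) (simp add: sum_distrib_left mult_ac)
  qed
  also have "\<dots> = (\<Sum>l\<le>K. \<Sum>l'\<le>K. \<pi> l * (f l' * prob {\<omega> \<in> space M. queue_step K l (A \<omega>) (Ioff \<omega>) = l'}))"
    by (rule sum.swap)
  finally show ?thesis by (simp only: E sum_distrib_left)
qed

text \<open>The terms \<open>T (K - l)\<close> arise on both sides of c, from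
  \<open>queue_step_below\<close> and \<open>queue_step_above\<close>, and add up to the full loss;
  the boundary term is the mass of \<open>[c, c + b)\<close> times b.\<close>

lemma queue_drift:
  fixes A :: "'a \<Rightarrow> int" and c K b :: nat
  defines "T \<equiv> stop_loss M (\<lambda>\<omega>. of_int (A \<omega>))"
  assumes meas: "A \<in> M \<rightarrow>\<^sub>M count_space UNIV" "Ioff \<in> M \<rightarrow>\<^sub>M count_space UNIV"
    and A: "AE \<omega> in M. A \<omega> \<ge> 0" "integrable M (\<lambda>\<omega>. real_of_int (A \<omega>))"
    and stat: "stationary_queue_dist M K A Ioff \<pi>"
    and c: "c \<le> K"
    and \<delta>: "\<delta> \<le> expectation (\<lambda>\<omega>. real (min (Ioff \<omega>) b)) - expectation (\<lambda>\<omega>. real_of_int (A \<omega>))"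
  shows "(\<Sum>l\<le>K. \<pi> l * T (real K - real l)) + \<delta> * (\<Sum>l\<in>{c..K}. \<pi> l)
    \<le> (\<Sum>l\<in>{..K} \<inter> {..<c}. \<pi> l * T (real c - real l))
      + real b * ((\<Sum>l\<in>{c..K}. \<pi> l) - (\<Sum>l\<in>{c + b..K}. \<pi> l))"
proof -
  note [measurable] = meas
  have \<pi>: "\<pi> l \<ge> 0" if "l \<le> K" for l using stat that by (auto simp: stationary_queue_dist_def)
  define E where "E l = expectation (\<lambda>\<omega>. real (queue_step K l (A \<omega>) (Ioff \<omega>) - c))" for l
  have intT: "integrable M (\<lambda>\<omega>. max 0 (real_of_int (A \<omega>) - x))" for x
    by (rule integrable_stop_loss[OF A(2)])
  have int: "integrable M (\<lambda>\<omega>. real (queue_step K l (A \<omega>) (Ioff \<omega>) - c))" for l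
  proof (rule integrable_const_bound[where B = "real K"])
    have "queue_step K l (A \<omega>) (Ioff \<omega>) - c \<le> K" for \<omega>
      using queue_step_le[of K l "A \<omega>" "Ioff \<omega>"] by linarith
    then show "AE \<omega> in M. norm (real (queue_step K l (A \<omega>) (Ioff \<omega>) - c)) \<le> real K" by simp
  qed measurable
  have intb: "integrable M (\<lambda>\<omega>. real (min (Ioff \<omega>) b))"
    by (rule integrable_const_bound[where B = "real b"]) auto
  have below: "E l \<le> T (real c - real l) - T (real K - real l)" if "l < c" for l
  proof -
    have "E l \<le> expectation (\<lambda>\<omega>. max 0 (real_of_int (A \<omega>) - (real c - real l))
       - max 0 (real_of_int (A \<omega>) - (real K - real l)))"
      unfolding E_def using A(1)
      by (intro integral_mono_AE int Bochner_Integration.integrable_diff intT)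
         (auto elim!: eventually_mono intro!: queue_step_below that c)
    also have "\<dots> = T (real c - real l) - T (real K - real l)"
      unfolding T_def stop_loss_def by (intro Bochner_Integration.integral_diff intT)
    finally show ?thesis .
  qed
  have above: "E l \<le> real (l - c) - \<delta> - T (real K - real l) + (if l < c + b then real b else 0)"
    if "c \<le> l" "l \<le> K" for l
  proof -
    have "E l \<le> expectation (\<lambda>\<omega>. real (l - c) + real_of_int (A \<omega>)
       - max 0 (real_of_int (A \<omega>) - (real K - real l)) - real (min (Ioff \<omega>) b) + (if l < c + b then real b else 0))"
      unfolding E_def
    proof (rule integral_mono_AE)
      show "AE \<omega> in M. real (queue_step K l (A \<omega>) (Ioff \<omega>) - c) \<le> real (l - c) + real_of_int (A \<omega>)
       - max 0 (real_of_int (A \<omega>) - (real K - real l)) - real (min (Ioff \<omega>) b) + (if l < c + b then real b else 0)"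
        using A(1) by eventually_elim (rule queue_step_above[OF that])
    qed (intro int Bochner_Integration.integrable_diff Bochner_Integration.integrable_add
            intT intb integrable_const A(2))+
    also have "\<dots> = real (l - c) + expectation (\<lambda>\<omega>. real_of_int (A \<omega>))
       - T (real K - real l) - expectation (\<lambda>\<omega>. real (min (Ioff \<omega>) b)) + (if l < c + b then real b else 0)"
      unfolding T_def stop_loss_def using intT intb A(2)
      by (simp add: prob_space)
    finally show ?thesis using \<delta> by linarith
  qed
  let ?B = "{..K} \<inter> {..<c}" and ?U = "{c..K}"
  have split: "(\<Sum>l\<le>K. g l) = (\<Sum>l\<in>?B. g l) + (\<Sum>l\<in>?U. g l)" for g :: "nat \<Rightarrow> real"
  proof -
    have "{..K} = ?B \<union> ?U" by auto
    then show ?thesis by (subst sum.union_disjoint[symmetric]) auto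
  qed
  have mid: "(\<Sum>l\<in>?U. \<pi> l * (if l < c + b then real b else 0)) = real b * ((\<Sum>l\<in>?U. \<pi> l) - (\<Sum>l\<in>{c + b..K}. \<pi> l))"
  proof -
    have "(\<Sum>l\<in>?U. \<pi> l) = (\<Sum>l\<in>?U \<inter> {..<c + b}. \<pi> l) + (\<Sum>l\<in>{c + b..K}. \<pi> l)"
    proof -
      have "?U = (?U \<inter> {..<c + b}) \<union> {c + b..K}" by auto
      then show ?thesis by (subst sum.union_disjoint[symmetric]) auto
    qed
    moreover have "(\<Sum>l\<in>?U. \<pi> l * (if l < c + b then real b else 0)) = (\<Sum>l\<in>?U \<inter> {..<c + b}. \<pi> l) * real b"
      by (simp only: sum.inter_restrict[OF finite_atLeastAtMost] sum_distrib_right) (auto intro!: sum.cong)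
    ultimately show ?thesis by simp
  qed
  \<comment> \<open>The mean excess over c, a finite sum, reappears on the right-hand side and
    cancels; what remains is the drift inequality.\<close>
  have "(\<Sum>l\<in>?U. \<pi> l * real (l - c)) = (\<Sum>l\<le>K. \<pi> l * real (l - c))"
    unfolding split[of "\<lambda>l. \<pi> l * real (l - c)"] by simp
  also have "\<dots> = (\<Sum>l\<le>K. \<pi> l * E l)"
    unfolding E_def by (rule stationary_queue_balance[OF meas stat])
  also have "\<dots> \<le> (\<Sum>l\<in>?B. \<pi> l * (T (real c - real l) - T (real K - real l)))
     + (\<Sum>l\<in>?U. \<pi> l * (real (l - c) - \<delta> - T (real K - real l) + (if l < c + b then real b else 0)))"
    unfolding split using \<pi> below above by (intro add_mono sum_mono mult_left_mono) auto
  also have "\<dots> = (\<Sum>l\<in>?B. \<pi> l * T (real c - real l)) - (\<Sum>l\<in>?B. \<pi> l * T (real K - real l))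
     + ((\<Sum>l\<in>?U. \<pi> l * real (l - c)) - \<delta> * (\<Sum>l\<in>?U. \<pi> l) - (\<Sum>l\<in>?U. \<pi> l * T (real K - real l))
     + (\<Sum>l\<in>?U. \<pi> l * (if l < c + b then real b else 0)))"
    by (simp only: distrib_left right_diff_distrib sum.distrib sum_subtractf sum_distrib_left mult.commute[of _ \<delta>])
  finally show ?thesis unfolding mid split[of "\<lambda>l. \<pi> l * T (real K - real l)"] by linarith
qed

text \<open>Monotone convergence. The mean of \<open>X\<close> is taken in the extended reals
  because it may be infinite, while the drift argument needs a finite surplus at some finite
  cap.\<close>

lemma truncated_mean_exceeds:
  assumes [measurable]: "X \<in> M \<rightarrow>\<^sub>M count_space UNIV"
    and r: "r \<ge> 0" and less: "ennreal r < (\<integral>\<^sup>+\<omega>. ennreal (real (X \<omega>)) \<partial>M)"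
  obtains \<delta> b0 where "\<delta> > 0" "\<And>b. b \<ge> b0 \<Longrightarrow> \<delta> \<le> expectation (\<lambda>\<omega>. real (min (X \<omega>) b)) - r"
proof -
  have int: "integrable M (\<lambda>\<omega>. real (min (X \<omega>) b))" for b
    by (rule integrable_const_bound[where B = "real b"]) auto
  have "(\<integral>\<^sup>+\<omega>. ennreal (real (X \<omega>)) \<partial>M) = (\<integral>\<^sup>+\<omega>. (SUP b. ennreal (real (min (X \<omega>) b))) \<partial>M)"
  proof (intro nn_integral_cong antisym)
    fix \<omega>
    have "ennreal (real (X \<omega>)) = ennreal (real (min (X \<omega>) (X \<omega>)))" by simp
    also have "\<dots> \<le> (SUP b. ennreal (real (min (X \<omega>) b)))" by (rule SUP_upper) simp
    finally show "ennreal (real (X \<omega>)) \<le> (SUP b. ennreal (real (min (X \<omega>) b)))" .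
    show "(SUP b. ennreal (real (min (X \<omega>) b))) \<le> ennreal (real (X \<omega>))"
      by (intro SUP_least ennreal_leI) simp
  qed
  also have "\<dots> = (SUP b. \<integral>\<^sup>+\<omega>. ennreal (real (min (X \<omega>) b)) \<partial>M)"
    by (intro nn_integral_monotone_convergence_SUP) (auto simp: incseq_def le_fun_def intro!: ennreal_leI)
  also have "\<dots> = (SUP b. ennreal (expectation (\<lambda>\<omega>. real (min (X \<omega>) b))))"
    by (subst nn_integral_eq_integral[OF int]) auto
  finally obtain b0 where b0: "ennreal r < ennreal (expectation (\<lambda>\<omega>. real (min (X \<omega>) b0)))"
    using less by (auto simp: less_SUP_iff)
  then have "r < expectation (\<lambda>\<omega>. real (min (X \<omega>) b0))"
    using r by (simp add: ennreal_less_iff)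
  moreover have "expectation (\<lambda>\<omega>. real (min (X \<omega>) b0)) \<le> expectation (\<lambda>\<omega>. real (min (X \<omega>) b))" if "b \<ge> b0" for b
    using that by (intro integral_mono int) auto
  ultimately show ?thesis
    by (intro that[of "expectation (\<lambda>\<omega>. real (min (X \<omega>) b0)) - r" b0]) auto
qed

lemma loss_bounds:
  fixes A :: "'a \<Rightarrow> int" and \<pi> :: "nat \<Rightarrow> nat \<Rightarrow> real"
  defines "T \<equiv> stop_loss M (\<lambda>\<omega>. of_int (A \<omega>))"
    and "V \<equiv> \<lambda>K. \<Sum>l\<le>K. \<pi> K l * expectation (\<lambda>\<omega>. of_int (max 0 (int l + A \<omega> - int K)))"
  assumes meas: "A \<in> M \<rightarrow>\<^sub>M count_space UNIV" "Ioff \<in> M \<rightarrow>\<^sub>M count_space UNIV"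
    and A: "AE \<omega> in M. A \<omega> \<ge> 0" "integrable M (\<lambda>\<omega>. real_of_int (A \<omega>))"
    and stable: "(\<integral>\<^sup>+\<omega>. ennreal (real_of_int (A \<omega>)) \<partial>M) < (\<integral>\<^sup>+\<omega>. ennreal (real (Ioff \<omega>)) \<partial>M)"
    and stat: "\<And>K. stationary_queue_dist M K A Ioff (\<pi> K)"
    and T: "cons_var T" "\<And>x. T x > 0" and \<epsilon>: "\<epsilon> > 0"
  shows "T (real K) \<le> V K" "\<forall>\<^sub>F K in sequentially. V K \<le> (1 + \<epsilon>) * T (real K)"
proof -
  have \<pi>: "\<pi> K l \<ge> 0" if "l \<le> K" for K l
    using stat[of K] that unfolding stationary_queue_dist_def by blast
  have \<pi>_sum: "(\<Sum>l\<le>K. \<pi> K l) = 1" for K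
    using stat[of K] unfolding stationary_queue_dist_def by blast
  \<comment> \<open>The overflow from state l is the excess of the net input over the free space
    \<open>K - l\<close>.\<close>
  have V: "V K = (\<Sum>l\<le>K. \<pi> K l * T (real K - real l))" for K
    unfolding V_def T_def stop_loss_def
    by (intro sum.cong arg_cong2[where f="(*)"] Bochner_Integration.integral_cong refl)
       (simp add: of_int_max algebra_simps)
  have anti: "antimono T" unfolding T_def by (rule antimono_stop_loss[OF A(2)])
  have "(\<Sum>l\<le>K. \<pi> K l) * T (real K) \<le> V K" for K
    unfolding V sum_distrib_right using \<pi> anti
    by (intro sum_mono mult_left_mono) (auto simp: antimono_def)
  then show *: "T (real K) \<le> V K" for K by (simp add: \<pi>_sum)
  have EA: "(\<integral>\<^sup>+\<omega>. ennreal (real_of_int (A \<omega>)) \<partial>M) = ennreal (expectation (\<lambda>\<omega>. real_of_int (A \<omega>)))"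
    using A by (intro nn_integral_eq_integral) (auto elim!: eventually_mono)
  have "expectation (\<lambda>\<omega>. real_of_int (A \<omega>)) \<ge> 0"
    using A(1) by (intro integral_nonneg_AE) (auto elim!: eventually_mono)
  from truncated_mean_exceeds[OF meas(2) this stable[unfolded EA]]
  obtain \<delta> b0 where \<delta>: "\<delta> > 0"
    "\<And>b. b \<ge> b0 \<Longrightarrow> \<delta> \<le> expectation (\<lambda>\<omega>. real (min (Ioff \<omega>) b)) - expectation (\<lambda>\<omega>. real_of_int (A \<omega>))"
    by blast
  show "\<forall>\<^sub>F K in sequentially. V K \<le> (1 + \<epsilon>) * T (real K)"
  proof (rule drift_imp_loss_bound[where p = \<pi> and \<delta> = \<delta> and ?b0.0 = b0])
    show "V K \<ge> 0" for K using *[of K] T(2)[of "real K"] by linarith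
    show "(T \<longlongrightarrow> 0) at_top" unfolding T_def by (rule stop_loss_tendsto_0[OF A(2)])
    show "V K + \<delta> * (\<Sum>l\<in>{c..K}. \<pi> K l) \<le> (\<Sum>l\<in>{..K} \<inter> {..<c}. \<pi> K l * T (real c - real l))
       + real b * ((\<Sum>l\<in>{c..K}. \<pi> K l) - (\<Sum>l\<in>{c + b..K}. \<pi> K l))" if "b \<ge> b0" "c \<le> K" for K c b
      unfolding V T_def by (rule queue_drift[OF meas A stat that(2) \<delta>(2)[OF that(1)]])
  qed (use anti T \<pi> \<pi>_sum \<delta> \<epsilon> in auto)
qed

end

section \<open>Markov-modulated arrivals\<close>

text \<open>Histories take countably many values, so the Markov property can be used through point
  probabilities, without conditional expectations.\<close>

lemma (in prob_space) nn_integral_countable_rv: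
  fixes Z :: "'a \<Rightarrow> 'c::countable" and g :: "'c \<Rightarrow> ennreal"
  assumes [measurable]: "Z \<in> M \<rightarrow>\<^sub>M count_space UNIV"
  shows "(\<integral>\<^sup>+\<omega>. g (Z \<omega>) \<partial>M)
       = (\<integral>\<^sup>+z. g z * ennreal (prob {\<omega> \<in> space M. Z \<omega> = z}) \<partial>count_space UNIV)"
proof -
  interpret C: sigma_finite_measure "count_space (UNIV :: 'c set)"
    by (intro sigma_finite_measure_count_space_countable) simp
  interpret P: pair_sigma_finite "count_space (UNIV :: 'c set)" M ..
  have ev[measurable]: "{\<omega> \<in> space M. Z \<omega> = z} \<in> events" for z by measurable
  have "(\<integral>\<^sup>+\<omega>. g (Z \<omega>) \<partial>M)
      = (\<integral>\<^sup>+\<omega>. (\<integral>\<^sup>+z. g z * indicator {\<omega> \<in> space M. Z \<omega> = z} \<omega> \<partial>count_space UNIV) \<partial>M)"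
  proof (intro nn_integral_cong)
    fix \<omega> assume "\<omega> \<in> space M"
    then have "(\<integral>\<^sup>+z. g z * indicator {\<omega> \<in> space M. Z \<omega> = z} \<omega> \<partial>count_space UNIV)
      = (\<integral>\<^sup>+z. g z * indicator {Z \<omega>} z \<partial>count_space UNIV)"
      by (intro nn_integral_cong) (auto split: split_indicator)
    then show "g (Z \<omega>) = (\<integral>\<^sup>+z. g z * indicator {\<omega> \<in> space M. Z \<omega> = z} \<omega> \<partial>count_space UNIV)"
      by simp
  qed
  also have "\<dots> = (\<integral>\<^sup>+z. (\<integral>\<^sup>+\<omega>. g z * indicator {\<omega> \<in> space M. Z \<omega> = z} \<omega> \<partial>M) \<partial>count_space UNIV)"
  proof (rule P.Fubini')
    have "(\<lambda>p. g (fst p) * indicator {\<omega> \<in> space M. Z \<omega> = fst p} (snd p))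
        \<in> borel_measurable (count_space UNIV \<Otimes>\<^sub>M M)"
      by (rule measurable_pair_measure_countable1) auto
    then show "(\<lambda>(z, \<omega>). g z * indicator {\<omega> \<in> space M. Z \<omega> = z} \<omega>) \<in> borel_measurable (count_space UNIV \<Otimes>\<^sub>M M)"
      by (simp add: split_beta')
  qed
  also have "\<dots> = (\<integral>\<^sup>+z. g z * ennreal (prob {\<omega> \<in> space M. Z \<omega> = z}) \<partial>count_space UNIV)"
    by (simp add: nn_integral_cmult emeasure_eq_measure)
  finally show ?thesis .
qed

lemma exp_le_quadratic:
  fixes x :: real
  assumes "\<bar>x\<bar> \<le> 1"
  shows "exp x \<le> 1 + x + x\<^sup>2"
proof (cases "x \<ge> 0")
  case True
  then show ?thesis using assms exp_bound by simp
next
  case False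
  define y where "y = - x"
  have y: "0 < y" "y \<le> 1" using False assms by (auto simp: y_def)
  have "exp x = 1 / exp y" by (simp add: y_def exp_minus field_simps)
  also have "\<dots> \<le> 1 / (1 + y)" using y exp_ge_add_one_self[of y] by (intro divide_left_mono) auto
  also have "\<dots> \<le> 1 - y + y\<^sup>2"
  proof -
    have "(1 - y + y\<^sup>2) * (1 + y) = 1 + y ^ 3" by (simp add: algebra_simps power2_eq_square power3_eq_cube)
    then show ?thesis using y by (simp add: divide_le_eq)
  qed
  finally show ?thesis by (simp add: y_def)
qed

text \<open>Convexity on \<open>[0, y]\<close>. The chord turns the exponential moment of a batch
  truncated at y into its mean, the only moment that is known.\<close>

lemma exp_le_chord:
  fixes s u y :: real
  assumes "0 \<le> u" "u \<le> y" "0 < y"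
  shows "exp (s * u) \<le> 1 + u / y * (exp (s * y) - 1)"
proof -
  have "exp ((1 - u / y) *\<^sub>R 0 + (u / y) *\<^sub>R (s * y)) \<le> (1 - u / y) * exp 0 + (u / y) * exp (s * y)"
    by (rule convex_onD[OF convex_on_exp[of 1, simplified]]) (use assms in auto)
  then show ?thesis using assms by (simp add: algebra_simps)
qed

text \<open>\<open>Q i\<close> is the joint law of the next batch and the next state from state i.
  The factorisation is over complete histories and starts at slot 1; the law of slot 0 is left
  free.\<close>

locale markov_arrivals = prob_space M for M :: "'a measure" +
  fixes N :: "nat \<Rightarrow> 'a \<Rightarrow> nat" and J :: "nat \<Rightarrow> 'a \<Rightarrow> 'd::finite"
    and Q :: "'d \<Rightarrow> (nat \<times> 'd) pmf"
  assumes meas_N[measurable]: "\<And>n. N n \<in> M \<rightarrow>\<^sub>M count_space UNIV"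
    and meas_J[measurable]: "\<And>n. J n \<in> M \<rightarrow>\<^sub>M count_space UNIV"
    and step: "\<And>n ks js k j. n \<ge> 1 \<Longrightarrow>
        prob {\<omega> \<in> space M. (\<forall>t<n. N t \<omega> = ks t \<and> J t \<omega> = js t) \<and> N n \<omega> = k \<and> J n \<omega> = j}
        = pmf (Q (js (n - 1))) (k, j) * prob {\<omega> \<in> space M. \<forall>t<n. N t \<omega> = ks t \<and> J t \<omega> = js t}"
    and integrable_fst: "\<And>i. integrable (measure_pmf (Q i)) (\<lambda>z. real (fst z))"
begin

text \<open>A list rather than a function of time, so that the history has a countable type. It
  covers the slots before n only.\<close>

definition path :: "nat \<Rightarrow> 'a \<Rightarrow> (nat \<times> 'd) list" where
  "path n \<omega> = map (\<lambda>t. (N t \<omega>, J t \<omega>)) [0..<n]"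

abbreviation drift :: "'d \<Rightarrow> real" where
  "drift i \<equiv> measure_pmf.expectation (Q i) (\<lambda>z. real (fst z))"

abbreviation truncated_drift :: "nat \<Rightarrow> 'd \<Rightarrow> real" where
  "truncated_drift R i \<equiv> measure_pmf.expectation (Q i) (\<lambda>z. real (min (fst z) R))"

text \<open>Slot 0 is left out because its law is not given by \<open>Q\<close>; it is always
  estimated separately.\<close>

abbreviation total :: "nat \<Rightarrow> 'a \<Rightarrow> real" where
  "total n \<omega> \<equiv> real (\<Sum>t\<in>{1..n}. N t \<omega>)"

abbreviation truncated_total :: "nat \<Rightarrow> nat \<Rightarrow> 'a \<Rightarrow> real" where
  "truncated_total R n \<omega> \<equiv> \<Sum>t\<in>{1..n}. real (min (N t \<omega>) R)"

abbreviation additive :: "('d \<Rightarrow> nat \<times> 'd \<Rightarrow> real) \<Rightarrow> nat \<Rightarrow> 'a \<Rightarrow> real" where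
  "additive u n \<omega> \<equiv> \<Sum>t\<in>{1..n}. u (J (t - 1) \<omega>) (N t \<omega>, J t \<omega>)"

lemma path_eq_iff:
  "length q = n \<Longrightarrow> path n \<omega> = q \<longleftrightarrow> (\<forall>t<n. N t \<omega> = fst (q ! t) \<and> J t \<omega> = snd (q ! t))"
  by (auto simp: path_def list_eq_iff_nth_eq prod_eq_iff)

lemma measurable_path[measurable]: "path n \<in> M \<rightarrow>\<^sub>M count_space UNIV"
proof (subst measurable_count_space_eq2_countable, intro conjI ballI)
  fix q :: "(nat \<times> 'd) list"
  show "path n -` {q} \<inter> space M \<in> events"
  proof (cases "length q = n")
    case True
    have "path n -` {q} \<inter> space M = {\<omega> \<in> space M. \<forall>t<n. N t \<omega> = fst (q ! t) \<and> J t \<omega> = snd (q ! t)}"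
      using path_eq_iff[OF True] by auto
    then show ?thesis by simp
  next
    case False
    then have "path n -` {q} \<inter> space M = {}" by (auto simp: path_def)
    then show ?thesis by simp
  qed
qed auto

lemma last_path: "n \<ge> 1 \<Longrightarrow> snd (last (path n \<omega>)) = J (n - 1) \<omega>"
  by (cases n) (simp_all add: path_def)

text \<open>The Markov property in integrated form: point probabilities of history and next slot
  factorise, and the sum over the next slot is an integral against \<open>Q\<close>. Lists of the
  wrong length carry no mass.\<close>

lemma nn_integral_step:
  assumes n: "n \<ge> 1"
  shows "(\<integral>\<^sup>+\<omega>. f (path n \<omega>) (N n \<omega>, J n \<omega>) \<partial>M)
       = (\<integral>\<^sup>+\<omega>. (\<integral>\<^sup>+z. f (path n \<omega>) z \<partial>measure_pmf (Q (J (n - 1) \<omega>))) \<partial>M)"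
proof -
  have pr: "prob {\<omega> \<in> space M. (path n \<omega>, N n \<omega>, J n \<omega>) = (q, z)}
     = pmf (Q (snd (last q))) z * prob {\<omega> \<in> space M. path n \<omega> = q}" for q z
  proof (cases "length q = n")
    case True
    then have "last q = q ! (n - 1)" using n by (subst last_conv_nth) auto
    moreover obtain k j where "z = (k, j)" by (cases z)
    ultimately show ?thesis
      using step[OF n, of "\<lambda>t. fst (q ! t)" "\<lambda>t. snd (q ! t)" k j] by (simp add: path_eq_iff[OF True])
  next
    case False
    then have "path n \<omega> \<noteq> q" for \<omega> by (auto simp: path_def)
    then show ?thesis by simp
  qed
  have "(\<integral>\<^sup>+\<omega>. f (path n \<omega>) (N n \<omega>, J n \<omega>) \<partial>M)
      = (\<integral>\<^sup>+\<omega>. case_prod f (path n \<omega>, N n \<omega>, J n \<omega>) \<partial>M)" by simp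
  also have "\<dots> = (\<integral>\<^sup>+p. case_prod f p * ennreal (prob {\<omega> \<in> space M. (path n \<omega>, N n \<omega>, J n \<omega>) = p}) \<partial>count_space UNIV)"
    by (rule nn_integral_countable_rv) measurable
  also have "\<dots> = (\<integral>\<^sup>+q. (\<integral>\<^sup>+z. f q z * ennreal (prob {\<omega> \<in> space M. (path n \<omega>, N n \<omega>, J n \<omega>) = (q, z)}) \<partial>count_space UNIV) \<partial>count_space UNIV)"
    by (subst nn_integral_fst_count_space[symmetric]) simp
  also have "\<dots> = (\<integral>\<^sup>+q. (\<integral>\<^sup>+z. f q z \<partial>measure_pmf (Q (snd (last q)))) * ennreal (prob {\<omega> \<in> space M. path n \<omega> = q}) \<partial>count_space UNIV)"
    unfolding pr nn_integral_measure_pmf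
    by (intro nn_integral_cong)
       (simp add: ennreal_mult nn_integral_multc[symmetric] mult_ac)
  also have "\<dots> = (\<integral>\<^sup>+\<omega>. (\<integral>\<^sup>+z. f (path n \<omega>) z \<partial>measure_pmf (Q (snd (last (path n \<omega>))))) \<partial>M)"
    by (rule nn_integral_countable_rv[symmetric]) measurable
  finally show ?thesis using n by (simp add: last_path)
qed

lemma nn_integral_le:
  assumes "n \<ge> 1" "\<And>i. (\<integral>\<^sup>+z. g z \<partial>measure_pmf (Q i)) \<le> c"
  shows "(\<integral>\<^sup>+\<omega>. g (N n \<omega>, J n \<omega>) \<partial>M) \<le> c"
proof -
  have "(\<integral>\<^sup>+\<omega>. g (N n \<omega>, J n \<omega>) \<partial>M) = (\<integral>\<^sup>+\<omega>. (\<integral>\<^sup>+z. g z \<partial>measure_pmf (Q (J (n - 1) \<omega>))) \<partial>M)"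
    by (rule nn_integral_step[OF assms(1), of "\<lambda>_. g"])
  also have "\<dots> \<le> (\<integral>\<^sup>+\<omega>. c \<partial>M)" using assms(2) by (intro nn_integral_mono)
  finally show ?thesis by (simp add: emeasure_space_1)
qed

text \<open>Conditionally on the past, the last factor has mean at most a whatever the current
  state. This uniformity replaces independence of the factors.\<close>

lemma nn_integral_prod_le:
  assumes a: "\<And>i. (\<integral>\<^sup>+z. w i z \<partial>measure_pmf (Q i)) \<le> a"
  shows "(\<integral>\<^sup>+\<omega>. (\<Prod>t\<in>{1..n}. w (J (t - 1) \<omega>) (N t \<omega>, J t \<omega>)) \<partial>M) \<le> a ^ n"
proof (induction n)
  case 0
  then show ?case by (simp add: emeasure_space_1)
next
  case (Suc n)
  define F where "F q = (\<Prod>t\<in>{1..n}. w (snd (q ! (t - 1))) (q ! t))" for q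
  have F: "F (path (Suc n) \<omega>) = (\<Prod>t\<in>{1..n}. w (J (t - 1) \<omega>) (N t \<omega>, J t \<omega>))" for \<omega>
    unfolding F_def path_def by (intro prod.cong) (auto simp del: upt_Suc)
  have "(\<integral>\<^sup>+\<omega>. (\<Prod>t\<in>{1..Suc n}. w (J (t - 1) \<omega>) (N t \<omega>, J t \<omega>)) \<partial>M)
      = (\<integral>\<^sup>+\<omega>. F (path (Suc n) \<omega>) * w (snd (last (path (Suc n) \<omega>))) (N (Suc n) \<omega>, J (Suc n) \<omega>) \<partial>M)"
    unfolding F using last_path[of "Suc n"] by (simp add: mult.commute)
  also have "\<dots> = (\<integral>\<^sup>+\<omega>. (\<integral>\<^sup>+z. F (path (Suc n) \<omega>) * w (snd (last (path (Suc n) \<omega>))) z \<partial>measure_pmf (Q (J (Suc n - 1) \<omega>))) \<partial>M)"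
    by (rule nn_integral_step[of "Suc n" "\<lambda>q z. F q * w (snd (last q)) z"]) simp
  also have "\<dots> = (\<integral>\<^sup>+\<omega>. F (path (Suc n) \<omega>) * (\<integral>\<^sup>+z. w (J n \<omega>) z \<partial>measure_pmf (Q (J n \<omega>))) \<partial>M)"
    using last_path[of "Suc n"] by (simp add: nn_integral_cmult)
  also have "\<dots> \<le> (\<integral>\<^sup>+\<omega>. F (path (Suc n) \<omega>) * a \<partial>M)"
    by (intro nn_integral_mono mult_left_mono a) auto
  also have "\<dots> = (\<integral>\<^sup>+\<omega>. F (path (Suc n) \<omega>) \<partial>M) * a"
    by (rule nn_integral_multc) measurable
  also have "\<dots> \<le> a ^ n * a" unfolding F by (intro mult_right_mono Suc.IH) simp
  finally show ?case by (simp add: mult.commute)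
qed

section \<open>Exponential tail bounds for additive functionals of the chain\<close>

lemma prob_sum_ge_exp:
  assumes u: "\<And>i. (\<integral>\<^sup>+z. ennreal (exp (u i z)) \<partial>measure_pmf (Q i)) \<le> ennreal a" and a: "a \<ge> 0"
  shows "prob {\<omega> \<in> space M. additive u n \<omega> \<ge> c} \<le> exp (- c) * a ^ n"
proof -
  let ?S = "\<lambda>\<omega>. \<Sum>t\<in>{1..n}. u (J (t - 1) \<omega>) (N t \<omega>, J t \<omega>)"
  have [measurable]: "(\<lambda>\<omega>. u (J (t - 1) \<omega>) (N t \<omega>, J t \<omega>)) \<in> borel_measurable M" for t
  proof -
    have "(\<lambda>\<omega>. case_prod u (J (t - 1) \<omega>, N t \<omega>, J t \<omega>)) \<in> borel_measurable M"
      by (rule measurable_compose[where N = "count_space UNIV"]) measurable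
    then show ?thesis by simp
  qed
  have "ennreal (prob {\<omega> \<in> space M. ?S \<omega> \<ge> c}) = (\<integral>\<^sup>+\<omega>. indicator {\<omega> \<in> space M. ?S \<omega> \<ge> c} \<omega> \<partial>M)"
    by (simp add: emeasure_eq_measure)
  also have "\<dots> \<le> (\<integral>\<^sup>+\<omega>. ennreal (exp (- c)) * (\<Prod>t\<in>{1..n}. ennreal (exp (u (J (t - 1) \<omega>) (N t \<omega>, J t \<omega>)))) \<partial>M)"
  proof (intro nn_integral_mono)
    fix \<omega>
    have "ennreal (exp (- c)) * (\<Prod>t\<in>{1..n}. ennreal (exp (u (J (t - 1) \<omega>) (N t \<omega>, J t \<omega>))))
       = ennreal (exp (?S \<omega> - c))"
      by (simp add: prod_ennreal ennreal_mult[symmetric] exp_sum[symmetric] exp_add[symmetric] mult_exp_exp)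
    moreover have "1 \<le> exp (?S \<omega> - c)" if "c \<le> ?S \<omega>" using that by simp
    ultimately show "indicator {\<omega> \<in> space M. ?S \<omega> \<ge> c} \<omega>
       \<le> ennreal (exp (- c)) * (\<Prod>t\<in>{1..n}. ennreal (exp (u (J (t - 1) \<omega>) (N t \<omega>, J t \<omega>))))"
      by (auto split: split_indicator simp: ennreal_1[symmetric] simp del: ennreal_1 intro!: ennreal_leI)
  qed
  also have "\<dots> = ennreal (exp (- c)) * (\<integral>\<^sup>+\<omega>. (\<Prod>t\<in>{1..n}. ennreal (exp (u (J (t - 1) \<omega>) (N t \<omega>, J t \<omega>)))) \<partial>M)"
    by (rule nn_integral_cmult) measurable
  also have "\<dots> \<le> ennreal (exp (- c)) * ennreal a ^ n"
    by (intro mult_left_mono nn_integral_prod_le u) simp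
  also have "\<dots> = ennreal (exp (- c) * a ^ n)"
    using a by (simp add: ennreal_power ennreal_mult)
  finally show ?thesis using a by (simp add: ennreal_le_iff)
qed

text \<open>To second order the exponential moment per step is at most
  \<open>exp (2 * s * \<epsilon>)\<close>, against a threshold worth
  \<open>exp (3 * s * \<epsilon>)\<close> per step; the difference decays geometrically.\<close>

lemma bounded_functional_ge_tendsto_0:
  fixes u :: "'d \<Rightarrow> nat \<times> 'd \<Rightarrow> real"
  assumes B: "\<And>i z. \<bar>u i z\<bar> \<le> B" and mean: "\<And>i. measure_pmf.expectation (Q i) (u i) \<le> \<epsilon>" and \<epsilon>: "\<epsilon> > 0"
  shows "(\<lambda>n. prob {\<omega> \<in> space M. additive u n \<omega> \<ge> 3 * \<epsilon> * real n}) \<longlonglongrightarrow> 0"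
proof -
  define B' where "B' = max B 1"
  have B': "B' \<ge> 1" "\<And>i z. \<bar>u i z\<bar> \<le> B'" using B by (auto simp: B'_def max.coboundedI1)
  \<comment> \<open>The first bound keeps \<open>s * u\<close> within \<open>[-1, 1]\<close>, where
    the quadratic estimate holds; the second makes the quadratic term at most
    \<open>s * \<epsilon>\<close>.\<close>
  define s where "s = min (1 / B') (\<epsilon> / B'\<^sup>2)"
  have s: "s > 0" "s * B' \<le> 1" "s * B'\<^sup>2 \<le> \<epsilon>"
  proof -
    have "s \<le> 1 / B'" "s \<le> \<epsilon> / B'\<^sup>2" by (simp_all add: s_def)
    then show "s * B' \<le> 1" "s * B'\<^sup>2 \<le> \<epsilon>" using B'(1) by (simp_all add: field_simps)
  qed (use B'(1) \<epsilon> in \<open>simp add: s_def\<close>)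
  have int: "integrable (measure_pmf (Q i)) (u i)" for i
    by (rule measure_pmf.integrable_const_bound[where B=B']) (use B' in auto)
  have E: "(\<integral>\<^sup>+z. ennreal (exp (s * u i z)) \<partial>measure_pmf (Q i)) \<le> ennreal (exp (2 * s * \<epsilon>))" for i
  proof -
    have "(\<integral>\<^sup>+z. ennreal (exp (s * u i z)) \<partial>measure_pmf (Q i)) \<le> (\<integral>\<^sup>+z. ennreal (1 + s * u i z + s * \<epsilon>) \<partial>measure_pmf (Q i))"
    proof (intro nn_integral_mono ennreal_leI)
      fix z
      have "\<bar>s * u i z\<bar> \<le> s * B'" using B'(2)[of i z] s(1) by (simp add: abs_mult)
      then have "\<bar>s * u i z\<bar> \<le> 1" using s(2) by linarith
      then have "exp (s * u i z) \<le> 1 + s * u i z + (s * u i z)\<^sup>2" by (rule exp_le_quadratic)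
      also have "(s * u i z)\<^sup>2 \<le> s * \<epsilon>"
      proof -
        have "(s * u i z)\<^sup>2 = s * (s * (u i z)\<^sup>2)" by (simp add: power2_eq_square mult_ac)
        also have "\<dots> \<le> s * (s * B'\<^sup>2)"
          using s(1) B'(1) power_mono[OF B'(2)[of i z], of 2] by (intro mult_left_mono) auto
        also have "\<dots> \<le> s * \<epsilon>" using s by (intro mult_left_mono) auto
        finally show ?thesis .
      qed
      finally show "exp (s * u i z) \<le> 1 + s * u i z + s * \<epsilon>" by simp
    qed
    also have "\<dots> = ennreal (measure_pmf.expectation (Q i) (\<lambda>z. 1 + s * u i z + s * \<epsilon>))"
    proof (rule nn_integral_eq_integral)
      show "AE z in measure_pmf (Q i). 0 \<le> 1 + s * u i z + s * \<epsilon>"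
      proof (intro AE_I2)
        fix z
        have "\<bar>s * u i z\<bar> \<le> s * B'" using B'(2)[of i z] s(1) by (simp add: abs_mult)
        moreover have "s * \<epsilon> > 0" using s \<epsilon> by simp
        ultimately show "0 \<le> 1 + s * u i z + s * \<epsilon>" using s(2) by linarith
      qed
    qed (use int in auto)
    also have "measure_pmf.expectation (Q i) (\<lambda>z. 1 + s * u i z + s * \<epsilon>) = 1 + s * measure_pmf.expectation (Q i) (u i) + s * \<epsilon>"
      using int by simp
    also have "ennreal \<dots> \<le> ennreal (exp (2 * s * \<epsilon>))"
    proof (intro ennreal_leI)
      have "s * measure_pmf.expectation (Q i) (u i) \<le> s * \<epsilon>" using mean[of i] s by (intro mult_left_mono) auto
      then show "1 + s * measure_pmf.expectation (Q i) (u i) + s * \<epsilon> \<le> exp (2 * s * \<epsilon>)"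
        using exp_ge_add_one_self[of "2 * s * \<epsilon>"] by linarith
    qed
    finally show ?thesis .
  qed
  have "prob {\<omega> \<in> space M. additive u n \<omega> \<ge> 3 * \<epsilon> * real n} \<le> exp (- (s * \<epsilon>)) ^ n" for n
  proof -
    have "additive u n \<omega> \<ge> 3 * \<epsilon> * real n
       \<longleftrightarrow> (\<Sum>t\<in>{1..n}. s * u (J (t - 1) \<omega>) (N t \<omega>, J t \<omega>)) \<ge> s * (3 * \<epsilon> * real n)" for \<omega>
      using s(1) by (simp only: sum_distrib_left[symmetric] mult_le_cancel_left_pos)
    then have "prob {\<omega> \<in> space M. additive u n \<omega> \<ge> 3 * \<epsilon> * real n}
      = prob {\<omega> \<in> space M. (\<Sum>t\<in>{1..n}. s * u (J (t - 1) \<omega>) (N t \<omega>, J t \<omega>)) \<ge> s * (3 * \<epsilon> * real n)}"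
      by simp
    also have "\<dots> \<le> exp (- (s * (3 * \<epsilon> * real n))) * exp (2 * s * \<epsilon>) ^ n"
      by (rule prob_sum_ge_exp[where u = "\<lambda>i z. s * u i z"]) (use E in auto)
    also have "\<dots> = exp (- (s * \<epsilon>)) ^ n"
      by (simp add: exp_of_nat_mult[symmetric] exp_add[symmetric] mult_exp_exp algebra_simps)
    finally show ?thesis .
  qed
  then have bound: "\<forall>\<^sub>F n in sequentially. prob {\<omega> \<in> space M. additive u n \<omega> \<ge> 3 * \<epsilon> * real n}
    \<le> exp (- (s * \<epsilon>)) ^ n"
    by (intro always_eventually allI)
  have lim: "(\<lambda>n. exp (- (s * \<epsilon>)) ^ n) \<longlonglongrightarrow> 0"
    using s \<epsilon> by (intro LIMSEQ_power_zero) auto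
  have nonneg: "\<forall>\<^sub>F n in sequentially. 0 \<le> prob {\<omega> \<in> space M. additive u n \<omega> \<ge> 3 * \<epsilon> * real n}"
    by (intro always_eventually allI measure_nonneg)
  show ?thesis by (rule tendsto_sandwich[OF nonneg bound tendsto_const lim])
qed

text \<open>Chernoff bound with parameter \<open>ln (y / (n C)) / y\<close>: it reflects that \<open>k\<close> partial sums must
  each exceed \<open>y\<close>, which happens with probability at most \<open>n C / y\<close>.\<close>

lemma prob_truncated_sum_ge:
  assumes C: "\<And>i. drift i \<le> C" "C > 0" and y: "y > 0" and n: "n \<ge> 1" "real n * C \<le> y"
  shows "prob {\<omega> \<in> space M. (\<Sum>t\<in>{1..n}. if real (N t \<omega>) \<le> y then real (N t \<omega>) else 0) \<ge> real k * y}
       \<le> exp 1 * (real n * C / y) ^ k"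
proof -
  define s where "s = ln (y / (real n * C)) / y"
  have nC: "real n * C > 0" using n C by simp
  have s: "s \<ge> 0" "exp (s * y) = y / (real n * C)" using nC n y by (auto simp: s_def)
  define u where "u z = (if real (fst z) \<le> y then real (fst z) else 0)" for z :: "nat \<times> 'd"
  \<comment> \<open>The chord slope is at most \<open>1 / (n C)\<close> for this s, so one step
    costs a factor of at most \<open>1 + 1 / n\<close>, and all n steps together at most e.\<close>
  have E: "(\<integral>\<^sup>+z. ennreal (exp (s * u z)) \<partial>measure_pmf (Q i)) \<le> ennreal (exp (1 / real n))" for i
  proof -
    let ?c = "1 / (real n * C)"
    have "(\<integral>\<^sup>+z. ennreal (exp (s * u z)) \<partial>measure_pmf (Q i)) \<le> (\<integral>\<^sup>+z. ennreal (1 + ?c * real (fst z)) \<partial>measure_pmf (Q i))"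
    proof (intro nn_integral_mono ennreal_leI)
      fix z
      have "exp (s * u z) \<le> 1 + u z / y * (exp (s * y) - 1)"
        by (rule exp_le_chord) (use y in \<open>auto simp: u_def\<close>)
      also have "\<dots> \<le> 1 + real (fst z) / y * (y / (real n * C))"
        unfolding s(2)[symmetric] using y s(1)
        by (intro add_left_mono mult_mono divide_right_mono) (auto simp: u_def)
      also have "\<dots> = 1 + ?c * real (fst z)" using y by simp
      finally show "exp (s * u z) \<le> 1 + ?c * real (fst z)" .
    qed
    also have "\<dots> = ennreal (measure_pmf.expectation (Q i) (\<lambda>z. 1 + ?c * real (fst z)))"
      using nC integrable_fst by (intro nn_integral_eq_integral) auto
    also have "measure_pmf.expectation (Q i) (\<lambda>z. 1 + ?c * real (fst z)) = 1 + ?c * drift i"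
      using integrable_fst by simp
    also have "ennreal \<dots> \<le> ennreal (exp (1 / real n))"
    proof (intro ennreal_leI)
      have "?c * drift i \<le> ?c * C" using C nC by (intro mult_left_mono) auto
      also have "\<dots> = 1 / real n" using C by simp
      finally show "1 + ?c * drift i \<le> exp (1 / real n)"
        using exp_ge_add_one_self[of "1 / real n"] by linarith
    qed
    finally show ?thesis .
  qed
  have "prob {\<omega> \<in> space M. (\<Sum>t\<in>{1..n}. if real (N t \<omega>) \<le> y then real (N t \<omega>) else 0) \<ge> real k * y}
     \<le> prob {\<omega> \<in> space M. (\<Sum>t\<in>{1..n}. s * u (N t \<omega>, J t \<omega>)) \<ge> s * (real k * y)}"
  proof (rule finite_measure_mono)
    show "{\<omega> \<in> space M. (\<Sum>t\<in>{1..n}. if real (N t \<omega>) \<le> y then real (N t \<omega>) else 0) \<ge> real k * y}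
      \<subseteq> {\<omega> \<in> space M. (\<Sum>t\<in>{1..n}. s * u (N t \<omega>, J t \<omega>)) \<ge> s * (real k * y)}"
      using s(1) unfolding sum_distrib_left[symmetric] u_def fst_conv
      by (auto intro: mult_left_mono)
    have [measurable]: "(\<lambda>\<omega>. u (N t \<omega>, J t \<omega>)) \<in> borel_measurable M" for t
      unfolding u_def by simp
    show "{\<omega> \<in> space M. (\<Sum>t\<in>{1..n}. s * u (N t \<omega>, J t \<omega>)) \<ge> s * (real k * y)} \<in> events"
      by measurable
  qed
  also have "\<dots> \<le> exp (- (s * (real k * y))) * exp (1 / real n) ^ n"
    by (rule prob_sum_ge_exp[where u = "\<lambda>i z. s * u z"]) (use E in auto)
  also have "exp (1 / real n) ^ n = exp 1"
    using n by (simp add: exp_of_nat_mult[symmetric])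
  also have "exp (- (s * (real k * y))) = (real n * C / y) ^ k"
  proof -
    have "exp (- (s * (real k * y))) = inverse (exp (s * y)) ^ k"
      by (simp add: exp_minus[symmetric] exp_of_nat_mult[symmetric] mult_ac)
    then show ?thesis unfolding s(2) by simp
  qed
  finally show ?thesis by (simp add: mult.commute)
qed

end

section \<open>The Poisson equation and the law of large numbers\<close>

text \<open>No power of P leads out of a closed set, and irreducibility reaches every state. This
  serves both the maximum principle and the proof that the process visits all states.\<close>

lemma irreducible_closed_eq_UNIV:
  fixes P :: "real^'d^'d"
  assumes P: "\<And>i j. P $ i $ j \<ge> 0" and irr: "irreducible_mat P"
    and V: "V \<noteq> {}" "\<And>i j. i \<in> V \<Longrightarrow> P $ i $ j > 0 \<Longrightarrow> j \<in> V"
  shows "V = UNIV"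
proof -
  have nn: "mat_power P n $ i $ j \<ge> 0" for n i j
    by (induction n arbitrary: i j)
       (auto simp: mat_power_def mat_def matrix_matrix_mult_def P intro!: sum_nonneg)
  have closed: "i \<in> V \<Longrightarrow> mat_power P n $ i $ j > 0 \<Longrightarrow> j \<in> V" for n i j
  proof (induction n arbitrary: j)
    case 0
    then show ?case by (auto simp: mat_power_def mat_def split: if_splits)
  next
    case (Suc n)
    have "mat_power P (Suc n) $ i $ j = (\<Sum>k\<in>UNIV. mat_power P n $ i $ k * P $ k $ j)"
      by (simp add: mat_power_def matrix_matrix_mult_def)
    with Suc.prems have "(\<Sum>k\<in>UNIV. mat_power P n $ i $ k * P $ k $ j) > 0" by simp
    then obtain k where "mat_power P n $ i $ k * P $ k $ j > 0"
      by (meson not_le sum_nonpos)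
    then have "mat_power P n $ i $ k > 0" "P $ k $ j > 0"
      using nn[of n i k] P[of k j] by (auto simp: zero_less_mult_iff)
    then show ?case using Suc.IH[OF Suc.prems(1)] V(2) by blast
  qed
  obtain i where "i \<in> V" using V(1) by blast
  moreover have "\<exists>n. mat_power P n $ i $ j > 0" for j using irr by (auto simp: irreducible_mat_def)
  ultimately show ?thesis using closed by blast
qed

text \<open>Maximum principle: at a maximum c the average of the nonnegative \<open>c - h\<close>
  vanishes, so the set of maxima is closed under transitions.\<close>

lemma harmonic_imp_const:
  fixes P :: "real^'d^'d" and h :: "real^'d"
  assumes st: "stochastic_mat P" and irr: "irreducible_mat P"
    and h: "\<And>i. h $ i = (\<Sum>j\<in>UNIV. P $ i $ j * h $ j)"
  shows "\<exists>c. \<forall>i. h $ i = c"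
proof -
  have P: "P $ i $ j \<ge> 0" "(\<Sum>j\<in>UNIV. P $ i $ j) = 1" for i j
    using st by (auto simp: stochastic_mat_def)
  define c where "c = Max (range (\<lambda>i. h $ i))"
  have le: "h $ j \<le> c" for j unfolding c_def by (intro Max_ge) auto
  have "c \<in> range (\<lambda>i. h $ i)" unfolding c_def by (intro Max_in) auto
  then have ne: "{i. h $ i = c} \<noteq> {}" by auto
  have "{i. h $ i = c} = UNIV"
  proof (rule irreducible_closed_eq_UNIV[OF P(1) irr ne])
    fix i j assume i: "i \<in> {i. h $ i = c}" and ij: "P $ i $ j > 0"
    have "(\<Sum>j\<in>UNIV. P $ i $ j * (c - h $ j)) = c * (\<Sum>j\<in>UNIV. P $ i $ j) - (\<Sum>j\<in>UNIV. P $ i $ j * h $ j)"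
      by (simp add: right_diff_distrib sum_subtractf sum_distrib_left mult.commute)
    also have "\<dots> = 0" using i h[of i] P(2)[of i] by simp
    finally have "(\<Sum>j\<in>UNIV. P $ i $ j * (c - h $ j)) = 0" .
    then have "P $ i $ j * (c - h $ j) = 0"
      using le P(1) by (subst (asm) sum_nonneg_eq_0_iff) auto
    then show "j \<in> {i. h $ i = c}" using ij by simp
  qed
  then show ?thesis by blast
qed

text \<open>Fredholm alternative by linear algebra. An irreducible chain may be periodic, in which
  case the series of the \<open>P^n g\<close> can diverge, so h is not constructed by
  summation.\<close>

lemma poisson_equation_solvable:
  fixes P :: "real^'d^'d" and \<phi> g :: "real^'d"
  assumes st: "stochastic_mat P" and irr: "irreducible_mat P"
    and \<phi>: "prob_vector \<phi>" "\<phi> v* P = \<phi>" and g: "\<phi> \<bullet> g = 0"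
  obtains h where "\<And>i. h $ i - (\<Sum>j\<in>UNIV. P $ i $ j * h $ j) = g $ i"
proof -
  have \<phi>P: "(\<Sum>i\<in>UNIV. \<phi> $ i * P $ i $ j) = \<phi> $ j" for j
  proof -
    have "(\<phi> v* P) $ j = \<phi> $ j" using \<phi>(2) by simp
    then show ?thesis by (simp add: vector_matrix_mult_def mult.commute)
  qed
  have \<phi>1: "(\<Sum>i\<in>UNIV. \<phi> $ i) = 1" using \<phi>(1) by (simp add: prob_vector_def)
  \<comment> \<open>A rank-one perturbation of \<open>I - P\<close> that is invertible and agrees with it on the complement of \<open>\<phi>\<close>.\<close>
  define L :: "real^'d \<Rightarrow> real^'d" where "L h = (\<chi> i. h $ i - (\<Sum>j\<in>UNIV. P $ i $ j * h $ j) + \<phi> \<bullet> h)" for h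
  have "linear L"
  proof (rule linearI)
    show "L (x + y) = L x + L y" for x y
      by (simp add: L_def vec_eq_iff distrib_left sum.distrib inner_add_right)
    show "L (c *\<^sub>R x) = c *\<^sub>R L x" for c x
    proof -
      have "(\<Sum>j\<in>UNIV. P $ i $ j * (c * x $ j)) = c * (\<Sum>j\<in>UNIV. P $ i $ j * x $ j)" for i
        by (simp only: sum_distrib_left mult.left_commute)
      then show ?thesis by (simp add: L_def vec_eq_iff distrib_left right_diff_distrib)
    qed
  qed
  \<comment> \<open>Since \<phi> annihilates the range of \<open>I - P\<close>, only the
    perturbation is seen by \<phi>. Hence the kernel of \<open>L\<close> consists of harmonic
    functions of mean 0, and the preimage of g has mean 0, where \<open>L\<close> is
    \<open>I - P\<close>.\<close>
  have \<phi>L: "\<phi> \<bullet> L h = \<phi> \<bullet> h" for h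
  proof -
    have "\<phi> \<bullet> L h = (\<Sum>i\<in>UNIV. \<phi> $ i * h $ i - (\<Sum>j\<in>UNIV. \<phi> $ i * P $ i $ j * h $ j) + \<phi> $ i * (\<phi> \<bullet> h))"
    proof -
      have eq: "\<phi> $ i * L h $ i = \<phi> $ i * h $ i - (\<Sum>j\<in>UNIV. \<phi> $ i * P $ i $ j * h $ j) + \<phi> $ i * (\<phi> \<bullet> h)" for i
      proof -
        have "\<phi> $ i * (\<Sum>j\<in>UNIV. P $ i $ j * h $ j) = (\<Sum>j\<in>UNIV. \<phi> $ i * P $ i $ j * h $ j)"
          by (simp only: sum_distrib_left mult.assoc)
        then show ?thesis by (simp only: L_def vec_lambda_beta distrib_left right_diff_distrib)
      qed
      have "\<phi> \<bullet> L h = (\<Sum>i\<in>UNIV. \<phi> $ i * L h $ i)" by (simp add: inner_vec_def)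
      then show ?thesis by (simp only: eq)
    qed
    also have "\<dots> = (\<Sum>i\<in>UNIV. \<phi> $ i * h $ i) - (\<Sum>i\<in>UNIV. \<Sum>j\<in>UNIV. \<phi> $ i * P $ i $ j * h $ j) + (\<Sum>i\<in>UNIV. \<phi> $ i) * (\<phi> \<bullet> h)"
      by (simp only: sum.distrib sum_subtractf sum_distrib_right)
    also have "(\<Sum>i\<in>UNIV. \<Sum>j\<in>UNIV. \<phi> $ i * P $ i $ j * h $ j) = (\<Sum>j\<in>UNIV. (\<Sum>i\<in>UNIV. \<phi> $ i * P $ i $ j) * h $ j)"
      by (subst sum.swap) (simp only: sum_distrib_right)
    also have "\<dots> = (\<Sum>i\<in>UNIV. \<phi> $ i * h $ i)" by (simp only: \<phi>P)
    also have "\<dots> = \<phi> \<bullet> h" by (simp add: inner_vec_def)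
    finally show ?thesis by (simp add: \<phi>1)
  qed
  have "inj L"
  proof (rule linear_injective_0[THEN iffD2, OF \<open>linear L\<close>, rule_format])
    fix h assume 0: "L h = 0"
    then have \<phi>h: "\<phi> \<bullet> h = 0" using \<phi>L[of h] by simp
    have harm: "h $ i = (\<Sum>j\<in>UNIV. P $ i $ j * h $ j)" for i
    proof -
      have "L h $ i = h $ i - (\<Sum>j\<in>UNIV. P $ i $ j * h $ j) + \<phi> \<bullet> h" by (simp only: L_def vec_lambda_beta)
      then show ?thesis unfolding 0 \<phi>h by simp
    qed
    obtain c where c: "\<forall>i. h $ i = c" using harmonic_imp_const[OF st irr harm] by blast
    have "\<phi> \<bullet> h = (\<Sum>i\<in>UNIV. \<phi> $ i) * c" by (simp add: inner_vec_def c sum_distrib_right)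
    then have "c = 0" unfolding \<phi>h \<phi>1 by simp
    then show "h = 0" using c by (simp add: vec_eq_iff)
  qed
  then have "surj L" using \<open>linear L\<close> linear_injective_imp_surjective by blast
  then obtain h where h: "g = L h" by (metis surjD)
  then have "\<phi> \<bullet> h = 0" using g \<phi>L[of h] by simp
  then have "h $ i - (\<Sum>j\<in>UNIV. P $ i $ j * h $ j) = g $ i" for i unfolding h by (simp add: L_def)
  then show ?thesis by (rule that)
qed

text \<open>\<open>poisson\<close> says that the sum of the \<open>N t - lam\<close> plus
  \<open>h (J n) - h (J 0)\<close> has conditionally centred increments, so the modulating chain
  disappears up to a bounded term.\<close>

locale centered_markov_arrivals = markov_arrivals M N J Q
  for M :: "'a measure" and N J and Q :: "'d::finite \<Rightarrow> (nat \<times> 'd) pmf" +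
  fixes h :: "'d \<Rightarrow> real" and lam :: real
  assumes poisson: "\<And>i. drift i - lam + measure_pmf.expectation (Q i) (\<lambda>z. h (snd z)) - h i = 0"
begin

text \<open>Dominated convergence in each state; finitely many states admit a common R.\<close>

lemma truncated_drift_close:
  assumes "\<epsilon> > 0"
  obtains R :: nat where "\<And>i. drift i - truncated_drift R i \<le> \<epsilon>"
proof -
  have "(\<lambda>R. truncated_drift R i) \<longlonglongrightarrow> drift i" for i
  proof (rule integral_dominated_convergence[where w = "\<lambda>z. real (fst z)"])
    show "AE z in measure_pmf (Q i). (\<lambda>R. real (min (fst z) R)) \<longlonglongrightarrow> real (fst z)"
    proof (intro AE_I2)
      fix z :: "nat \<times> 'd"
      show "(\<lambda>R. real (min (fst z) R)) \<longlonglongrightarrow> real (fst z)"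
        by (rule tendsto_eventually) (use eventually_ge_at_top[of "fst z"] in eventually_elim, simp)
    qed
  qed (use integrable_fst in auto)
  then have "\<forall>\<^sub>F R in sequentially. truncated_drift R i > drift i - \<epsilon>" for i
    using assms by (intro order_tendstoD(1)) auto
  then have "\<forall>\<^sub>F R in sequentially. \<forall>i. truncated_drift R i > drift i - \<epsilon>"
    by (rule eventually_all_finite)
  then obtain R :: nat where "\<forall>i. truncated_drift R i > drift i - \<epsilon>"
    using eventually_happens[of _ sequentially] by auto
  then show ?thesis by (intro that[of R]) (simp add: less_imp_le field_simps)
qed

definition potential_bound :: real where
  "potential_bound = Max (range (\<lambda>i. \<bar>h i\<bar>))"

lemma abs_h_le: "\<bar>h i\<bar> \<le> potential_bound"
  unfolding potential_bound_def by (intro Max_ge) auto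

text \<open>Subtracting the increments of the potential \<open>h\<close> turns the centred arrivals into a bounded
  functional with (nearly) vanishing conditional mean, at the price of a bounded boundary term.\<close>

lemma truncated_sum_tendsto_0:
  assumes R: "\<And>i. drift i - truncated_drift R i \<le> \<epsilon>"
    and \<epsilon>: "\<epsilon> > 0" and e: "e \<ge> 4 * \<epsilon>" and \<sigma>: "\<sigma> = 1 \<or> \<sigma> = -1"
  shows "(\<lambda>n. prob {\<omega> \<in> space M. \<sigma> * (truncated_total R n \<omega> - real n * lam) \<ge> e * real n}) \<longlonglongrightarrow> 0"
proof -
  define u where "u i z = \<sigma> * (real (min (fst z) R) - lam + h (snd z) - h i)" for i and z :: "nat \<times> 'd"
  let ?H = potential_bound
  have B: "\<bar>u i z\<bar> \<le> real R + \<bar>lam\<bar> + 2 * ?H" for i z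
    using abs_h_le[of i] abs_h_le[of "snd z"] \<sigma> unfolding u_def by (auto simp: abs_mult min_def)
  \<comment> \<open>By the Poisson equation the mean is \<sigma> times the truncation error, which
    lies between \<open>-\<epsilon>\<close> and 0.\<close>
  have mean: "measure_pmf.expectation (Q i) (u i) \<le> \<epsilon>" for i
  proof -
    have i1: "integrable (measure_pmf (Q i)) (\<lambda>z. real (min (fst z) R))"
      by (rule measure_pmf.integrable_const_bound[where B="real R"]) auto
    have i2: "integrable (measure_pmf (Q i)) (\<lambda>z. h (snd z))"
      by (rule measure_pmf.integrable_const_bound[where B="?H"]) (auto simp: abs_h_le)
    have "truncated_drift R i \<le> drift i"
      by (intro integral_mono i1 integrable_fst) auto
    moreover have "measure_pmf.expectation (Q i) (u i)
      = \<sigma> * (truncated_drift R i - lam + measure_pmf.expectation (Q i) (\<lambda>z. h (snd z)) - h i)"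
      unfolding u_def using i1 i2 by (simp add: measure_pmf.prob_space)
    ultimately show ?thesis using R[of i] poisson[of i] \<sigma> \<epsilon> by auto
  qed
  have sum_u: "additive u n \<omega>
      = \<sigma> * (truncated_total R n \<omega> - real n * lam + h (J n \<omega>) - h (J 0 \<omega>))" for n \<omega>
    by (induction n) (auto simp: u_def algebra_simps)
  have lim: "(\<lambda>n. prob {\<omega> \<in> space M. additive u n \<omega> \<ge> 3 * \<epsilon> * real n}) \<longlonglongrightarrow> 0"
    by (rule bounded_functional_ge_tendsto_0[OF B mean \<epsilon>])
  have [measurable]: "(\<lambda>\<omega>. u (J (t - 1) \<omega>) (N t \<omega>, J t \<omega>)) \<in> borel_measurable M" for t
  proof -
    have "(\<lambda>\<omega>. case_prod u (J (t - 1) \<omega>, N t \<omega>, J t \<omega>)) \<in> borel_measurable M"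
      by (rule measurable_compose[where N = "count_space UNIV"]) measurable
    then show ?thesis by simp
  qed
  have "\<forall>\<^sub>F n in sequentially. real n \<ge> 2 * ?H / \<epsilon>"
    using filterlim_real_sequentially by (auto simp: filterlim_at_top)
  then have "\<forall>\<^sub>F n in sequentially.
      prob {\<omega> \<in> space M. \<sigma> * (truncated_total R n \<omega> - real n * lam) \<ge> e * real n}
      \<le> prob {\<omega> \<in> space M. additive u n \<omega> \<ge> 3 * \<epsilon> * real n}"
  proof eventually_elim
    case (elim n)
    \<comment> \<open>The potential contributes at most twice its bound, which is absorbed by the
      gap between \<open>4 * \<epsilon>\<close> and \<open>3 * \<epsilon>\<close>.\<close>
    have n: "2 * ?H \<le> \<epsilon> * real n" using elim \<epsilon> by (simp add: field_simps)
    show ?case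
    proof (rule finite_measure_mono)
      show "{\<omega> \<in> space M. \<sigma> * (truncated_total R n \<omega> - real n * lam) \<ge> e * real n}
         \<subseteq> {\<omega> \<in> space M. additive u n \<omega> \<ge> 3 * \<epsilon> * real n}"
      proof (clarsimp simp del: of_nat_min One_nat_def)
        fix \<omega> assume *: "e * real n \<le> \<sigma> * (truncated_total R n \<omega> - real n * lam)"
        have "\<sigma> * (h (J n \<omega>) - h (J 0 \<omega>)) \<ge> - (2 * ?H)"
          using abs_h_le[of "J n \<omega>"] abs_h_le[of "J 0 \<omega>"] \<sigma> by (auto simp: abs_le_iff)
        moreover have "4 * \<epsilon> * real n \<le> e * real n" using e by (intro mult_right_mono) auto
        moreover have "additive u n \<omega>
           = \<sigma> * (truncated_total R n \<omega> - real n * lam) + \<sigma> * (h (J n \<omega>) - h (J 0 \<omega>))"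
          unfolding sum_u by (simp add: algebra_simps)
        ultimately show "3 * \<epsilon> * real n \<le> additive u n \<omega>"
          using * n by linarith
      qed
    qed measurable
  qed
  from tendsto_sandwich[OF _ this tendsto_const lim] show ?thesis by simp
qed

text \<open>Truncating batches only lowers the total, so the bounded case suffices.\<close>

lemma arrivals_lower_lln:
  assumes e: "e > 0"
  shows "(\<lambda>n. prob {\<omega> \<in> space M. total n \<omega> \<le> (lam - e) * real n}) \<longlonglongrightarrow> 0"
proof -
  have e4: "e / 4 > 0" "e \<ge> 4 * (e / 4)" using e by auto
  obtain R where R: "\<And>i. drift i - truncated_drift R i \<le> e / 4"
    using truncated_drift_close[OF e4(1)] by blast
  have lim: "(\<lambda>n. prob {\<omega> \<in> space M. (-1) * (truncated_total R n \<omega> - real n * lam) \<ge> e * real n}) \<longlonglongrightarrow> 0"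
    by (rule truncated_sum_tendsto_0[OF R e4]) simp
  have "prob {\<omega> \<in> space M. total n \<omega> \<le> (lam - e) * real n}
     \<le> prob {\<omega> \<in> space M. (-1) * (truncated_total R n \<omega> - real n * lam) \<ge> e * real n}" for n
  proof (rule finite_measure_mono)
    show "{\<omega> \<in> space M. total n \<omega> \<le> (lam - e) * real n}
       \<subseteq> {\<omega> \<in> space M. (-1) * (truncated_total R n \<omega> - real n * lam) \<ge> e * real n}"
    proof (clarsimp simp del: of_nat_min One_nat_def of_nat_sum)
      fix \<omega> assume *: "total n \<omega> \<le> (lam - e) * real n"
      have "truncated_total R n \<omega> \<le> total n \<omega>"
        unfolding of_nat_sum by (intro sum_mono) auto
      moreover have "(lam - e) * real n = real n * lam - e * real n" by (simp add: algebra_simps)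
      ultimately show "e * real n \<le> real n * lam - truncated_total R n \<omega>"
        using * by linarith
    qed
  qed measurable
  then show ?thesis
    by (intro tendsto_sandwich[OF _ _ tendsto_const lim] always_eventually allI measure_nonneg)
qed

text \<open>The part of the batches above R has no more than a small mean. Markov's inequality for
  its sum is enough, since convergence in probability is wanted without a rate.\<close>

lemma arrivals_upper_lln:
  assumes e: "e > 0"
  shows "(\<lambda>n. prob {\<omega> \<in> space M. total n \<omega> \<ge> (lam + e) * real n}) \<longlonglongrightarrow> 0"
proof (rule tendstoI)
  fix \<eta> :: real assume \<eta>: "\<eta> > 0"
  \<comment> \<open>The first bound leaves the deviation \<open>e / 2\<close> for the truncated sum;
    the second makes the Markov bound \<open>2 * \<epsilon> / e\<close> at most
    \<open>\<eta> / 2\<close>.\<close>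
  define \<epsilon> where "\<epsilon> = min (e / 8) (\<eta> * e / 4)"
  have \<epsilon>: "\<epsilon> > 0" "e / 2 \<ge> 4 * \<epsilon>" "\<epsilon> \<le> \<eta> * e / 4" using e \<eta> by (auto simp: \<epsilon>_def)
  obtain R where R: "\<And>i. drift i - truncated_drift R i \<le> \<epsilon>"
    using truncated_drift_close[OF \<epsilon>(1)] by blast
  let ?A = "\<lambda>n. {\<omega> \<in> space M. 1 * (truncated_total R n \<omega> - real n * lam) \<ge> e / 2 * real n}"
  let ?D = "\<lambda>n \<omega>. \<Sum>t\<in>{1..n}. real (N t \<omega> - R)"
  let ?B = "\<lambda>n. {\<omega> \<in> space M. 1 \<le> ennreal (2 / (e * real n)) * (\<Sum>t\<in>{1..n}. ennreal (real (N t \<omega> - R)))}"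
  have lim: "(\<lambda>n. prob (?A n)) \<longlonglongrightarrow> 0"
    by (rule truncated_sum_tendsto_0[OF R \<epsilon>(1,2)]) simp
  then have "\<forall>\<^sub>F n in sequentially. prob (?A n) < \<eta> / 2"
    using \<eta> by (intro order_tendstoD) auto
  then show "\<forall>\<^sub>F n in sequentially. dist (prob {\<omega> \<in> space M. total n \<omega> \<ge> (lam + e) * real n}) 0 < \<eta>"
    using eventually_gt_at_top[of 0]
  proof eventually_elim
    case (elim n)
    have Bev[measurable]: "?B n \<in> events" by measurable
    have "prob {\<omega> \<in> space M. total n \<omega> \<ge> (lam + e) * real n} \<le> prob (?A n \<union> ?B n)"
    proof (rule finite_measure_mono)
      show "{\<omega> \<in> space M. total n \<omega> \<ge> (lam + e) * real n} \<subseteq> ?A n \<union> ?B n"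
      proof
        fix \<omega> assume *: "\<omega> \<in> {\<omega> \<in> space M. total n \<omega> \<ge> (lam + e) * real n}"
        have eq: "total n \<omega> = truncated_total R n \<omega> + ?D n \<omega>"
          unfolding of_nat_sum sum.distrib[symmetric] by (intro sum.cong) auto
        have le: "real n * lam + e / 2 * real n + e / 2 * real n \<le> truncated_total R n \<omega> + ?D n \<omega>"
          using * unfolding eq[symmetric] by (simp add: algebra_simps)
        show "\<omega> \<in> ?A n \<union> ?B n"
        proof (rule ccontr)
          assume n: "\<omega> \<notin> ?A n \<union> ?B n"
          then have "truncated_total R n \<omega> - real n * lam < e / 2 * real n"
            using * by auto
          then have D: "?D n \<omega> > e / 2 * real n" using le by linarith
          then have "1 \<le> 2 / (e * real n) * ?D n \<omega>" using e elim(2) by (simp add: field_simps)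
          then have "ennreal 1 \<le> ennreal (2 / (e * real n) * ?D n \<omega>)" by (rule ennreal_leI)
          also have "ennreal (2 / (e * real n) * ?D n \<omega>)
             = ennreal (2 / (e * real n)) * (\<Sum>t\<in>{1..n}. ennreal (real (N t \<omega> - R)))"
            using e by (subst ennreal_mult) (auto intro!: sum_nonneg)
          finally have "\<omega> \<in> ?B n" using * by simp
          with n show False by simp
        qed
      qed
    qed measurable
    also have "\<dots> \<le> prob (?A n) + prob (?B n)" by (rule measure_Un_le) measurable
    also have "prob (?B n) \<le> \<eta> / 2"
    proof -
      have "emeasure M (?B n) \<le> ennreal (2 / (e * real n)) * (\<integral>\<^sup>+\<omega>. (\<Sum>t\<in>{1..n}. ennreal (real (N t \<omega> - R))) * indicator (space M) \<omega> \<partial>M)"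
        by (rule nn_integral_Markov_inequality) measurable
      also have "(\<integral>\<^sup>+\<omega>. (\<Sum>t\<in>{1..n}. ennreal (real (N t \<omega> - R))) * indicator (space M) \<omega> \<partial>M)
         = (\<integral>\<^sup>+\<omega>. (\<Sum>t\<in>{1..n}. ennreal (real (N t \<omega> - R))) \<partial>M)"
        by (intro nn_integral_cong) auto
      also have "\<dots> = (\<Sum>t\<in>{1..n}. \<integral>\<^sup>+\<omega>. ennreal (real (N t \<omega> - R)) \<partial>M)"
        by (rule nn_integral_sum) measurable
      also have "\<dots> \<le> (\<Sum>t\<in>{1..n}. ennreal \<epsilon>)"
      proof (intro sum_mono)
        fix t assume t: "t \<in> {1..n}"
        have "(\<integral>\<^sup>+z. ennreal (real (fst z - R)) \<partial>measure_pmf (Q i)) \<le> ennreal \<epsilon>" for i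
        proof -
          have i1: "integrable (measure_pmf (Q i)) (\<lambda>z. real (min (fst z) R))"
            by (rule measure_pmf.integrable_const_bound[where B="real R"]) auto
          have eq: "real (k - R) = real k - real (min k R)" for k by auto
          have "(\<integral>\<^sup>+z. ennreal (real (fst z - R)) \<partial>measure_pmf (Q i)) = ennreal (measure_pmf.expectation (Q i) (\<lambda>z. real (fst z) - real (min (fst z) R)))"
            unfolding eq using i1 integrable_fst by (intro nn_integral_eq_integral) auto
          also have "measure_pmf.expectation (Q i) (\<lambda>z. real (fst z) - real (min (fst z) R)) = drift i - truncated_drift R i"
            by (rule Bochner_Integration.integral_diff[OF integrable_fst i1])
          finally show ?thesis using R[of i] by (simp add: ennreal_leI)
        qed
        then show "(\<integral>\<^sup>+\<omega>. ennreal (real (N t \<omega> - R)) \<partial>M) \<le> ennreal \<epsilon>"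
          using nn_integral_le[of t "\<lambda>z. ennreal (real (fst z - R))"] t by simp
      qed
      also have "\<dots> = ennreal (real n * \<epsilon>)"
        using \<epsilon> by (simp add: ennreal_mult ennreal_of_nat_eq_real_of_nat)
      finally have "ennreal (prob (?B n)) \<le> ennreal (2 / (e * real n)) * ennreal (real n * \<epsilon>)"
        by (simp add: emeasure_eq_measure mult_left_mono)
      also have "\<dots> = ennreal (2 * \<epsilon> / e)"
        using \<epsilon> e elim(2) by (simp add: ennreal_mult[symmetric])
      finally have "prob (?B n) \<le> 2 * \<epsilon> / e" using \<epsilon> e by (simp add: ennreal_le_iff)
      also have "\<dots> \<le> \<eta> / 2" using \<epsilon>(3) e by (simp add: field_simps)
      finally show ?thesis .
    qed
    finally show ?case using elim(1) by simp
  qed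
qed

end

section \<open>Sampling at an independent consistently varying time\<close>

text \<open>The discrete counterpart of writing \<open>m^(p+1)\<close> as an integral of
  \<open>(p + 1) t^p\<close>; with \<open>j < X\<close> in place of \<open>j < m\<close> it
  expresses a moment through tails.\<close>

lemma power_Suc_le_sum:
  "real m ^ Suc p \<le> real (Suc p) * (\<Sum>j<m. real (Suc j) ^ p)"
proof (induction m)
  case (Suc m)
  have diff: "real (Suc m) ^ Suc p \<le> real m ^ Suc p + real (Suc p) * real (Suc m) ^ p"
  proof (induction p)
    case (Suc p)
    have "real (Suc m) ^ Suc (Suc p) = real m * real (Suc m) ^ Suc p + real (Suc m) ^ Suc p"
      by (simp add: algebra_simps)
    also have "\<dots> \<le> real m * (real m ^ Suc p + real (Suc p) * real (Suc m) ^ p) + real (Suc m) ^ Suc p"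
      using Suc by (intro add_mono mult_left_mono) auto
    also have "\<dots> = real m ^ Suc (Suc p) + real (Suc p) * (real m * real (Suc m) ^ p) + real (Suc m) ^ Suc p"
      by (simp add: algebra_simps)
    also have "\<dots> \<le> real m ^ Suc (Suc p) + real (Suc p) * real (Suc m) ^ Suc p + real (Suc m) ^ Suc p"
      by (intro add_mono mult_left_mono order_refl) auto
    also have "\<dots> = real m ^ Suc (Suc p) + real (Suc (Suc p)) * real (Suc m) ^ Suc p"
      by (simp add: algebra_simps)
    finally show ?case .
  qed simp
  have "real (Suc m) ^ Suc p \<le> real (Suc p) * (\<Sum>j<m. real (Suc j) ^ p) + real (Suc p) * real (Suc m) ^ p"
    using diff Suc by linarith
  then show ?case by (simp only: sum.lessThan_Suc distrib_left)
qed simp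

text \<open>The moment becomes a sum over \<open>j < n\<close> of \<open>(j + 1)^p F j\<close>. By
  the Potter bound each term is at most a constant times \<open>x^p F x\<close>, so n enters only
  linearly.\<close>

lemma (in prob_space) truncated_moment_le:
  fixes X :: "'a \<Rightarrow> nat"
  defines "F \<equiv> rv_tail M (\<lambda>\<omega>. real (X \<omega>))"
  assumes [measurable]: "X \<in> M \<rightarrow>\<^sub>M count_space UNIV"
    and potter: "\<And>y z. 0 \<le> y \<Longrightarrow> y \<le> z \<Longrightarrow> 1 \<le> z \<Longrightarrow> y ^ p * F y \<le> C * (z ^ p * F z)"
    and x: "1 \<le> x" "real n \<le> x" and C: "C > 0"
  shows "(\<integral>\<^sup>+\<omega>. ennreal (real (X \<omega>) ^ Suc p) * indicator {..n} (X \<omega>) \<partial>M)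
    \<le> ennreal (real (Suc p) * 2 ^ p * C * real n * (x ^ p * F x))"
proof -
  have F_nn: "F y \<ge> 0" for y unfolding F_def by (rule rv_tail_nonneg)
  \<comment> \<open>The Potter bound needs power and tail at one point. Since \<open>X\<close> is an
    integer, \<open>X > j\<close> gives \<open>X \<ge> j + 1 > (j + 1) / 2\<close>, at the price of
    \<open>2 ^ p\<close>.\<close>
  have half: "F (real j) \<le> F (real (Suc j) / 2)" for j
    unfolding F_def rv_tail_def by (rule finite_measure_mono) auto
  have term_le: "real (Suc j) ^ p * F (real j) \<le> 2 ^ p * (C * (x ^ p * F x))" if "j < n" for j
  proof -
    have "real (Suc j) ^ p * F (real j) \<le> real (Suc j) ^ p * F (real (Suc j) / 2)"
      using half by (intro mult_left_mono) auto
    also have "\<dots> = 2 ^ p * ((real (Suc j) / 2) ^ p * F (real (Suc j) / 2))"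
      by (simp add: power_divide)
    also have "\<dots> \<le> 2 ^ p * (C * (x ^ p * F x))"
      using that x by (intro mult_left_mono potter) auto
    finally show ?thesis .
  qed
  have "(\<integral>\<^sup>+\<omega>. ennreal (real (X \<omega>) ^ Suc p) * indicator {..n} (X \<omega>) \<partial>M)
    \<le> (\<integral>\<^sup>+\<omega>. (\<Sum>j<n. ennreal (real (Suc p) * real (Suc j) ^ p) * indicator {\<omega> \<in> space M. real (X \<omega>) > real j} \<omega>) \<partial>M)"
  proof (intro nn_integral_mono)
    fix \<omega> assume \<omega>: "\<omega> \<in> space M"
    show "ennreal (real (X \<omega>) ^ Suc p) * indicator {..n} (X \<omega>)
      \<le> (\<Sum>j<n. ennreal (real (Suc p) * real (Suc j) ^ p) * indicator {\<omega> \<in> space M. real (X \<omega>) > real j} \<omega>)"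
    proof (cases "X \<omega> \<le> n")
      case True
      have "ennreal (real (X \<omega>) ^ Suc p) \<le> ennreal (\<Sum>j<X \<omega>. real (Suc p) * real (Suc j) ^ p)"
        unfolding sum_distrib_left[symmetric] by (intro ennreal_leI power_Suc_le_sum)
      also have "\<dots> = (\<Sum>j<X \<omega>. ennreal (real (Suc p) * real (Suc j) ^ p))"
        by (rule sum_ennreal[symmetric]) simp
      also have "\<dots> = (\<Sum>j\<in>{..<n} \<inter> {..<X \<omega>}. ennreal (real (Suc p) * real (Suc j) ^ p))"
        using True by (intro sum.cong) auto
      also have "\<dots> = (\<Sum>j<n. ennreal (real (Suc p) * real (Suc j) ^ p) * indicator {\<omega> \<in> space M. real (X \<omega>) > real j} \<omega>)"
        unfolding sum.inter_restrict[OF finite_lessThan]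
        by (intro sum.cong refl) (simp add: \<omega> indicator_def)
      finally show ?thesis using True by simp
    qed simp
  qed
  also have "\<dots> = (\<Sum>j<n. \<integral>\<^sup>+\<omega>. ennreal (real (Suc p) * real (Suc j) ^ p) * indicator {\<omega> \<in> space M. real (X \<omega>) > real j} \<omega> \<partial>M)"
    by (rule nn_integral_sum) measurable
  also have "\<dots> = (\<Sum>j<n. ennreal (real (Suc p) * (real (Suc j) ^ p * F (real j))))"
  proof (intro sum.cong refl)
    fix j
    have "(\<integral>\<^sup>+\<omega>. ennreal (real (Suc p) * real (Suc j) ^ p) * indicator {\<omega> \<in> space M. real (X \<omega>) > real j} \<omega> \<partial>M)
      = ennreal (real (Suc p) * real (Suc j) ^ p) * ennreal (F (real j))"
      unfolding F_def rv_tail_def by (subst nn_integral_cmult_indicator) (auto simp: emeasure_eq_measure)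
    also have "\<dots> = ennreal (real (Suc p) * (real (Suc j) ^ p * F (real j)))"
      using F_nn[of "real j"] by (simp add: ennreal_mult[symmetric] mult.assoc)
    finally show "(\<integral>\<^sup>+\<omega>. ennreal (real (Suc p) * real (Suc j) ^ p) * indicator {\<omega> \<in> space M. real (X \<omega>) > real j} \<omega> \<partial>M)
      = ennreal (real (Suc p) * (real (Suc j) ^ p * F (real j)))" .
  qed
  also have "\<dots> \<le> (\<Sum>j<n. ennreal (real (Suc p) * (2 ^ p * (C * (x ^ p * F x)))))"
    using term_le by (intro sum_mono ennreal_leI mult_left_mono) auto
  also have "\<dots> = ennreal (real (Suc p) * 2 ^ p * C * real n * (x ^ p * F x))"
    using C x F_nn[of x] by (simp add: ennreal_of_nat_eq_real_of_nat ennreal_mult[symmetric] mult_ac)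
  finally show ?thesis .
qed

text \<open>\<open>N_pos\<close> makes all increments \<open>N - 1\<close> nonnegative, so the net
  input increases with the on-period; this is behind \<open>net_ge\<close> and
  \<open>net_le\<close>.\<close>

locale sampled_arrivals = centered_markov_arrivals M N J Q h lam
  for M :: "'a measure" and N J and Q :: "'d::finite \<Rightarrow> (nat \<times> 'd) pmf" and h lam +
  fixes Ion :: "'a \<Rightarrow> nat"
  assumes meas_Ion[measurable]: "Ion \<in> M \<rightarrow>\<^sub>M count_space UNIV"
    and Ion_pos: "\<And>\<omega>. \<omega> \<in> space M \<Longrightarrow> Ion \<omega> \<ge> 1"
    and N_pos: "\<And>n. AE \<omega> in M. N n \<omega> \<ge> 1"
    and indep_on: "indep_set
        {Ion -` A \<inter> space M | A. A \<in> sets (count_space UNIV)}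
        {(\<lambda>\<omega> n. (N n \<omega>, J n \<omega>)) -` B \<inter> space M | B.
           B \<in> sets (\<Pi>\<^sub>M n\<in>UNIV. count_space UNIV \<Otimes>\<^sub>M count_space UNIV)}"
begin

abbreviation path_space :: "(nat \<Rightarrow> nat \<times> 'd) measure" where
  "path_space \<equiv> \<Pi>\<^sub>M n\<in>UNIV. count_space UNIV \<Otimes>\<^sub>M count_space UNIV"

abbreviation arrivals :: "'a \<Rightarrow> nat \<Rightarrow> nat \<times> 'd" where
  "arrivals \<omega> \<equiv> (\<lambda>n. (N n \<omega>, J n \<omega>))"

lemma measurable_arrivals[measurable]: "arrivals \<in> M \<rightarrow>\<^sub>M path_space"
  by (rule measurable_PiM_single') (auto simp: space_pair_measure)

lemma measurable_component_fst[measurable]: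
  "(\<lambda>x. fst (x n)) \<in> path_space \<rightarrow>\<^sub>M count_space UNIV"
proof -
  have "(\<lambda>x. x n) \<in> path_space \<rightarrow>\<^sub>M count_space UNIV \<Otimes>\<^sub>M count_space UNIV"
    by (rule measurable_component_singleton) simp
  then show ?thesis by (rule measurable_compose[OF _ measurable_fst])
qed

lemma distr_Ion_arrivals:
  "distr M (count_space UNIV) Ion \<Otimes>\<^sub>M distr M path_space arrivals
     = distr M (count_space UNIV \<Otimes>\<^sub>M path_space) (\<lambda>\<omega>. (Ion \<omega>, arrivals \<omega>))"
proof (rule pair_measure_eqI)
  show "sigma_finite_measure (distr M (count_space UNIV) Ion)"
    by (intro prob_space_imp_sigma_finite prob_space_distr meas_Ion)
  show "sigma_finite_measure (distr M path_space arrivals)"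
    by (intro prob_space_imp_sigma_finite prob_space_distr measurable_arrivals)
  fix A B assume A: "A \<in> sets (distr M (count_space UNIV) Ion)" and B: "B \<in> sets (distr M path_space arrivals)"
  then have [measurable]: "B \<in> sets path_space" by simp
  have "(\<lambda>\<omega>. (Ion \<omega>, arrivals \<omega>)) -` (A \<times> B) \<inter> space M = (Ion -` A \<inter> space M) \<inter> (arrivals -` B \<inter> space M)"
    by auto
  moreover have "prob ((Ion -` A \<inter> space M) \<inter> (arrivals -` B \<inter> space M)) = prob (Ion -` A \<inter> space M) * prob (arrivals -` B \<inter> space M)"
    using B by (intro indep_setD[OF indep_on]) auto
  ultimately show "emeasure (distr M (count_space UNIV) Ion) A * emeasure (distr M path_space arrivals) B
     = emeasure (distr M (count_space UNIV \<Otimes>\<^sub>M path_space) (\<lambda>\<omega>. (Ion \<omega>, arrivals \<omega>))) (A \<times> B)"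
    by (simp add: emeasure_distr emeasure_eq_measure ennreal_mult)
qed (auto intro!: sets_pair_measure_cong)

text \<open>Fubini for the product law: the copy \<open>\<omega>'\<close> fixes the length while
  \<open>\<omega>\<close> generates the arrivals, so that estimates for a fixed number of slots
  apply.\<close>

lemma nn_integral_indep:
  assumes g: "\<And>n. g n \<in> borel_measurable path_space"
  shows "(\<integral>\<^sup>+\<omega>. g (Ion \<omega>) (arrivals \<omega>) \<partial>M) = (\<integral>\<^sup>+\<omega>'. (\<integral>\<^sup>+\<omega>. g (Ion \<omega>') (arrivals \<omega>) \<partial>M) \<partial>M)"
proof -
  note [measurable] = g
  have gm: "(\<lambda>p. g (fst p) (snd p)) \<in> borel_measurable (count_space UNIV \<Otimes>\<^sub>M path_space)"
    by (rule measurable_pair_measure_countable1) auto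
  interpret D: prob_space "distr M path_space arrivals"
    by (rule prob_space_distr) measurable
  have "(\<integral>\<^sup>+\<omega>. g (Ion \<omega>) (arrivals \<omega>) \<partial>M)
     = (\<integral>\<^sup>+p. g (fst p) (snd p) \<partial>distr M (count_space UNIV \<Otimes>\<^sub>M path_space) (\<lambda>\<omega>. (Ion \<omega>, arrivals \<omega>)))"
    by (subst nn_integral_distr) (use gm in auto)
  also have "\<dots> = (\<integral>\<^sup>+p. g (fst p) (snd p) \<partial>(distr M (count_space UNIV) Ion \<Otimes>\<^sub>M distr M path_space arrivals))"
    unfolding distr_Ion_arrivals ..
  also have "\<dots> = (\<integral>\<^sup>+m. (\<integral>\<^sup>+x. g m x \<partial>distr M path_space arrivals) \<partial>distr M (count_space UNIV) Ion)"
  proof (subst D.nn_integral_fst[symmetric])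
    show "(\<lambda>p. g (fst p) (snd p)) \<in> borel_measurable (distr M (count_space UNIV) Ion \<Otimes>\<^sub>M distr M path_space arrivals)"
      using gm by (simp cong: measurable_cong_sets)
  qed simp
  also have "\<dots> = (\<integral>\<^sup>+\<omega>'. (\<integral>\<^sup>+x. g (Ion \<omega>') x \<partial>distr M path_space arrivals) \<partial>M)"
    by (subst nn_integral_distr) auto
  also have "\<dots> = (\<integral>\<^sup>+\<omega>'. (\<integral>\<^sup>+\<omega>. g (Ion \<omega>') (arrivals \<omega>) \<partial>M) \<partial>M)"
    by (intro nn_integral_cong nn_integral_distr) auto
  finally show ?thesis .
qed

lemma prob_indep:
  assumes \<Phi>: "\<And>n. Measurable.pred path_space (\<Phi> n)"
  shows "ennreal (prob {\<omega> \<in> space M. \<Phi> (Ion \<omega>) (arrivals \<omega>)})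
    = (\<integral>\<^sup>+\<omega>'. ennreal (prob {\<omega> \<in> space M. \<Phi> (Ion \<omega>') (arrivals \<omega>)}) \<partial>M)"
    and "{\<omega> \<in> space M. \<Phi> (Ion \<omega>) (arrivals \<omega>)} \<in> events"
proof -
  note [measurable] = \<Phi>
  have ev[measurable]: "{\<omega> \<in> space M. \<Phi> n (arrivals \<omega>)} \<in> events" for n by measurable
  have "{\<omega> \<in> space M. \<Phi> (Ion \<omega>) (arrivals \<omega>)} = (\<Union>n. {\<omega> \<in> space M. Ion \<omega> = n} \<inter> {\<omega> \<in> space M. \<Phi> n (arrivals \<omega>)})"
    by auto
  also have "\<dots> \<in> events" by measurable
  finally show ev'[measurable]: "{\<omega> \<in> space M. \<Phi> (Ion \<omega>) (arrivals \<omega>)} \<in> events" .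
  have "ennreal (prob {\<omega> \<in> space M. \<Phi> (Ion \<omega>) (arrivals \<omega>)})
     = (\<integral>\<^sup>+\<omega>. indicator {\<omega> \<in> space M. \<Phi> (Ion \<omega>) (arrivals \<omega>)} \<omega> \<partial>M)"
    by (simp add: emeasure_eq_measure)
  also have "\<dots> = (\<integral>\<^sup>+\<omega>. indicator {x. \<Phi> (Ion \<omega>) x} (arrivals \<omega>) \<partial>M)"
    by (intro nn_integral_cong) (auto split: split_indicator)
  also have "\<dots> = (\<integral>\<^sup>+\<omega>'. (\<integral>\<^sup>+\<omega>. indicator {x. \<Phi> (Ion \<omega>') x} (arrivals \<omega>) \<partial>M) \<partial>M)"
    by (rule nn_integral_indep[of "\<lambda>n. indicator {x. \<Phi> n x}"]) measurable
  also have "\<dots> = (\<integral>\<^sup>+\<omega>'. ennreal (prob {\<omega> \<in> space M. \<Phi> (Ion \<omega>') (arrivals \<omega>)}) \<partial>M)"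
  proof (intro nn_integral_cong)
    fix \<omega>'
    have "(\<integral>\<^sup>+\<omega>. indicator {x. \<Phi> (Ion \<omega>') x} (arrivals \<omega>) \<partial>M)
       = (\<integral>\<^sup>+\<omega>. indicator {\<omega> \<in> space M. \<Phi> (Ion \<omega>') (arrivals \<omega>)} \<omega> \<partial>M)"
      by (intro nn_integral_cong) (auto split: split_indicator)
    then show "(\<integral>\<^sup>+\<omega>. indicator {x. \<Phi> (Ion \<omega>') x} (arrivals \<omega>) \<partial>M) = ennreal (prob {\<omega> \<in> space M. \<Phi> (Ion \<omega>') (arrivals \<omega>)})"
      by (simp add: emeasure_eq_measure)
  qed
  finally show "ennreal (prob {\<omega> \<in> space M. \<Phi> (Ion \<omega>) (arrivals \<omega>)})
    = (\<integral>\<^sup>+\<omega>'. ennreal (prob {\<omega> \<in> space M. \<Phi> (Ion \<omega>') (arrivals \<omega>)}) \<partial>M)" .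
qed

lemma prob_indep_mult:
  assumes \<Psi>: "Measurable.pred path_space \<Psi>"
  shows "prob {\<omega> \<in> space M. Ion \<omega> \<in> B \<and> \<Psi> (arrivals \<omega>)}
    = prob {\<omega> \<in> space M. Ion \<omega> \<in> B} * prob {\<omega> \<in> space M. \<Psi> (arrivals \<omega>)}"
proof -
  let ?P = "{x \<in> space path_space. \<Psi> x}"
  have sp: "arrivals \<omega> \<in> space path_space" for \<omega> by (simp add: space_PiM space_pair_measure)
  have P: "?P \<in> sets path_space" using \<Psi> by simp
  have "prob ((Ion -` B \<inter> space M) \<inter> (arrivals -` ?P \<inter> space M))
      = prob (Ion -` B \<inter> space M) * prob (arrivals -` ?P \<inter> space M)"
  proof (rule indep_setD[OF indep_on])
    show "arrivals -` ?P \<inter> space M \<in> {arrivals -` B \<inter> space M | B. B \<in> sets path_space}"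
      using P by blast
  qed auto
  moreover have "(Ion -` B \<inter> space M) \<inter> (arrivals -` ?P \<inter> space M) = {\<omega> \<in> space M. Ion \<omega> \<in> B \<and> \<Psi> (arrivals \<omega>)}"
    using sp by auto
  moreover have "Ion -` B \<inter> space M = {\<omega> \<in> space M. Ion \<omega> \<in> B}" by auto
  moreover have "arrivals -` ?P \<inter> space M = {\<omega> \<in> space M. \<Psi> (arrivals \<omega>)}" using sp by auto
  ultimately show ?thesis by simp
qed

end

lemma sum_split_first:
  fixes f :: "nat \<Rightarrow> real"
  assumes "m \<ge> 1"
  shows "(\<Sum>t<m. f t - 1) = f 0 - 1 + (\<Sum>t\<in>{1..m - 1}. f t) - real (m - 1)"
proof -
  have "{..<m} = insert 0 {1..m - 1}" using assms by auto
  then show ?thesis by (simp add: sum_subtractf)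
qed

section \<open>Tail of the net input against tail of the on-period\<close>

context sampled_arrivals
begin

abbreviation "Ion_tail \<equiv> rv_tail M (\<lambda>\<omega>. real (Ion \<omega>))"
abbreviation "net \<equiv> (\<lambda>\<omega>. real_of_int (onoff_A N Ion \<omega>))"

lemma net_eq: "net \<omega> = (\<Sum>t<Ion \<omega>. real (N t \<omega>) - 1)"
  by (simp add: onoff_A_def)

lemma measurable_onoff_A[measurable]: "onoff_A N Ion \<in> M \<rightarrow>\<^sub>M count_space UNIV"
proof -
  have "(\<lambda>\<omega>. \<Sum>t<n. int (N t \<omega>) - 1) \<in> M \<rightarrow>\<^sub>M count_space UNIV" for n
  proof -
    have "(\<lambda>\<omega>. \<Sum>t<n. int (fst (path n \<omega> ! t)) - 1) \<in> M \<rightarrow>\<^sub>M count_space UNIV"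
      by (rule measurable_compose[OF measurable_path]) simp
    then show ?thesis by (simp add: path_def)
  qed
  then have "(\<lambda>\<omega>. (\<lambda>n \<omega>. \<Sum>t<n. int (N t \<omega>) - 1) (Ion \<omega>) \<omega>) \<in> M \<rightarrow>\<^sub>M count_space UNIV"
    by (rule measurable_compose_countable[OF _ meas_Ion])
  then show ?thesis by (simp add: onoff_A_def[abs_def])
qed

lemma AE_N_pos: "AE \<omega> in M. \<forall>n. N n \<omega> \<ge> 1"
  using N_pos by (simp add: AE_all_countable)

lemma net_eq_Ion:
  assumes "\<omega> \<in> space M"
  shows "net \<omega> = real (N 0 \<omega>) - 1 + total (Ion \<omega> - 1) \<omega> - real (Ion \<omega> - 1)"
  unfolding net_eq of_nat_sum by (rule sum_split_first[OF Ion_pos[OF assms]])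

lemma net_ge:
  assumes N: "\<forall>n. N n \<omega> \<ge> 1" and m: "1 \<le> m" "m \<le> Ion \<omega>"
  shows "net \<omega> \<ge> total (m - 1) \<omega> - real (m - 1)"
proof -
  have N0: "real (N 0 \<omega>) \<ge> 1" using N by (metis of_nat_1 of_nat_le_iff)
  have "(\<Sum>t<m. real (N t \<omega>) - 1) \<le> net \<omega>"
    unfolding net_eq using N m by (intro sum_mono2) auto
  then show ?thesis
    using sum_split_first[OF m(1), of "\<lambda>t. real (N t \<omega>)"] N0 by (simp del: sum_subtractf sum_constant)
qed

lemma net_le:
  assumes N: "\<forall>n. N n \<omega> \<ge> 1" and m: "1 \<le> m" "Ion \<omega> \<le> m"
  shows "net \<omega> \<le> real (N 0 \<omega>) - 1 + total (m - 1) \<omega> - real (m - 1)"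
proof -
  have "net \<omega> \<le> (\<Sum>t<m. real (N t \<omega>) - 1)"
    unfolding net_eq using N m by (intro sum_mono2) auto
  then show ?thesis
    using sum_split_first[OF m(1), of "\<lambda>t. real (N t \<omega>)"] by (simp del: sum_subtractf sum_constant)
qed

text \<open>An on-period slightly longer than z, namely beyond \<open>v * z\<close>, has net input
  above \<open>\<mu> * z\<close> with probability near 1, independently of its length. Consistent
  variation then restores the tail at z.\<close>

lemma net_tail_lower:
  assumes cv: "cons_var Ion_tail" and lam: "lam > 1" and \<epsilon>: "\<epsilon> > 0"
  shows "\<forall>\<^sub>F x in at_top. Ion_tail (x / (lam - 1)) \<le> (1 + \<epsilon>) * rv_tail M net x"
proof -
  define \<mu> where "\<mu> = lam - 1"
  have \<mu>: "\<mu> > 0" using lam by (simp add: \<mu>_def)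
  obtain v where v: "v > 1" "\<forall>\<^sub>F z in at_top. Ion_tail z \<le> (1 + \<epsilon> / 2) * Ion_tail (v * z)"
    using cons_varD[OF cv, of "\<epsilon> / 2"] \<epsilon> by auto
  \<comment> \<open>Half of the surplus \<open>\<mu> * (v - 1)\<close> pays for the deviation e, the
    other half for rounding.\<close>
  define e where "e = \<mu> * (v - 1) / (2 * v)"
  have e: "e > 0" using \<mu> v by (simp add: e_def)
  have ev: "(\<mu> - e) * v = \<mu> + \<mu> * (v - 1) / 2"
    using v by (simp add: e_def field_simps)
  have \<mu>e: "\<mu> - e > 0"
  proof -
    have "(\<mu> - e) * v > 0" unfolding ev using v \<mu> by (intro add_pos_pos) auto
    then show ?thesis using v(1) by (simp add: zero_less_mult_iff)
  qed
  define \<eta> where "\<eta> = \<epsilon> / (2 * (1 + \<epsilon>))"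
  have \<eta>: "\<eta> > 0" "(1 + \<epsilon>) * (1 - \<eta>) = 1 + \<epsilon> / 2" using \<epsilon> by (auto simp: \<eta>_def field_simps)
  let ?bad = "\<lambda>n \<omega>. total n \<omega> \<le> (lam - e) * real n"
  have "\<forall>\<^sub>F n in sequentially. prob {\<omega> \<in> space M. ?bad n \<omega>} < \<eta>"
    using arrivals_lower_lln[OF e] \<eta>(1) by (intro order_tendstoD) auto
  then obtain n0 where n0: "\<And>n. n \<ge> n0 \<Longrightarrow> prob {\<omega> \<in> space M. ?bad n \<omega>} < \<eta>"
    unfolding eventually_sequentially by blast
  \<comment> \<open>The first entry brings the number of slots above \<open>n0\<close>; the last
    lets the surplus cover the loss \<open>2 * (\<mu> - e)\<close> from
    \<open>m - 1 \<ge> v * z - 2\<close>.\<close>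
  define z0 where "z0 = max ((real n0 + 2) / v) (max 1 (4 * (\<mu> - e) / (\<mu> * (v - 1))))"
  have "\<forall>\<^sub>F z in at_top. Ion_tail z \<le> (1 + \<epsilon>) * rv_tail M net (\<mu> * z)"
    using v(2) eventually_ge_at_top[of z0]
  proof eventually_elim
    case (elim z)
    have z: "v * z \<ge> real n0 + 2" "z \<ge> 1" "z * (\<mu> * (v - 1)) \<ge> 4 * (\<mu> - e)"
    proof -
      have "z \<ge> (real n0 + 2) / v" "z \<ge> 1" "z \<ge> 4 * (\<mu> - e) / (\<mu> * (v - 1))"
        using elim(2) by (auto simp: z0_def)
      then show "v * z \<ge> real n0 + 2" "z \<ge> 1" "z * (\<mu> * (v - 1)) \<ge> 4 * (\<mu> - e)"
        using v(1) \<mu> by (simp_all add: pos_divide_le_eq mult.commute)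
    qed
    define m where "m = nat \<lfloor>v * z\<rfloor>"
    have vz: "v * z \<ge> 2" using z(1) by linarith
    have m: "real m \<le> v * z" "v * z < real m + 1" using vz unfolding m_def by linarith+
    then have m1: "m \<ge> 1" using vz by linarith
    have mn: "real (m - 1) \<ge> v * z - 2" "m - 1 \<ge> n0" using m z(1) m1 by linarith+
    have Im: "real (Ion \<omega>) > v * z \<longleftrightarrow> Ion \<omega> \<in> {m<..}" for \<omega>
      unfolding greaterThan_iff using m by linarith
    have "Ion_tail (v * z) * (1 - \<eta>) \<le> Ion_tail (v * z) * prob {\<omega> \<in> space M. \<not> ?bad (m - 1) \<omega>}"
    proof (intro mult_left_mono rv_tail_nonneg)
      have "prob {\<omega> \<in> space M. \<not> ?bad (m - 1) \<omega>} = 1 - prob {\<omega> \<in> space M. ?bad (m - 1) \<omega>}"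
        by (rule prob_neg) measurable
      then show "1 - \<eta> \<le> prob {\<omega> \<in> space M. \<not> ?bad (m - 1) \<omega>}" using n0[OF mn(2)] by linarith
    qed
    also have "\<dots> = prob {\<omega> \<in> space M. Ion \<omega> \<in> {m<..} \<and> \<not> ?bad (m - 1) \<omega>}"
      using prob_indep_mult[of "\<lambda>x. \<not> real (\<Sum>t\<in>{1..m - 1}. fst (x t)) \<le> (lam - e) * real (m - 1)" "{m<..}"]
      by (simp add: rv_tail_def Im)
    also have "\<dots> \<le> prob {\<omega> \<in> space M. net \<omega> > \<mu> * z}"
    proof (rule finite_measure_mono_AE)
      show "AE \<omega> in M. \<omega> \<in> {\<omega> \<in> space M. Ion \<omega> \<in> {m<..} \<and> \<not> ?bad (m - 1) \<omega>} \<longrightarrow> \<omega> \<in> {\<omega> \<in> space M. net \<omega> > \<mu> * z}"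
        using AE_N_pos
      proof eventually_elim
        case (elim \<omega>)
        show ?case
        proof (intro impI CollectI conjI)
          assume *: "\<omega> \<in> {\<omega> \<in> space M. Ion \<omega> \<in> {m<..} \<and> \<not> ?bad (m - 1) \<omega>}"
          then show "\<omega> \<in> space M" by simp
          have "\<mu> * z \<le> (\<mu> - e) * (v * z - 2)"
          proof -
            have "(\<mu> - e) * (v * z - 2) = z * ((\<mu> - e) * v) - 2 * (\<mu> - e)" by (simp add: algebra_simps)
            also have "\<dots> = \<mu> * z + z * (\<mu> * (v - 1)) / 2 - 2 * (\<mu> - e)" unfolding ev by (simp add: algebra_simps)
            finally show ?thesis using z(3) by linarith
          qed
          also have "\<dots> \<le> (\<mu> - e) * real (m - 1)" using mn(1) \<mu>e by (intro mult_left_mono) auto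
          also have "\<dots> = (lam - e) * real (m - 1) - real (m - 1)" by (simp add: \<mu>_def algebra_simps)
          also have "\<dots> < total (m - 1) \<omega> - real (m - 1)" using * by (simp del: of_nat_sum)
          also have "\<dots> \<le> net \<omega>" using * elim m1 by (intro net_ge) auto
          finally show "net \<omega> > \<mu> * z" .
        qed
      qed
    qed measurable
    also have "\<dots> = rv_tail M net (\<mu> * z)" by (simp add: rv_tail_def)
    finally have *: "Ion_tail (v * z) * (1 - \<eta>) \<le> rv_tail M net (\<mu> * z)" .
    have "Ion_tail z \<le> (1 + \<epsilon> / 2) * Ion_tail (v * z)" by (rule elim(1))
    also have "\<dots> = (1 + \<epsilon>) * (Ion_tail (v * z) * (1 - \<eta>))" unfolding \<eta>(2)[symmetric] by (simp add: mult_ac)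
    also have "\<dots> \<le> (1 + \<epsilon>) * rv_tail M net (\<mu> * z)" using * \<epsilon> by (intro mult_left_mono) auto
    finally show ?case .
  qed
  from eventually_at_top_scale[OF _ this, of "1 / \<mu>"] show ?thesis
    using \<mu> by (simp add: \<mu>_def)
qed

text \<open>Either slot 0 exceeds \<open>x / 2\<close>, or a later batch exceeds
  \<open>y = x / (2 k)\<close>, or the batches of size at most y sum to at least
  \<open>k y = x / 2\<close>. Averaging over \<open>Ion\<close> bounds the second event by the mean
  of \<open>Ion\<close> and the third by a truncated moment of order
  \<open>k = p + 1\<close>.\<close>

lemma net_tail_small_Ion:
  fixes \<rho> :: "real \<Rightarrow> real" and p :: nat
  assumes int: "integrable M (\<lambda>\<omega>. real (Ion \<omega>))"
    and \<rho>: "\<And>t y. prob {\<omega> \<in> space M. real (N t \<omega>) > y} \<le> \<rho> y"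
    and potter: "\<And>y z. 0 \<le> y \<Longrightarrow> y \<le> z \<Longrightarrow> 1 \<le> z \<Longrightarrow> y ^ p * Ion_tail y \<le> C * (z ^ p * Ion_tail z)"
    and C: "C > 0" and B: "\<And>i. drift i \<le> B" "B > 0"
    and \<eta>: "\<eta> > 0" "\<eta> \<le> 1" "\<eta> * (2 * real (Suc p) * B) \<le> 1" and x: "x \<ge> 1"
  shows "prob {\<omega> \<in> space M. real (Ion \<omega>) \<le> \<eta> * x \<and> net \<omega> > x}
    \<le> \<rho> (x / 2) + expectation (\<lambda>\<omega>. real (Ion \<omega>)) * \<rho> (x / (2 * real (Suc p)))
      + exp 1 * (2 * real (Suc p) * B) ^ Suc p * (real (Suc p) * 2 ^ p * C) * \<eta> * Ion_tail x"
proof -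
  let ?k = "Suc p"
  define y where "y = x / (2 * real ?k)"
  have y: "y > 0" "real ?k * y = x / 2" using x by (auto simp: y_def field_simps)
  define n where "n = nat \<lfloor>\<eta> * x\<rfloor>"
  have \<eta>x: "\<eta> * x > 0" using \<eta> x by simp
  have n: "real n \<le> \<eta> * x" "\<And>i::nat. real i \<le> \<eta> * x \<longleftrightarrow> i \<le> n"
    using \<eta>x unfolding n_def by (linarith, simp add: le_nat_iff le_floor_iff)
  have \<rho>nn: "\<rho> z \<ge> 0" for z using \<rho>[of z 0] measure_nonneg order_trans by blast
  have Fnn: "Ion_tail z \<ge> 0" for z by (rule rv_tail_nonneg)
  let ?tr = "\<lambda>m \<omega>. \<Sum>t\<in>{1..m - 1}. if real (N t \<omega>) \<le> y then real (N t \<omega>) else 0"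
  define \<Phi>2 where "\<Phi>2 m x \<longleftrightarrow> (\<exists>t\<in>{1..<m}. real (fst (x t)) > y)" for m and x :: "nat \<Rightarrow> nat \<times> 'd"
  define \<Phi>3 where "\<Phi>3 m x \<longleftrightarrow> m \<le> n \<and> (\<Sum>t\<in>{1..m - 1}. if real (fst (x t)) \<le> y then real (fst (x t)) else 0) \<ge> real ?k * y"
    for m and x :: "nat \<Rightarrow> nat \<times> 'd"
  have meas2: "Measurable.pred path_space (\<Phi>2 m)" for m unfolding \<Phi>2_def by measurable
  have meas3: "Measurable.pred path_space (\<Phi>3 m)" for m unfolding \<Phi>3_def by measurable
  let ?E1 = "{\<omega> \<in> space M. real (N 0 \<omega>) > x / 2}"
  let ?E2 = "{\<omega> \<in> space M. \<Phi>2 (Ion \<omega>) (arrivals \<omega>)}"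
  let ?E3 = "{\<omega> \<in> space M. \<Phi>3 (Ion \<omega>) (arrivals \<omega>)}"
  have ev: "?E1 \<in> events" "?E2 \<in> events" "?E3 \<in> events"
    using prob_indep(2)[OF meas2] prob_indep(2)[OF meas3] by auto
  have "prob {\<omega> \<in> space M. real (Ion \<omega>) \<le> \<eta> * x \<and> net \<omega> > x} \<le> prob (?E1 \<union> (?E2 \<union> ?E3))"
  proof (rule finite_measure_mono)
    show "{\<omega> \<in> space M. real (Ion \<omega>) \<le> \<eta> * x \<and> net \<omega> > x} \<subseteq> ?E1 \<union> (?E2 \<union> ?E3)"
    proof
      fix \<omega> assume "\<omega> \<in> {\<omega> \<in> space M. real (Ion \<omega>) \<le> \<eta> * x \<and> net \<omega> > x}"
      then have \<omega>: "\<omega> \<in> space M" "Ion \<omega> \<le> n" "net \<omega> > x" using n(2) by auto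
      show "\<omega> \<in> ?E1 \<union> (?E2 \<union> ?E3)"
      proof (rule ccontr)
        assume c: "\<omega> \<notin> ?E1 \<union> (?E2 \<union> ?E3)"
        then have N0: "real (N 0 \<omega>) \<le> x / 2" using \<omega>(1) by auto
        have "real (N t \<omega>) \<le> y" if "t \<in> {1..<Ion \<omega>}" for t
          using c \<omega>(1) that by (force simp: \<Phi>2_def)
        then have "?tr (Ion \<omega>) \<omega> = total (Ion \<omega> - 1) \<omega>"
          unfolding of_nat_sum by (intro sum.cong) auto
        moreover have "\<not> real ?k * y \<le> ?tr (Ion \<omega>) \<omega>"
          using c \<omega> by (simp add: \<Phi>3_def cong: if_cong)
        ultimately have "total (Ion \<omega> - 1) \<omega> < x / 2" unfolding y(2) by linarith
        moreover have "real (Ion \<omega> - 1) \<ge> 0" by simp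
        ultimately show False using net_eq_Ion[OF \<omega>(1)] \<omega>(3) N0 by linarith
      qed
    qed
  qed (use ev in auto)
  also have "\<dots> \<le> prob ?E1 + prob (?E2 \<union> ?E3)" using ev by (intro measure_Un_le) auto
  also have "prob (?E2 \<union> ?E3) \<le> prob ?E2 + prob ?E3" using ev by (intro measure_Un_le) auto
  also have "prob ?E1 \<le> \<rho> (x / 2)" by (rule \<rho>)
  also have "prob ?E2 \<le> expectation (\<lambda>\<omega>. real (Ion \<omega>)) * \<rho> y"
  proof -
    have "prob {\<omega> \<in> space M. \<Phi>2 m (arrivals \<omega>)} \<le> real m * \<rho> y" for m
    proof -
      have "{\<omega> \<in> space M. \<Phi>2 m (arrivals \<omega>)} = (\<Union>t\<in>{1..<m}. {\<omega> \<in> space M. real (N t \<omega>) > y})"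
        by (auto simp: \<Phi>2_def)
      also have "prob \<dots> \<le> (\<Sum>t\<in>{1..<m}. prob {\<omega> \<in> space M. real (N t \<omega>) > y})"
        by (rule finite_measure_subadditive_finite) auto
      also have "\<dots> \<le> (\<Sum>t\<in>{1..<m}. \<rho> y)" by (intro sum_mono \<rho>)
      also have "\<dots> \<le> real m * \<rho> y" using \<rho>nn by (auto intro!: mult_right_mono)
      finally show ?thesis .
    qed
    then have "ennreal (prob ?E2) \<le> (\<integral>\<^sup>+\<omega>. ennreal (real (Ion \<omega>) * \<rho> y) \<partial>M)"
      unfolding prob_indep(1)[of \<Phi>2, OF meas2] by (intro nn_integral_mono ennreal_leI)
    also have "\<dots> = ennreal (expectation (\<lambda>\<omega>. real (Ion \<omega>) * \<rho> y))"
      using int \<rho>nn by (intro nn_integral_eq_integral) auto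
    finally show ?thesis using \<rho>nn int by (simp add: ennreal_le_iff integral_nonneg_AE)
  qed
  also have "prob ?E3 \<le> exp 1 * (2 * real ?k * B) ^ ?k * (real ?k * 2 ^ p * C) * \<eta> * Ion_tail x"
  proof -
    let ?c = "exp 1 * (B / y) ^ ?k"
    have c: "?c \<ge> 0" using B y by simp
    \<comment> \<open>For \<open>m \<le> 1\<close> the sum is empty and stays below its positive
      threshold; the Chernoff bound covers the rest.\<close>
    have le: "prob {\<omega> \<in> space M. \<Phi>3 m (arrivals \<omega>)} \<le> ?c * real m ^ ?k" if m: "m \<le> n" for m
    proof (cases "m \<le> 1")
      case True
      then have "m - 1 = 0" by simp
      then have "\<not> \<Phi>3 m x'" for x' using y x by (simp add: \<Phi>3_def)
      then have "prob {\<omega> \<in> space M. \<Phi>3 m (arrivals \<omega>)} = 0" by simp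
      moreover have "0 \<le> ?c * real m ^ ?k" by (rule mult_nonneg_nonneg[OF c]) simp
      ultimately show ?thesis by linarith
    next
      \<comment> \<open>The condition on \<open>\<eta>\<close> is what guarantees the hypothesis of
        the Chernoff bound, namely that the mean over the slots does not exceed y.\<close>
      case False
      have "real m \<le> \<eta> * x" using m n(1) by linarith
      then have "real m * B \<le> \<eta> * x * B" using B(2) by (intro mult_right_mono) auto
      also have "\<dots> = \<eta> * (2 * real ?k * B) * y" unfolding y_def by simp
      also have "\<dots> \<le> y" using \<eta>(3) y(1) by (simp add: mult_le_cancel_right1)
      finally have mB: "real m * B \<le> y" .
      have m1B: "real (m - 1) * B \<le> real m * B" using B by (intro mult_right_mono) auto
      have "prob {\<omega> \<in> space M. \<Phi>3 m (arrivals \<omega>)} \<le> prob {\<omega> \<in> space M. ?tr m \<omega> \<ge> real ?k * y}"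
        by (rule finite_measure_mono) (auto simp: \<Phi>3_def cong: if_cong)
      also have "\<dots> \<le> exp 1 * (real (m - 1) * B / y) ^ ?k"
        by (rule prob_truncated_sum_ge[OF B y(1)]) (use False mB m1B in auto)
      also have "\<dots> \<le> exp 1 * (real m * B / y) ^ ?k"
        using m1B B y(1) by (intro mult_left_mono power_mono divide_right_mono) auto
      also have "\<dots> = ?c * real m ^ ?k" by (simp add: power_divide power_mult_distrib)
      finally show ?thesis .
    qed
    have "ennreal (prob ?E3) \<le> (\<integral>\<^sup>+\<omega>. ennreal ?c * (ennreal (real (Ion \<omega>) ^ ?k) * indicator {..n} (Ion \<omega>)) \<partial>M)"
      unfolding prob_indep(1)[of \<Phi>3, OF meas3]
    proof (intro nn_integral_mono)
      fix \<omega>'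
      show "ennreal (prob {\<omega> \<in> space M. \<Phi>3 (Ion \<omega>') (arrivals \<omega>)}) \<le> ennreal ?c * (ennreal (real (Ion \<omega>') ^ ?k) * indicator {..n} (Ion \<omega>'))"
      proof (cases "Ion \<omega>' \<le> n")
        case True
        then show ?thesis using le[OF True] c by (simp add: ennreal_mult[symmetric] ennreal_leI)
      next
        case False
        then have "\<not> \<Phi>3 (Ion \<omega>') x" for x by (auto simp: \<Phi>3_def)
        then show ?thesis by simp
      qed
    qed
    also have "\<dots> = ennreal ?c * (\<integral>\<^sup>+\<omega>. ennreal (real (Ion \<omega>) ^ ?k) * indicator {..n} (Ion \<omega>) \<partial>M)"
      by (rule nn_integral_cmult,
          rule measurable_compose[OF meas_Ion, where g = "\<lambda>m. ennreal (real m ^ ?k) * indicator {..n} m"]) simp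
    also have "\<dots> \<le> ennreal ?c * ennreal (real ?k * 2 ^ p * C * real n * (x ^ p * Ion_tail x))"
    proof (intro mult_left_mono truncated_moment_le meas_Ion potter x C)
      have "\<eta> * x \<le> 1 * x" using \<eta> x by (intro mult_right_mono) auto
      then show "real n \<le> x" using n(1) by linarith
    qed auto
    also have "\<dots> = ennreal (?c * (real ?k * 2 ^ p * C * real n * (x ^ p * Ion_tail x)))"
      using c C x Fnn[of x] by (intro ennreal_mult[symmetric]) auto
    finally have "ennreal (prob ?E3) \<le> ennreal (?c * (real ?k * 2 ^ p * C * real n * (x ^ p * Ion_tail x)))" .
    moreover have "real ?k * 2 ^ p * C * real n * (x ^ p * Ion_tail x) \<ge> 0"
      using C x Fnn[of x] by (intro mult_nonneg_nonneg) auto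
    ultimately have "prob ?E3 \<le> ?c * (real ?k * 2 ^ p * C * real n * (x ^ p * Ion_tail x))"
      using mult_nonneg_nonneg[OF c] ennreal_le_iff by blast
    also have "\<dots> \<le> ?c * (real ?k * 2 ^ p * C * (\<eta> * x) * (x ^ p * Ion_tail x))"
      using c C x Fnn[of x] n(1) by (intro mult_left_mono mult_right_mono) auto
    also have "\<dots> = exp 1 * ((B / y) ^ ?k * x ^ ?k) * (real ?k * 2 ^ p * C) * \<eta> * Ion_tail x"
      by simp
    \<comment> \<open>The powers of x cancel, since y is proportional to x.\<close>
    also have "(B / y) ^ ?k * x ^ ?k = (2 * real ?k * B) ^ ?k"
    proof -
      have "B / y * x = 2 * real ?k * B" using x unfolding y_def by (simp add: field_simps)
      then show ?thesis unfolding power_mult_distrib[symmetric] by simp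
    qed
    finally show ?thesis .
  qed
  finally show ?thesis by (simp only: y_def add.assoc)
qed

text \<open>With \<open>x = \<mu> * z\<close>, on-periods beyond \<open>z / v\<close> give the main
  term; those above \<open>\<eta> * \<mu> * z\<close> and up to \<open>z / v\<close> cost
  \<open>\<epsilon> / 8\<close> by the law of large numbers, and the shorter ones
  \<open>3 * \<epsilon> / 8\<close>.\<close>

lemma net_tail_upper:
  fixes \<rho> :: "real \<Rightarrow> real"
  assumes cv: "cons_var Ion_tail" and pos: "\<And>x. Ion_tail x > 0" and lam: "lam > 1"
    and int: "integrable M (\<lambda>\<omega>. real (Ion \<omega>))"
    and \<rho>: "\<And>t y. prob {\<omega> \<in> space M. real (N t \<omega>) > y} \<le> \<rho> y"
    and \<rho>_small: "\<And>c. c > 0 \<Longrightarrow> \<forall>\<^sub>F y in at_top. \<rho> y \<le> c * Ion_tail y" and \<epsilon>: "\<epsilon> > 0"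
  shows "\<forall>\<^sub>F x in at_top. rv_tail M net x \<le> (1 + \<epsilon>) * Ion_tail (x / (lam - 1))"
proof -
  define \<mu> where "\<mu> = lam - 1"
  have \<mu>: "\<mu> > 0" using lam by (simp add: \<mu>_def)
  have anti: "antimono Ion_tail" by (intro antimono_rv_tail measurable_compose[OF meas_Ion]) simp
  have nn: "Ion_tail x \<ge> 0" for x by (rule rv_tail_nonneg)
  have le1: "Ion_tail x \<le> 1" for x by (rule rv_tail_le_1)
  have scale: "\<exists>\<kappa>>0. \<forall>\<^sub>F z in at_top. Ion_tail (a * z) \<le> \<kappa> * Ion_tail z" if "a > 0" for a
  proof -
    obtain \<kappa> where "\<kappa> > 0" "\<forall>\<^sub>F y in at_top. Ion_tail y \<le> \<kappa> * Ion_tail (1 / a * y)"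
      using cons_var_dominated[OF cv anti nn] by blast
    then have "\<forall>\<^sub>F z in at_top. Ion_tail (a * z) \<le> \<kappa> * Ion_tail (1 / a * (a * z))"
      by (intro eventually_at_top_scale[OF that])
    moreover have "1 / a * (a * z) = z" for z using that by simp
    ultimately have "\<forall>\<^sub>F z in at_top. Ion_tail (a * z) \<le> \<kappa> * Ion_tail z" by (simp only:)
    with \<open>\<kappa> > 0\<close> show ?thesis by blast
  qed
  have \<rho>_scale: "\<forall>\<^sub>F z in at_top. \<rho> (a * z) \<le> d * Ion_tail z" if "a > 0" "d > 0" for a d
  proof -
    obtain \<kappa> where \<kappa>: "\<kappa> > 0" "\<forall>\<^sub>F z in at_top. Ion_tail (a * z) \<le> \<kappa> * Ion_tail z"
      using scale[OF \<open>a > 0\<close>] by blast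
    have "\<forall>\<^sub>F z in at_top. \<rho> (a * z) \<le> d / \<kappa> * Ion_tail (a * z)"
      using that \<kappa>(1) by (intro eventually_at_top_scale[OF _ \<rho>_small]) auto
    with \<kappa>(2) show ?thesis
    proof eventually_elim
      case (elim z)
      have "d / \<kappa> * Ion_tail (a * z) \<le> d / \<kappa> * (\<kappa> * Ion_tail z)"
        using elim(1) that \<kappa> by (intro mult_left_mono) auto
      also have "\<dots> = d * Ion_tail z" using \<kappa>(1) by simp
      finally show ?case using elim(2) by linarith
    qed
  qed
  obtain v where v: "v > 1" "\<forall>\<^sub>F y in at_top. Ion_tail y \<le> (1 + \<epsilon> / 2) * Ion_tail (v * y)"
    using cons_varD[OF cv, of "\<epsilon> / 2"] \<epsilon> by auto
  have H1: "\<forall>\<^sub>F z in at_top. Ion_tail (z / v) \<le> (1 + \<epsilon> / 2) * Ion_tail z"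
    using eventually_at_top_scale[OF _ v(2), of "1 / v"] v(1) by simp
  obtain p C where pC: "C > 0"
    "\<And>y z. 0 \<le> y \<Longrightarrow> y \<le> z \<Longrightarrow> 1 \<le> z \<Longrightarrow> y ^ p * Ion_tail y \<le> C * (z ^ p * Ion_tail z)"
  proof -
    obtain p C where "C > 0" and *: "\<forall>y z. 0 \<le> y \<longrightarrow> y \<le> z \<longrightarrow> 1 \<le> z \<longrightarrow> y ^ p * Ion_tail y \<le> C * (z ^ p * Ion_tail z)"
      using cons_var_potter[OF cv anti pos le1] by blast
    have "y ^ p * Ion_tail y \<le> C * (z ^ p * Ion_tail z)" if "0 \<le> y" "y \<le> z" "1 \<le> z" for y z
      using *[rule_format, OF that] .
    then show thesis by (rule that[OF \<open>C > 0\<close>])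
  qed
  define B where "B = max 1 (Max (range drift))"
  have B: "drift i \<le> B" "B > 0" for i
  proof -
    have "drift i \<le> Max (range drift)" by (intro Max_ge) auto
    then show "drift i \<le> B" "B > 0" unfolding B_def by linarith+
  qed
  obtain \<kappa>3 where \<kappa>3: "\<kappa>3 > 0" "\<forall>\<^sub>F z in at_top. Ion_tail (\<mu> * z) \<le> \<kappa>3 * Ion_tail z"
    using scale[OF \<mu>] by blast
  define D where "D = exp 1 * (2 * real (Suc p) * B) ^ Suc p * (real (Suc p) * 2 ^ p * C)"
  have D: "D > 0" using B pC by (simp add: D_def)
  \<comment> \<open>The first two bounds are conditions of \<open>net_tail_small_Ion\<close>; the
    third makes its Chernoff term at most \<open>\<epsilon> / 8\<close> of the tail at z, with
    \<open>\<kappa>3\<close> accounting for the passage from \<open>\<mu> * z\<close> to z.\<close>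
  define \<eta> where "\<eta> = min 1 (min (1 / (2 * real (Suc p) * B)) (\<epsilon> / (8 * (D * \<kappa>3))))"
  have \<eta>: "\<eta> > 0" "\<eta> \<le> 1" "\<eta> * (2 * real (Suc p) * B) \<le> 1" "D * \<eta> * \<kappa>3 \<le> \<epsilon> / 8"
  proof -
    have p1: "2 * real (Suc p) * B > 0" and p2: "8 * (D * \<kappa>3) > 0" using B(2) D \<kappa>3(1) by simp_all
    show "\<eta> > 0" unfolding \<eta>_def using p1 p2 \<epsilon> by (simp only: min_less_iff_conj divide_pos_pos zero_less_one simp_thms)
    show "\<eta> \<le> 1" unfolding \<eta>_def by (rule min.cobounded1)
    have "\<eta> \<le> 1 / (2 * real (Suc p) * B)" unfolding \<eta>_def by (rule min.coboundedI2, rule min.cobounded1)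
    then show "\<eta> * (2 * real (Suc p) * B) \<le> 1" using pos_le_divide_eq[OF p1, of \<eta> 1] by blast
    have "\<eta> \<le> \<epsilon> / (8 * (D * \<kappa>3))" unfolding \<eta>_def by (rule min.coboundedI2, rule min.cobounded2)
    then have "\<eta> * (8 * (D * \<kappa>3)) \<le> \<epsilon>" using pos_le_divide_eq[OF p2, of \<eta> \<epsilon>] by blast
    moreover have "\<eta> * (8 * (D * \<kappa>3)) = 8 * (D * \<eta> * \<kappa>3)" by simp
    ultimately show "D * \<eta> * \<kappa>3 \<le> \<epsilon> / 8" by linarith
  qed
  have "\<eta> * \<mu> > 0" using \<eta> \<mu> by simp
  then obtain \<kappa>2 where \<kappa>2: "\<kappa>2 > 0" "\<forall>\<^sub>F z in at_top. Ion_tail (\<eta> * \<mu> * z) \<le> \<kappa>2 * Ion_tail z"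
    using scale by blast
  \<comment> \<open>\<open>\<kappa>2\<close> depends on \<open>\<eta>\<close>, so the tolerance in
    the law of large numbers is fixed only now.\<close>
  define \<tau> where "\<tau> = \<epsilon> / (16 * \<kappa>2)"
  have \<tau>: "\<tau> > 0" "2 * \<tau> * \<kappa>2 = \<epsilon> / 8" using \<epsilon> \<kappa>2 by (auto simp: \<tau>_def)
  \<comment> \<open>\<open>a * z\<close> is the share granted to slot 0 and
    \<open>(\<mu> + e) * z / v\<close> that of the later slots. Half of the slack
    \<open>\<mu> - \<mu> / v\<close> becomes a, the other half \<open>e / v\<close>.\<close>
  define a where "a = \<mu> * (1 - 1 / v) / 2"
  define e where "e = v * a"
  have ae: "a > 0" "e > 0" "a + (\<mu> + e) / v = \<mu>"
  proof -
    show "a > 0" using v \<mu> by (simp add: a_def)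
    then show "e > 0" using v by (simp add: e_def)
    have "(\<mu> + e) / v = \<mu> / v + a" using v(1) by (simp add: e_def add_divide_distrib)
    moreover have "2 * a = \<mu> - \<mu> / v" by (simp add: a_def right_diff_distrib)
    ultimately show "a + (\<mu> + e) / v = \<mu>" by linarith
  qed
  have "\<forall>\<^sub>F n in sequentially. prob {\<omega> \<in> space M. total n \<omega> \<ge> (lam + e) * real n} < \<tau>"
    using arrivals_upper_lln[OF ae(2)] \<tau>(1) by (intro order_tendstoD) auto
  then obtain n0 where n0: "\<And>n. n \<ge> n0 \<Longrightarrow> prob {\<omega> \<in> space M. total n \<omega> \<ge> (lam + e) * real n} < \<tau>"
    unfolding eventually_sequentially by blast
  have "\<forall>\<^sub>F z in at_top. \<rho> (a * z) \<le> \<tau> * Ion_tail z" by (rule \<rho>_scale[OF ae(1) \<tau>(1)])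
  moreover have "\<forall>\<^sub>F z in at_top. \<rho> (\<mu> / 2 * z) \<le> \<epsilon> / 8 * Ion_tail z" using \<mu> \<epsilon> by (intro \<rho>_scale) auto
  moreover define E where "E = expectation (\<lambda>\<omega>. real (Ion \<omega>))"
  have E: "E \<ge> 0" unfolding E_def by (intro integral_nonneg_AE) auto
  have "\<forall>\<^sub>F z in at_top. \<rho> (\<mu> / (2 * real (Suc p)) * z) \<le> \<epsilon> / (8 * (E + 1)) * Ion_tail z"
    using \<mu> \<epsilon> E by (intro \<rho>_scale) auto
  moreover have "\<forall>\<^sub>F z in at_top. z \<ge> max (1 / \<mu>) (v * (real n0 + 2))" by (rule eventually_ge_at_top)
  ultimately have "\<forall>\<^sub>F z in at_top. rv_tail M net (\<mu> * z) \<le> (1 + \<epsilon>) * Ion_tail z"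
    using H1 \<kappa>2(2) \<kappa>3(2)
  proof eventually_elim
    case (elim z)
    have z: "\<mu> * z \<ge> 1" "z / v \<ge> real n0 + 2"
    proof -
      have "1 / \<mu> \<le> z" "v * (real n0 + 2) \<le> z" using elim(4) by auto
      then show "\<mu> * z \<ge> 1" "z / v \<ge> real n0 + 2"
        using \<mu> v(1) by (simp_all add: pos_divide_le_eq pos_le_divide_eq mult.commute)
    qed
    define m where "m = nat \<lfloor>z / v\<rfloor>"
    have m: "real m \<le> z / v" "z / v < real m + 1" using z(2) unfolding m_def by linarith+
    have m1: "m \<ge> 1" "m - 1 \<ge> n0" using m z(2) by linarith+
    have mz: "real (m - 1) \<le> z / v" using m(1) by simp
    have Im: "real i \<le> z / v \<longleftrightarrow> i \<le> m" for i :: nat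
      using m by linarith
    \<comment> \<open>By monotonicity the m slots dominate any on-period of length at most m. The
      event no longer mentions \<open>Ion\<close> and is independent of it.\<close>
    define \<Psi> where "\<Psi> x \<longleftrightarrow> real (fst (x 0)) - 1 + real (\<Sum>t\<in>{1..m - 1}. fst (x t)) - real (m - 1) > \<mu> * z" for x :: "nat \<Rightarrow> nat \<times> 'd"
    have meas\<Psi>: "Measurable.pred path_space \<Psi>" unfolding \<Psi>_def by measurable
    let ?A = "{\<omega> \<in> space M. real (Ion \<omega>) > z / v}"
    let ?B = "{\<omega> \<in> space M. Ion \<omega> \<in> {i. real i > \<eta> * (\<mu> * z)} \<and> \<Psi> (arrivals \<omega>)}"
    let ?C = "{\<omega> \<in> space M. real (Ion \<omega>) \<le> \<eta> * (\<mu> * z) \<and> net \<omega> > \<mu> * z}"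
    have ev\<Psi>[measurable]: "{\<omega> \<in> space M. \<Psi> (arrivals \<omega>)} \<in> events"
      unfolding \<Psi>_def fst_conv by measurable
    have "?B = {\<omega> \<in> space M. real (Ion \<omega>) > \<eta> * (\<mu> * z)} \<inter> {\<omega> \<in> space M. \<Psi> (arrivals \<omega>)}" by auto
    also have "\<dots> \<in> events" by measurable
    finally have evB: "?B \<in> events" .
    have evA: "?A \<in> events" and evC: "?C \<in> events" by measurable
    have "rv_tail M net (\<mu> * z) = prob {\<omega> \<in> space M. net \<omega> > \<mu> * z}" by (simp add: rv_tail_def)
    also have "\<dots> \<le> prob (?A \<union> (?B \<union> ?C))"
    proof (rule finite_measure_mono_AE)
      show "AE \<omega> in M. \<omega> \<in> {\<omega> \<in> space M. net \<omega> > \<mu> * z} \<longrightarrow> \<omega> \<in> ?A \<union> (?B \<union> ?C)"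
        using AE_N_pos
      proof eventually_elim
        case (elim \<omega>)
        show ?case
        proof (intro impI, rule ccontr)
          assume \<omega>: "\<omega> \<in> {\<omega> \<in> space M. net \<omega> > \<mu> * z}" and c: "\<omega> \<notin> ?A \<union> (?B \<union> ?C)"
          have sp: "\<omega> \<in> space M" "net \<omega> > \<mu> * z" using \<omega> by auto
          have "Ion \<omega> \<le> m" using c sp(1) Im[of "Ion \<omega>"] by auto
          moreover have "\<not> \<Psi> (arrivals \<omega>)" using c sp by auto
          ultimately show False
            using net_le[OF elim m1(1)] sp(2) unfolding \<Psi>_def fst_conv by linarith
        qed
      qed
    qed (use evA evB evC in auto)
    also have "\<dots> \<le> prob ?A + prob (?B \<union> ?C)" using evA evB evC by (intro measure_Un_le) auto
    also have "prob (?B \<union> ?C) \<le> prob ?B + prob ?C" using evB evC by (intro measure_Un_le) auto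
    also have "prob ?A \<le> (1 + \<epsilon> / 2) * Ion_tail z" using elim(5) by (simp add: rv_tail_def)
    also have "prob ?B \<le> \<epsilon> / 8 * Ion_tail z"
    proof -
      have "prob {\<omega> \<in> space M. \<Psi> (arrivals \<omega>)} \<le> 2 * \<tau>"
      proof -
        let ?G1 = "{\<omega> \<in> space M. real (N 0 \<omega>) > a * z}"
        let ?G2 = "{\<omega> \<in> space M. total (m - 1) \<omega> \<ge> (lam + e) * real (m - 1)}"
        have "prob {\<omega> \<in> space M. \<Psi> (arrivals \<omega>)} \<le> prob (?G1 \<union> ?G2)"
        proof (rule finite_measure_mono)
          show "{\<omega> \<in> space M. \<Psi> (arrivals \<omega>)} \<subseteq> ?G1 \<union> ?G2"
          proof
            fix \<omega> assume \<omega>: "\<omega> \<in> {\<omega> \<in> space M. \<Psi> (arrivals \<omega>)}"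
            have "(\<mu> + e) * real (m - 1) \<le> (\<mu> + e) * (z / v)"
              using mz \<mu> ae by (intro mult_left_mono) auto
            moreover have "a * z + (\<mu> + e) * (z / v) = \<mu> * z"
            proof -
              have "a * z + (\<mu> + e) * (z / v) = (a + (\<mu> + e) / v) * z" by (simp add: algebra_simps)
              then show ?thesis unfolding ae(3) .
            qed
            moreover have "(lam + e) * real (m - 1) - real (m - 1) = (\<mu> + e) * real (m - 1)"
              by (simp add: \<mu>_def algebra_simps)
            moreover have "real (N 0 \<omega>) - 1 + total (m - 1) \<omega> - real (m - 1) > \<mu> * z"
              using \<omega> unfolding \<Psi>_def by simp
            ultimately have "real (N 0 \<omega>) > a * z \<or> total (m - 1) \<omega> \<ge> (lam + e) * real (m - 1)"
              by linarith
            then show "\<omega> \<in> ?G1 \<union> ?G2" using \<omega> by blast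
          qed
        qed measurable
        also have "\<dots> \<le> prob ?G1 + prob ?G2" by (rule measure_Un_le) measurable
        also have "prob ?G1 \<le> \<tau>"
        proof -
          have "prob ?G1 \<le> \<rho> (a * z)" by (rule \<rho>)
          also have "\<dots> \<le> \<tau> * Ion_tail z" by (rule elim(1))
          also have "\<dots> \<le> \<tau> * 1" using \<tau>(1) le1 by (intro mult_left_mono) auto
          finally show ?thesis by simp
        qed
        also have "prob ?G2 \<le> \<tau>" using n0[OF m1(2)] by simp
        finally show ?thesis by simp
      qed
      then have "prob ?B \<le> Ion_tail (\<eta> * \<mu> * z) * (2 * \<tau>)"
        unfolding prob_indep_mult[OF meas\<Psi>] using nn[of "\<eta> * \<mu> * z"]
        by (intro mult_mono) (auto simp: rv_tail_def mult.assoc)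
      also have "\<dots> \<le> \<kappa>2 * Ion_tail z * (2 * \<tau>)" using elim(6) \<tau>(1) by (intro mult_right_mono) auto
      also have "\<dots> = (2 * \<tau> * \<kappa>2) * Ion_tail z" by (simp add: mult_ac)
      finally show ?thesis unfolding \<tau>(2) .
    qed
    also have "prob ?C \<le> 3 * (\<epsilon> / 8) * Ion_tail z"
    proof -
      have "prob ?C \<le> \<rho> (\<mu> * z / 2) + E * \<rho> (\<mu> * z / (2 * real (Suc p))) + D * \<eta> * Ion_tail (\<mu> * z)"
        unfolding E_def D_def
        by (rule net_tail_small_Ion[OF int \<rho> pC(2) pC(1) B \<eta>(1-3) z(1)])
      also have "\<rho> (\<mu> * z / 2) \<le> \<epsilon> / 8 * Ion_tail z" using elim(2) by simp
      also have "E * \<rho> (\<mu> * z / (2 * real (Suc p))) \<le> \<epsilon> / 8 * Ion_tail z"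
      proof -
        have "E * \<rho> (\<mu> * z / (2 * real (Suc p))) \<le> E * (\<epsilon> / (8 * (E + 1)) * Ion_tail z)"
          using elim(3) E by (intro mult_left_mono) auto
        also have "\<dots> = E / (E + 1) * (\<epsilon> / 8 * Ion_tail z)" by simp
        also have "\<dots> \<le> 1 * (\<epsilon> / 8 * Ion_tail z)" using E \<epsilon> nn[of z] by (intro mult_right_mono) auto
        finally show ?thesis by simp
      qed
      also have "D * \<eta> * Ion_tail (\<mu> * z) \<le> \<epsilon> / 8 * Ion_tail z"
      proof -
        have "D * \<eta> * Ion_tail (\<mu> * z) \<le> D * \<eta> * (\<kappa>3 * Ion_tail z)"
          using elim(7) D \<eta> by (intro mult_left_mono) auto
        also have "\<dots> = (D * \<eta> * \<kappa>3) * Ion_tail z" by simp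
        also have "\<dots> \<le> \<epsilon> / 8 * Ion_tail z" using \<eta>(4) nn by (intro mult_right_mono) auto
        finally show ?thesis .
      qed
      finally show ?thesis by simp
    qed
    finally have "rv_tail M net (\<mu> * z)
       \<le> (1 + \<epsilon> / 2) * Ion_tail z + (\<epsilon> / 8 * Ion_tail z + 3 * (\<epsilon> / 8) * Ion_tail z)"
      by simp
    also have "\<dots> = (1 + \<epsilon>) * Ion_tail z" by (simp add: algebra_simps)
    finally show ?case .
  qed
  from eventually_at_top_scale[OF _ this, of "1 / \<mu>"] show ?thesis
    using \<mu> by (simp add: \<mu>_def)
qed

end

section \<open>The batch Markovian arrival process\<close>

lemma nn_integral_nat_prod:
  fixes f :: "nat \<times> 'd::finite \<Rightarrow> ennreal"
  shows "(\<integral>\<^sup>+z. f z \<partial>count_space (UNIV :: (nat \<times> 'd) set)) = (\<Sum>j\<in>UNIV. \<Sum>k. f (k, j))"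
proof -
  have "(\<integral>\<^sup>+z. f z \<partial>count_space (UNIV :: (nat \<times> 'd) set)) = (\<integral>\<^sup>+j. (\<integral>\<^sup>+k. f (k, j) \<partial>count_space UNIV) \<partial>count_space UNIV)"
    by (rule nn_integral_snd_count_space[symmetric])
  also have "\<dots> = (\<Sum>j\<in>UNIV. \<integral>\<^sup>+k. f (k, j) \<partial>count_space UNIV)"
    by (rule nn_integral_count_space_finite) simp
  finally show ?thesis by (simp only: nn_integral_count_space_nat)
qed

lemma suminf_indicator_greater:
  assumes "\<And>k. a k \<ge> (0::real)" "summable a"
  shows "(\<Sum>m. ennreal (a m) * indicator {k<..} m) = ennreal (\<Sum>l. a (l + k + 1))"
proof -
  have "(\<Sum>m. ennreal (a m) * indicator {k<..} m) = (\<Sum>m. ennreal (a (m + Suc k)) * indicator {k<..} (m + Suc k)) + (\<Sum>m<Suc k. ennreal (a m) * indicator {k<..} m)"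
    by (rule suminf_offset) simp
  also have "(\<Sum>m<Suc k. ennreal (a m) * indicator {k<..} m) = 0"
    by (intro sum.neutral) auto
  also have "(\<Sum>m. ennreal (a (m + Suc k)) * indicator {k<..} (m + Suc k)) = (\<Sum>m. ennreal (a (m + k + 1)))" by simp
  also have "\<dots> = ennreal (\<Sum>l. a (l + k + 1))"
  proof (rule suminf_ennreal2)
    have "summable (\<lambda>l. a (l + (k + 1)))" by (rule summable_ignore_initial_segment[OF assms(2)])
    then show "summable (\<lambda>l. a (l + k + 1))" by (simp add: add.assoc)
  qed (rule assms)
  finally show ?thesis by simp
qed

text \<open>The model prescribes point masses only for batches of size at least 1. As these already
  exhaust the probability of E, nothing is left for a value outside the support of q.\<close>

lemma (in prob_space) prob_eq_0_if_pmf_eq_0: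
  fixes Z :: "'a \<Rightarrow> 'c::countable"
  assumes Z[measurable]: "Z \<in> M \<rightarrow>\<^sub>M count_space UNIV" and E[measurable]: "Measurable.pred M E"
    and ge: "\<And>z. prob {\<omega> \<in> space M. E \<omega> \<and> Z \<omega> = z} \<ge> pmf q z * prob {\<omega> \<in> space M. E \<omega>}"
    and z0: "pmf q z0 = 0"
  shows "prob {\<omega> \<in> space M. E \<omega> \<and> Z \<omega> = z0} = 0"
proof -
  let ?g = "\<lambda>z. prob {\<omega> \<in> space M. E \<omega> \<and> Z \<omega> = z}"
  let ?c = "prob {\<omega> \<in> space M. E \<omega>}"
  let ?W = "\<lambda>\<omega>. if E \<omega> then Some (Z \<omega>) else None"
  have ev: "?g z \<ge> 0" for z by simp
  have "ennreal ?c = (\<integral>\<^sup>+\<omega>. (case ?W \<omega> of Some z \<Rightarrow> 1 | None \<Rightarrow> 0) \<partial>M)"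
  proof -
    have "ennreal ?c = (\<integral>\<^sup>+\<omega>. indicator {\<omega> \<in> space M. E \<omega>} \<omega> \<partial>M)"
      by (simp add: emeasure_eq_measure)
    also have "\<dots> = (\<integral>\<^sup>+\<omega>. (case ?W \<omega> of Some z \<Rightarrow> 1 | None \<Rightarrow> 0) \<partial>M)"
      by (intro nn_integral_cong) auto
    finally show ?thesis .
  qed
  also have "\<dots> = (\<integral>\<^sup>+w. (case w of Some z \<Rightarrow> 1 | None \<Rightarrow> 0) * ennreal (prob {\<omega> \<in> space M. ?W \<omega> = w}) \<partial>count_space UNIV)"
    by (rule nn_integral_countable_rv) measurable
  also have "\<dots> = (\<integral>\<^sup>+w. (case w of Some z \<Rightarrow> 1 | None \<Rightarrow> 0) * ennreal (prob {\<omega> \<in> space M. ?W \<omega> = w}) \<partial>count_space (range Some))"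
    (is "_ = ?R") by (rule nn_integral_count_space_eq) (auto split: option.splits)
  also have "?R = (\<integral>\<^sup>+z. ennreal (?g z) \<partial>count_space UNIV)"
  proof -
    have "{\<omega> \<in> space M. ?W \<omega> = Some z} = {\<omega> \<in> space M. E \<omega> \<and> Z \<omega> = z}" for z by auto
    then show ?thesis
      by (subst nn_integral_bij_count_space[symmetric, of Some UNIV]) (auto simp: bij_betw_def)
  qed
  \<comment> \<open>The value \<open>z0\<close> has no mass under q, so its actual mass can be added
    on top without double counting.\<close>
  also have "\<dots> \<ge> (\<integral>\<^sup>+z. ennreal (pmf q z) * ennreal ?c + ennreal (?g z0) * indicator {z0} z \<partial>count_space UNIV)"
    (is "_ \<ge> ?S")
    using ge z0 by (intro nn_integral_mono) (auto split: split_indicator simp: ennreal_mult[symmetric] intro!: ennreal_leI)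
  also have "?S = ennreal ?c + ennreal (?g z0)"
  proof -
    have "(\<integral>\<^sup>+z. ennreal (pmf q z) * ennreal ?c \<partial>count_space UNIV) = ennreal ?c"
      using nn_integral_measure_pmf[of q "\<lambda>_. ennreal ?c"] by (simp add: measure_pmf.emeasure_space_1)
    then show ?thesis by (subst nn_integral_add) auto
  qed
  finally have "ennreal ?c + ennreal (?g z0) \<le> ennreal ?c" .
  then have "?g z0 \<le> 0" by (simp add: ennreal_plus[symmetric] del: ennreal_plus)
  then show ?thesis using ev[of z0] by linarith
qed

locale bmap = prob_space M for M :: "'a measure" +
  fixes N :: "nat \<Rightarrow> 'a \<Rightarrow> nat" and J :: "nat \<Rightarrow> 'a \<Rightarrow> 'd::finite"
    and \<alpha> :: "nat \<Rightarrow> real^'d" and \<Lambda> :: "nat \<Rightarrow> real^'d^'d"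
  assumes meas_N[measurable]: "\<And>n. N n \<in> M \<rightarrow>\<^sub>M count_space UNIV"
    and meas_J[measurable]: "\<And>n. J n \<in> M \<rightarrow>\<^sub>M count_space UNIV"
    and \<alpha>0: "\<alpha> 0 = 0" and \<Lambda>0: "\<Lambda> 0 = 0"
    and init: "\<And>k i. k \<ge> 1 \<Longrightarrow>
        measure M {\<omega> \<in> space M. N 0 \<omega> = k \<and> J 0 \<omega> = i} = \<alpha> k $ i"
    and markov: "\<And>n ks js k j. n \<ge> 1 \<Longrightarrow> k \<ge> 1 \<Longrightarrow>
        measure M {\<omega> \<in> space M. (\<forall>t<n. N t \<omega> = ks t \<and> J t \<omega> = js t) \<and> N n \<omega> = k \<and> J n \<omega> = j}
        = \<Lambda> k $ js (n - 1) $ j * measure M {\<omega> \<in> space M. \<forall>t<n. N t \<omega> = ks t \<and> J t \<omega> = js t}"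
    and \<alpha>_summ: "\<And>i. summable (\<lambda>k. \<alpha> k $ i)"
    and \<alpha>_prob: "prob_vector (\<chi> i. \<Sum>k. \<alpha> k $ i)"
    and \<Lambda>_summ: "\<And>i j. summable (\<lambda>k. \<Lambda> k $ i $ j)"
    and \<Lambda>_stoch: "stochastic_mat (\<chi> i j. \<Sum>k. \<Lambda> k $ i $ j)"
    and \<Lambda>_irred: "irreducible_mat (\<chi> i j. \<Sum>k. \<Lambda> k $ i $ j)"
    and lam_summ: "\<And>i j. summable (\<lambda>k. real k * \<Lambda> k $ i $ j)"
begin

definition P :: "real^'d^'d" where "P = (\<chi> i j. \<Sum>k. \<Lambda> k $ i $ j)"

lemma P_nth: "P $ i $ j = (\<Sum>k. \<Lambda> k $ i $ j)" by (simp add: P_def)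

lemma P_stochastic: "P $ i $ j \<ge> 0" "(\<Sum>j\<in>UNIV. P $ i $ j) = 1"
  using \<Lambda>_stoch by (auto simp: stochastic_mat_def P_def)

section \<open>Visited states and the signs of the matrix entries\<close>

abbreviation "follows n ks js \<omega> \<equiv> \<forall>t<n. N t \<omega> = ks t \<and> J t \<omega> = js t"

lemma \<alpha>_nonneg: "\<alpha> k $ i \<ge> 0"
  using init[of k i] \<alpha>0 by (cases "k = 0") (auto simp: measure_nonneg simp flip: init)

text \<open>There are countably many histories, so they cannot all be null.\<close>

lemma visited_path:
  assumes "prob {\<omega> \<in> space M. J n \<omega> = i} > 0"
  shows "\<exists>ks js. js n = i \<and> prob {\<omega> \<in> space M. follows (Suc n) ks js \<omega>} > 0"
proof (rule ccontr)
  assume c: "\<not> ?thesis"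
  define S where "S = {q :: (nat \<times> 'd) list. length q = Suc n \<and> snd (q ! n) = i}"
  let ?E = "\<lambda>q. {\<omega> \<in> space M. \<forall>t<Suc n. N t \<omega> = fst (q ! t) \<and> J t \<omega> = snd (q ! t)}"
  have "{\<omega> \<in> space M. J n \<omega> = i} \<subseteq> (\<Union>q\<in>S. ?E q)"
  proof
    fix \<omega> assume \<omega>: "\<omega> \<in> {\<omega> \<in> space M. J n \<omega> = i}"
    let ?q = "map (\<lambda>t. (N t \<omega>, J t \<omega>)) [0..<Suc n]"
    have "?q \<in> S" "\<omega> \<in> ?E ?q" using \<omega> by (auto simp: S_def simp del: upt_Suc)
    then show "\<omega> \<in> (\<Union>q\<in>S. ?E q)" by blast
  qed
  moreover have "(\<Union>q\<in>S. ?E q) \<in> null_sets M"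
  proof (rule null_sets_UN')
    fix q assume "q \<in> S"
    then have "\<not> prob (?E q) > 0"
      using c by (auto simp: S_def)
    then have "prob (?E q) = 0" using measure_nonneg[of M "?E q"] by linarith
    then show "?E q \<in> null_sets M" by (auto simp: emeasure_eq_measure null_sets_def)
  qed simp
  ultimately have "{\<omega> \<in> space M. J n \<omega> = i} \<in> null_sets M"
    by (rule null_sets_subset[rotated 2]) measurable
  then show False using assms by (simp add: null_sets_def emeasure_eq_measure)
qed

text \<open>The hypothesis \<open>markov\<close> says nothing about \<open>\<Lambda> k $ i $ j\<close> at states \<open>i\<close> that are never visited;
  irreducibility rules such states out.\<close>

lemma every_state_visited: "\<exists>n. prob {\<omega> \<in> space M. J n \<omega> = i} > 0"
proof -
  define V where "V = {i. \<exists>n. prob {\<omega> \<in> space M. J n \<omega> = i} > 0}"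
  have "V = UNIV"
  proof (rule irreducible_closed_eq_UNIV)
    show "P $ i $ j \<ge> 0" for i j by (rule P_stochastic)
    show "irreducible_mat P" using \<Lambda>_irred by (simp add: P_def)
    show "V \<noteq> {}"
    proof
      assume "V = {}"
      then have "\<not> prob {\<omega> \<in> space M. J 0 \<omega> = i} > 0" for i unfolding V_def by blast
      then have 0: "prob {\<omega> \<in> space M. J 0 \<omega> = i} = 0" for i
        using measure_nonneg[of M "{\<omega> \<in> space M. J 0 \<omega> = i}"] by (metis less_eq_real_def)
      have "prob (space M) = prob (\<Union>i\<in>UNIV. {\<omega> \<in> space M. J 0 \<omega> = i})" by (intro arg_cong[where f=prob]) auto
      also have "\<dots> \<le> (\<Sum>i\<in>UNIV. prob {\<omega> \<in> space M. J 0 \<omega> = i})"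
        by (rule finite_measure_subadditive_finite) auto
      finally show False using 0 by (simp add: prob_space)
    qed
    fix i j assume "i \<in> V" and Pij: "P $ i $ j > 0"
    then obtain n where "prob {\<omega> \<in> space M. J n \<omega> = i} > 0" by (auto simp: V_def)
    then obtain ks js where js: "js n = i" "prob {\<omega> \<in> space M. follows (Suc n) ks js \<omega>} > 0"
      using visited_path by blast
    \<comment> \<open>The signs of the summands are not known at this stage; a positive sum still
      forces a positive term.\<close>
    have "\<exists>k. \<Lambda> k $ i $ j > 0"
    proof (rule ccontr)
      assume "\<not> ?thesis"
      then have "P $ i $ j \<le> (\<Sum>k::nat. 0)" unfolding P_nth by (intro suminf_le \<Lambda>_summ) (auto simp: not_less)
      then show False using Pij by simp
    qed
    then obtain k where k: "\<Lambda> k $ i $ j > 0" by blast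
    then have "k \<ge> 1" using \<Lambda>0 by (cases k) auto
    then have "prob {\<omega> \<in> space M. follows (Suc n) ks js \<omega> \<and> N (Suc n) \<omega> = k \<and> J (Suc n) \<omega> = j} > 0"
      using markov[of "Suc n" k ks js j] js k by simp
    moreover have "prob {\<omega> \<in> space M. follows (Suc n) ks js \<omega> \<and> N (Suc n) \<omega> = k \<and> J (Suc n) \<omega> = j}
       \<le> prob {\<omega> \<in> space M. J (Suc n) \<omega> = j}"
      by (rule finite_measure_mono) auto
    ultimately have "prob {\<omega> \<in> space M. J (Suc n) \<omega> = j} > 0" by linarith
    then show "j \<in> V" unfolding V_def by blast
  qed
  then show ?thesis unfolding V_def by blast
qed

text \<open>Along a history of positive probability ending in i, the entry is a quotient of
  probabilities.\<close>

lemma \<Lambda>_nonneg: "\<Lambda> k $ i $ j \<ge> 0"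
proof (cases "k = 0")
  case False
  obtain n where "prob {\<omega> \<in> space M. J n \<omega> = i} > 0" using every_state_visited by blast
  then obtain ks js where js: "js n = i" "prob {\<omega> \<in> space M. follows (Suc n) ks js \<omega>} > 0"
    using visited_path by blast
  have "0 \<le> prob {\<omega> \<in> space M. follows (Suc n) ks js \<omega> \<and> N (Suc n) \<omega> = k \<and> J (Suc n) \<omega> = j}"
    by simp
  also have "\<dots> = \<Lambda> k $ js (Suc n - 1) $ j * prob {\<omega> \<in> space M. follows (Suc n) ks js \<omega>}"
    using False by (intro markov) auto
  finally have "\<Lambda> k $ i $ j * prob {\<omega> \<in> space M. follows (Suc n) ks js \<omega>} \<ge> 0"
    unfolding diff_Suc_1 js(1) .
  then show ?thesis using js(2) by (simp add: zero_le_mult_iff)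
qed (simp add: \<Lambda>0)

section \<open>Transition and initial laws as probability mass functions\<close>

definition kernel :: "'d \<Rightarrow> (nat \<times> 'd) pmf" where
  "kernel i = embed_pmf (\<lambda>(k, j). \<Lambda> k $ i $ j)"

definition initial :: "(nat \<times> 'd) pmf" where
  "initial = embed_pmf (\<lambda>(k, i). \<alpha> k $ i)"

lemma pmf_kernel: "pmf (kernel i) (k, j) = \<Lambda> k $ i $ j"
proof -
  have "(\<Sum>j\<in>UNIV. \<Sum>k. ennreal (\<Lambda> k $ i $ j)) = (\<Sum>j\<in>UNIV. ennreal (P $ i $ j))"
    unfolding P_nth by (intro sum.cong refl suminf_ennreal2 \<Lambda>_nonneg \<Lambda>_summ)
  also have "\<dots> = 1" using P_stochastic by simp
  finally show ?thesis
    unfolding kernel_def by (subst pmf_embed_pmf) (simp_all only: \<Lambda>_nonneg nn_integral_nat_prod split_beta fst_conv snd_conv)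
qed

lemma pmf_initial: "pmf initial (k, i) = \<alpha> k $ i"
proof -
  have "(\<Sum>i\<in>UNIV. \<Sum>k. ennreal (\<alpha> k $ i)) = (\<Sum>i\<in>UNIV. ennreal (\<Sum>k. \<alpha> k $ i))"
    by (intro sum.cong refl suminf_ennreal2 \<alpha>_nonneg \<alpha>_summ)
  also have "\<dots> = ennreal (\<Sum>i\<in>UNIV. \<Sum>k. \<alpha> k $ i)"
    using \<alpha>_prob by (intro sum_ennreal) (simp add: prob_vector_def)
  also have "\<dots> = 1" using \<alpha>_prob by (simp add: prob_vector_def)
  finally show ?thesis
    unfolding initial_def by (subst pmf_embed_pmf) (simp_all only: \<alpha>_nonneg nn_integral_nat_prod split_beta fst_conv snd_conv)
qed

lemma nn_integral_kernel:
  "(\<integral>\<^sup>+z. f z \<partial>measure_pmf (kernel i)) = (\<Sum>j\<in>UNIV. \<Sum>k. ennreal (\<Lambda> k $ i $ j) * f (k, j))"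
  by (simp only: nn_integral_measure_pmf nn_integral_nat_prod pmf_kernel)

lemma nn_integral_kernel_fst:
  "(\<integral>\<^sup>+z. ennreal (real (fst z)) \<partial>measure_pmf (kernel i)) = ennreal (\<Sum>j\<in>UNIV. \<Sum>k. real k * \<Lambda> k $ i $ j)"
proof -
  have "(\<integral>\<^sup>+z. ennreal (real (fst z)) \<partial>measure_pmf (kernel i)) = (\<Sum>j\<in>UNIV. \<Sum>k. ennreal (real k * \<Lambda> k $ i $ j))"
  proof -
    have "ennreal (\<Lambda> k $ i $ j) * ennreal (real (fst (k, j))) = ennreal (real k * \<Lambda> k $ i $ j)" for k j
      by (simp add: ennreal_mult \<Lambda>_nonneg mult.commute)
    then show ?thesis by (simp only: nn_integral_kernel)
  qed
  also have "\<dots> = (\<Sum>j\<in>UNIV. ennreal (\<Sum>k. real k * \<Lambda> k $ i $ j))"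
    by (intro sum.cong refl suminf_ennreal2 lam_summ) (simp add: \<Lambda>_nonneg)
  also have "\<dots> = ennreal (\<Sum>j\<in>UNIV. \<Sum>k. real k * \<Lambda> k $ i $ j)"
    by (intro sum_ennreal suminf_nonneg lam_summ) (simp add: \<Lambda>_nonneg)
  finally show ?thesis .
qed

lemma drift_sum_nonneg: "(\<Sum>j\<in>UNIV. \<Sum>k. real k * \<Lambda> k $ i $ j) \<ge> 0"
  by (intro sum_nonneg suminf_nonneg lam_summ) (simp add: \<Lambda>_nonneg)

lemma kernel_mean:
  "integrable (measure_pmf (kernel i)) (\<lambda>z. real (fst z))"
  "measure_pmf.expectation (kernel i) (\<lambda>z. real (fst z)) = (\<Sum>j\<in>UNIV. \<Sum>k. real k * \<Lambda> k $ i $ j)"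
proof -
  have "integrable (measure_pmf (kernel i)) (\<lambda>z. real (fst z))
      \<and> measure_pmf.expectation (kernel i) (\<lambda>z. real (fst z)) = (\<Sum>j\<in>UNIV. \<Sum>k. real k * \<Lambda> k $ i $ j)"
    by (rule nn_integral_eq_integrable[THEN iffD1, OF _ _ drift_sum_nonneg nn_integral_kernel_fst]) simp_all
  then show "integrable (measure_pmf (kernel i)) (\<lambda>z. real (fst z))"
    "measure_pmf.expectation (kernel i) (\<lambda>z. real (fst z)) = (\<Sum>j\<in>UNIV. \<Sum>k. real k * \<Lambda> k $ i $ j)"
    by blast+
qed

lemma kernel_expectation_snd:
  "measure_pmf.expectation (kernel i) (\<lambda>z. h (snd z)) = (\<Sum>j\<in>UNIV. P $ i $ j * (h j :: real))"
proof -
  have pmf_snd: "pmf (map_pmf snd (kernel i)) j = P $ i $ j" for j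
  proof -
    have "ennreal (pmf (map_pmf snd (kernel i)) j) = (\<integral>\<^sup>+z. indicator {j} (snd z) \<partial>measure_pmf (kernel i))"
      by (subst ennreal_pmf_map) (intro nn_integral_cong, simp add: indicator_def)
    also have "\<dots> = (\<Sum>j'\<in>UNIV. if j' = j then (\<Sum>k. ennreal (\<Lambda> k $ i $ j)) else 0)"
      unfolding nn_integral_kernel by (intro sum.cong) auto
    also have "\<dots> = (\<Sum>k. ennreal (\<Lambda> k $ i $ j))" by simp
    also have "\<dots> = ennreal (P $ i $ j)"
      unfolding P_nth by (intro suminf_ennreal2 \<Lambda>_nonneg \<Lambda>_summ)
    finally show ?thesis using P_stochastic(1) by simp
  qed
  have "measure_pmf.expectation (kernel i) (\<lambda>z. h (snd z)) = measure_pmf.expectation (map_pmf snd (kernel i)) h"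
    by simp
  also have "\<dots> = (\<Sum>j\<in>UNIV. h j * pmf (map_pmf snd (kernel i)) j)"
    by (rule integral_measure_pmf_real[of UNIV]) auto
  finally show ?thesis by (simp add: pmf_snd mult.commute)
qed

text \<open>Batches of size at least 1 are covered by \<open>markov\<close>. An empty batch has
  kernel mass 0, and the exhausted total mass rules it out.\<close>

lemma prob_step:
  assumes n: "n \<ge> 1"
  shows "prob {\<omega> \<in> space M. (\<forall>t<n. N t \<omega> = ks t \<and> J t \<omega> = js t) \<and> N n \<omega> = k \<and> J n \<omega> = j}
        = pmf (kernel (js (n - 1))) (k, j) * prob {\<omega> \<in> space M. \<forall>t<n. N t \<omega> = ks t \<and> J t \<omega> = js t}"
proof (cases "k = 0")
  case True
  let ?E = "\<lambda>\<omega>. \<forall>t<n. N t \<omega> = ks t \<and> J t \<omega> = js t"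
  have 0: "pmf (kernel i) (0, j) = 0" for i j by (simp add: pmf_kernel \<Lambda>0)
  have "prob {\<omega> \<in> space M. ?E \<omega> \<and> (N n \<omega>, J n \<omega>) = (0, j)} = 0"
  proof (rule prob_eq_0_if_pmf_eq_0[where q = "kernel (js (n - 1))"])
    fix z :: "nat \<times> 'd"
    show "pmf (kernel (js (n - 1))) z * prob {\<omega> \<in> space M. ?E \<omega>} \<le> prob {\<omega> \<in> space M. ?E \<omega> \<and> (N n \<omega>, J n \<omega>) = z}"
    proof (cases "fst z = 0")
      case True
      then show ?thesis using 0[of "js (n - 1)" "snd z"] by (cases z) simp
    next
      case False
      then show ?thesis using markov[OF n, of "fst z" ks js "snd z"] by (cases z) (simp add: pmf_kernel)
    qed
  qed (use 0 in \<open>simp_all\<close>)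
  then show ?thesis using True 0 by simp
next
  case False
  then show ?thesis using markov[OF n, of k] by (simp add: pmf_kernel)
qed

sublocale markov_arrivals M N J kernel
  by unfold_locales (use prob_step kernel_mean in auto)

lemma prob_initial: "prob {\<omega> \<in> space M. (N 0 \<omega>, J 0 \<omega>) = z} = pmf initial z"
proof (cases "fst z = 0")
  case True
  have "prob {\<omega> \<in> space M. True \<and> (N 0 \<omega>, J 0 \<omega>) = z} = 0"
  proof (rule prob_eq_0_if_pmf_eq_0[where q = initial])
    fix z' :: "nat \<times> 'd"
    show "pmf initial z' * prob {\<omega> \<in> space M. True} \<le> prob {\<omega> \<in> space M. True \<and> (N 0 \<omega>, J 0 \<omega>) = z'}"
    proof (cases "fst z' = 0")
      case True
      then show ?thesis by (cases z') (simp add: pmf_initial \<alpha>0)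
    next
      case False
      then show ?thesis using init[of "fst z'" "snd z'"] by (cases z') (simp add: pmf_initial prob_space)
    qed
    show "pmf initial z = 0" using True by (cases z) (simp add: pmf_initial \<alpha>0)
  qed simp_all
  then show ?thesis using True by (cases z) (simp add: pmf_initial \<alpha>0)
next
  case False
  then show ?thesis using init[of "fst z" "snd z"] by (cases z) (simp add: pmf_initial)
qed

lemma nn_integral_initial:
  "(\<integral>\<^sup>+\<omega>. f (N 0 \<omega>, J 0 \<omega>) \<partial>M) = (\<Sum>i\<in>UNIV. \<Sum>k. ennreal (\<alpha> k $ i) * f (k, i))"
proof -
  have "(\<integral>\<^sup>+\<omega>. f (N 0 \<omega>, J 0 \<omega>) \<partial>M) = (\<integral>\<^sup>+z. f z * ennreal (pmf initial z) \<partial>count_space UNIV)"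
    unfolding prob_initial[symmetric] by (rule nn_integral_countable_rv) measurable
  then show ?thesis by (simp add: nn_integral_nat_prod pmf_initial mult.commute)
qed

lemma AE_N_ge_1: "AE \<omega> in M. N n \<omega> \<ge> 1"
proof -
  let ?f = "\<lambda>z :: nat \<times> 'd. indicator {0} (fst z) :: ennreal"
  have "(\<integral>\<^sup>+\<omega>. ?f (N n \<omega>, J n \<omega>) \<partial>M) = 0"
  proof (cases "n = 0")
    case True
    have "ennreal (\<alpha> k $ i) * ?f (k, i) = 0" for k i by (cases "k = 0") (auto simp: \<alpha>0)
    then show ?thesis unfolding True nn_integral_initial[of ?f] by (simp only: suminf_zero sum.neutral_const)
  next
    case False
    have "ennreal (\<Lambda> k $ i $ j) * ?f (k, j) = 0" for k i j by (cases "k = 0") (auto simp: \<Lambda>0)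
    then have "(\<integral>\<^sup>+z. ?f z \<partial>measure_pmf (kernel i)) = 0" for i
      unfolding nn_integral_kernel by (simp only: suminf_zero sum.neutral_const)
    then show ?thesis using nn_integral_le[of n ?f 0] False by simp
  qed
  moreover have "(\<lambda>\<omega>. ?f (N n \<omega>, J n \<omega>)) \<in> borel_measurable M"
    unfolding fst_conv by (rule measurable_compose[OF meas_N]) simp
  ultimately have "AE \<omega> in M. ?f (N n \<omega>, J n \<omega>) = 0" by (simp only: nn_integral_0_iff_AE)
  then show ?thesis by eventually_elim (auto split: split_indicator_asm)
qed

abbreviation "\<alpha>_rest k i \<equiv> \<Sum>l. \<alpha> (l + k + 1) $ i"
abbreviation "\<Lambda>_rest k i j \<equiv> \<Sum>l. \<Lambda> (l + k + 1) $ i $ j"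

text \<open>Summing over all entries gives one bound for every slot and state.\<close>

definition tail_sum :: "nat \<Rightarrow> real" where
  "tail_sum k = (\<Sum>i\<in>UNIV. \<alpha>_rest k i) + (\<Sum>i\<in>UNIV. \<Sum>j\<in>UNIV. \<Lambda>_rest k i j)"

lemma prob_N_greater: "prob {\<omega> \<in> space M. N n \<omega> > k} \<le> tail_sum k"
proof -
  let ?f = "\<lambda>z :: nat \<times> 'd. indicator {k<..} (fst z) :: ennreal"
  have sa: "(\<alpha>_rest k i) \<ge> 0" for i
    using summable_ignore_initial_segment[OF \<alpha>_summ, of "k + 1" i] by (intro suminf_nonneg \<alpha>_nonneg) (simp add: add.assoc)
  have sL: "(\<Lambda>_rest k i j) \<ge> 0" for i j
    using summable_ignore_initial_segment[OF \<Lambda>_summ, of "k + 1" i j] by (intro suminf_nonneg \<Lambda>_nonneg) (simp add: add.assoc)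
  have "ennreal (prob {\<omega> \<in> space M. N n \<omega> > k}) = (\<integral>\<^sup>+\<omega>. indicator {\<omega> \<in> space M. N n \<omega> > k} \<omega> \<partial>M)"
    by (simp add: emeasure_eq_measure)
  also have "\<dots> = (\<integral>\<^sup>+\<omega>. ?f (N n \<omega>, J n \<omega>) \<partial>M)"
    by (intro nn_integral_cong) (auto split: split_indicator)
  also have "\<dots> \<le> ennreal (tail_sum k)"
  proof (cases "n = 0")
    case True
    have "(\<integral>\<^sup>+\<omega>. ?f (N n \<omega>, J n \<omega>) \<partial>M) = (\<Sum>i\<in>UNIV. ennreal (\<alpha>_rest k i))"
      unfolding True nn_integral_initial[of ?f]
      by (intro sum.cong refl) (simp only: fst_conv suminf_indicator_greater[OF \<alpha>_nonneg \<alpha>_summ])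
    also have "\<dots> = ennreal (\<Sum>i\<in>UNIV. \<alpha>_rest k i)" using sa by (intro sum_ennreal) simp
    also have "\<dots> \<le> ennreal (tail_sum k)"
      unfolding tail_sum_def using sL by (intro ennreal_leI) (simp add: sum_nonneg)
    finally show ?thesis .
  next
    case False
    have "(\<integral>\<^sup>+z. ?f z \<partial>measure_pmf (kernel i)) \<le> ennreal (tail_sum k)" for i
    proof -
      have "(\<integral>\<^sup>+z. ?f z \<partial>measure_pmf (kernel i)) = (\<Sum>j\<in>UNIV. ennreal (\<Lambda>_rest k i j))"
        unfolding nn_integral_kernel
        by (intro sum.cong refl) (simp only: fst_conv suminf_indicator_greater[OF \<Lambda>_nonneg \<Lambda>_summ])
      also have "\<dots> = ennreal (\<Sum>j\<in>UNIV. \<Lambda>_rest k i j)" using sL by (intro sum_ennreal) simp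
      also have "\<dots> \<le> ennreal (tail_sum k)"
      proof (intro ennreal_leI)
        have "(\<Sum>j\<in>UNIV. \<Lambda>_rest k i j) \<le> (\<Sum>i\<in>UNIV. \<Sum>j\<in>UNIV. \<Lambda>_rest k i j)"
          using sL by (intro member_le_sum[of i UNIV "\<lambda>i. \<Sum>j\<in>UNIV. \<Lambda>_rest k i j"]) (auto intro!: sum_nonneg)
        then show "(\<Sum>j\<in>UNIV. \<Lambda>_rest k i j) \<le> tail_sum k"
          unfolding tail_sum_def using sa sum_nonneg[of UNIV "\<lambda>i. \<alpha>_rest k i"] by simp
      qed
      finally show ?thesis .
    qed
    then show ?thesis using nn_integral_le[of n ?f "ennreal (tail_sum k)"] False by simp
  qed
  finally show ?thesis
    using sa sL by (subst (asm) ennreal_le_iff) (auto simp: tail_sum_def intro!: add_nonneg_nonneg sum_nonneg)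
qed

lemma tail_sum_bigo:
  assumes "\<And>i. (\<lambda>k. \<Sum>l. \<alpha> (l + k + 1) $ i) \<in> O(g)" "\<And>i j. (\<lambda>k. \<Sum>l. \<Lambda> (l + k + 1) $ i $ j) \<in> O(g)"
  shows "tail_sum \<in> O(g)"
  unfolding tail_sum_def[abs_def] by (intro sum_in_bigo big_sum_in_bigo assms)

end

section \<open>The loss probability\<close>

lemma asymp_equiv_if_ratio_bounds:
  fixes f g :: "'b \<Rightarrow> real"
  assumes g: "\<And>x. g x > 0"
    and fg: "\<And>\<epsilon>. \<epsilon> > 0 \<Longrightarrow> \<forall>\<^sub>F x in F. f x \<le> (1 + \<epsilon>) * g x"
    and gf: "\<And>\<epsilon>. \<epsilon> > 0 \<Longrightarrow> \<forall>\<^sub>F x in F. g x \<le> (1 + \<epsilon>) * f x"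
  shows "f \<sim>[F] g"
proof (rule asymp_equivI', rule tendstoI)
  fix \<epsilon> :: real assume \<epsilon>: "\<epsilon> > 0"
  have "\<epsilon> / 2 > 0" using \<epsilon> by simp
  show "\<forall>\<^sub>F x in F. dist (f x / g x) 1 < \<epsilon>"
    using fg[OF \<open>\<epsilon> / 2 > 0\<close>] gf[OF \<open>\<epsilon> / 2 > 0\<close>]
  proof eventually_elim
    case (elim x)
    define r where "r = f x / g x"
    have r: "r \<le> 1 + \<epsilon> / 2" "1 \<le> (1 + \<epsilon> / 2) * r"
      using elim g[of x] by (simp_all add: r_def pos_divide_le_eq pos_le_divide_eq)
    have "1 - \<epsilon> / 2 \<le> r"
    proof (rule ccontr)
      assume "\<not> 1 - \<epsilon> / 2 \<le> r"
      then have "(1 + \<epsilon> / 2) * r < (1 + \<epsilon> / 2) * (1 - \<epsilon> / 2)" using \<epsilon> by simp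
      also have "\<dots> = 1 - (\<epsilon> / 2) * (\<epsilon> / 2)" by (simp add: algebra_simps)
      also have "\<dots> \<le> 1" by simp
      finally show False using r(2) by linarith
    qed
    then have "\<bar>r - 1\<bar> < \<epsilon>" using r(1) \<epsilon> by linarith
    then show ?case by (simp add: r_def dist_real_def)
  qed
qed

text \<open>Tail sums live on integers, while thresholds such as \<open>x / (2 k)\<close> are real.
  Rounding down shifts the argument by at most 1, which long-tailedness of F absorbs.\<close>

lemma (in bmap) tail_bound:
  assumes cv: "cons_var F" and F: "antimono F" "\<And>x. F x > 0"
    and Yo: "YT \<in> o[at_top](F)"
    and O: "\<And>i. (\<lambda>k. \<Sum>l. \<alpha> (l + k + 1) $ i) \<in> O(\<lambda>k. YT (real k))"
      "\<And>i j. (\<lambda>k. \<Sum>l. \<Lambda> (l + k + 1) $ i $ j) \<in> O(\<lambda>k. YT (real k))"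
  shows "\<exists>\<rho>. (\<forall>t y. prob {\<omega> \<in> space M. real (N t \<omega>) > y} \<le> \<rho> y)
    \<and> (\<forall>c>0. \<forall>\<^sub>F y in at_top. \<rho> y \<le> c * F y)"
proof -
  \<comment> \<open>For negative y the floor would be clipped to 0 by \<open>nat\<close>, while the
    probability is 1.\<close>
  define \<rho> where "\<rho> y = (if y < 0 then 1 else tail_sum (nat \<lfloor>y\<rfloor>))" for y :: real
  have nn: "F x \<ge> 0" for x using F(2)[of x] by simp
  have 1: "prob {\<omega> \<in> space M. real (N t \<omega>) > y} \<le> \<rho> y" for t y
  proof (cases "y < 0")
    case False
    have "real k > y \<longleftrightarrow> k > nat \<lfloor>y\<rfloor>" for k :: nat
      using False by linarith
    then show ?thesis using prob_N_greater[of "nat \<lfloor>y\<rfloor>" t] False by (simp add: \<rho>_def)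
  qed (simp add: \<rho>_def)
  have 2: "\<forall>\<^sub>F y in at_top. \<rho> y \<le> c * F y" if c: "c > 0" for c
  proof -
    have "tail_sum \<in> O(\<lambda>k. YT (real k))" by (rule tail_sum_bigo[OF O])
    then obtain C where C: "C > 0" "\<forall>\<^sub>F k in sequentially. norm (tail_sum k) \<le> C * norm (YT (real k))"
      by (elim landau_o.bigE)
    have "\<forall>\<^sub>F x in at_top. norm (YT x) \<le> c / (2 * C) * norm (F x)"
      using C c by (intro landau_o.smallD[OF Yo]) auto
    then have "\<forall>\<^sub>F k in sequentially. norm (YT (real k)) \<le> c / (2 * C) * norm (F (real k))"
      using filterlim_real_sequentially by (auto simp: filterlim_iff)
    with C(2) have "\<forall>\<^sub>F k in sequentially. tail_sum k \<le> c / 2 * F (real k)"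
    proof eventually_elim
      case (elim k)
      have "tail_sum k \<le> C * norm (YT (real k))" using elim(1) by simp
      also have "\<dots> \<le> C * (c / (2 * C) * norm (F (real k)))" using elim(2) C(1) by (intro mult_left_mono) auto
      also have "\<dots> = c / 2 * F (real k)" using C(1) nn by simp
      finally show ?case .
    qed
    then obtain k0 where k0: "\<And>k. k \<ge> k0 \<Longrightarrow> tail_sum k \<le> c / 2 * F (real k)"
      unfolding eventually_sequentially by blast
    have "\<forall>\<^sub>F y in at_top. F (y - 1) \<le> (1 + 1) * F y"
      by (rule cons_var_shift[OF cv F(1) nn]) simp
    then show ?thesis using eventually_ge_at_top[of "real k0 + 1"]
    proof eventually_elim
      case (elim y)
      have y: "nat \<lfloor>y\<rfloor> \<ge> k0" "real (nat \<lfloor>y\<rfloor>) \<ge> y - 1" "\<not> y < 0" using elim(2) by linarith+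
      have "\<rho> y \<le> c / 2 * F (real (nat \<lfloor>y\<rfloor>))" using k0[OF y(1)] y(3) by (simp add: \<rho>_def)
      also have "\<dots> \<le> c / 2 * F (y - 1)" using y(2) F(1) c by (intro mult_left_mono) (auto simp: antimono_def)
      also have "\<dots> \<le> c / 2 * ((1 + 1) * F y)" using elim(1) c by (intro mult_left_mono) auto
      also have "\<dots> = c * F y" by simp
      finally show ?case .
    qed
  qed
  from 1 2 show ?thesis by blast
qed

text \<open>The condition on \<alpha> says that slot 0 is itself a kernel step from a state with law
  \<phi>. The states are thus stationary from slot 0 on, and every slot has mean lam.\<close>

lemma (in bmap) stationary_mean_arrivals:
  assumes \<phi>: "prob_vector \<phi>" "\<phi> v* P = \<phi>"
    and lam: "lam = (\<Sum>i\<in>UNIV. \<Sum>j\<in>UNIV. \<phi> $ i * (\<Sum>k. real k * \<Lambda> k $ i $ j))"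
    and \<alpha>\<phi>: "\<And>k. k \<ge> 1 \<Longrightarrow> \<alpha> k = \<phi> v* \<Lambda> k"
  shows "(\<integral>\<^sup>+\<omega>. ennreal (real (N n \<omega>)) \<partial>M) = ennreal lam"
proof -
  have \<phi>nn: "\<phi> $ i \<ge> 0" for i using \<phi>(1) by (simp add: prob_vector_def)
  have \<alpha>: "\<alpha> k $ i = (\<Sum>j\<in>UNIV. \<phi> $ j * \<Lambda> k $ j $ i)" for k i
  proof (cases "k = 0")
    case False
    then show ?thesis using \<alpha>\<phi>[of k] by (simp add: vector_matrix_mult_def mult.commute)
  qed (simp add: \<alpha>0 \<Lambda>0)
  let ?K = "\<lambda>f i. \<integral>\<^sup>+z. f z \<partial>measure_pmf (kernel i)"
  have init: "(\<integral>\<^sup>+\<omega>. f (N 0 \<omega>, J 0 \<omega>) \<partial>M) = (\<Sum>i\<in>UNIV. ennreal (\<phi> $ i) * ?K f i)" for f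
  proof -
    have "(\<integral>\<^sup>+\<omega>. f (N 0 \<omega>, J 0 \<omega>) \<partial>M) = (\<Sum>j\<in>UNIV. \<Sum>k. \<Sum>i\<in>UNIV. ennreal (\<phi> $ i) * (ennreal (\<Lambda> k $ i $ j) * f (k, j)))"
    proof -
      have "ennreal (\<alpha> k $ j) * f (k, j) = (\<Sum>i\<in>UNIV. ennreal (\<phi> $ i) * (ennreal (\<Lambda> k $ i $ j) * f (k, j)))" for k j
      proof -
        have "ennreal (\<alpha> k $ j) = (\<Sum>i\<in>UNIV. ennreal (\<phi> $ i * \<Lambda> k $ i $ j))"
          unfolding \<alpha> using \<phi>nn \<Lambda>_nonneg by (intro sum_ennreal[symmetric]) simp
        then show ?thesis by (simp only: ennreal_mult[OF \<phi>nn \<Lambda>_nonneg] sum_distrib_right mult.assoc)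
      qed
      then show ?thesis by (simp only: nn_integral_initial)
    qed
    also have "\<dots> = (\<Sum>j\<in>UNIV. \<Sum>i\<in>UNIV. \<Sum>k. ennreal (\<phi> $ i) * (ennreal (\<Lambda> k $ i $ j) * f (k, j)))"
      by (intro sum.cong refl suminf_sum) simp
    also have "\<dots> = (\<Sum>j\<in>UNIV. \<Sum>i\<in>UNIV. ennreal (\<phi> $ i) * (\<Sum>k. ennreal (\<Lambda> k $ i $ j) * f (k, j)))"
      by (simp only: ennreal_suminf_cmult)
    also have "\<dots> = (\<Sum>i\<in>UNIV. ennreal (\<phi> $ i) * ?K f i)"
      unfolding nn_integral_kernel sum_distrib_left by (rule sum.swap)
    finally show ?thesis .
  qed
  have \<phi>P: "(\<Sum>i\<in>UNIV. \<phi> $ i * P $ i $ j) = \<phi> $ j" for j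
  proof -
    have "(\<phi> v* P) $ j = \<phi> $ j" using \<phi>(2) by simp
    then show ?thesis by (simp add: vector_matrix_mult_def mult.commute)
  qed
  have next_state: "(\<Sum>i\<in>UNIV. ennreal (\<phi> $ i) * ?K (\<lambda>z. g (snd z)) i) = (\<Sum>j\<in>UNIV. ennreal (\<phi> $ j) * g j)" for g
  proof -
    have "?K (\<lambda>z. g (snd z)) i = (\<Sum>j\<in>UNIV. ennreal (P $ i $ j) * g j)" for i
    proof -
      have "(\<Sum>k. ennreal (\<Lambda> k $ i $ j)) = ennreal (P $ i $ j)" for j
        unfolding P_nth by (intro suminf_ennreal2 \<Lambda>_nonneg \<Lambda>_summ)
      then show ?thesis by (simp only: nn_integral_kernel snd_conv ennreal_suminf_multc)
    qed
    then have "(\<Sum>i\<in>UNIV. ennreal (\<phi> $ i) * ?K (\<lambda>z. g (snd z)) i)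
       = (\<Sum>i\<in>UNIV. \<Sum>j\<in>UNIV. ennreal (\<phi> $ i * P $ i $ j) * g j)"
      by (simp only: sum_distrib_left ennreal_mult[OF \<phi>nn P_stochastic(1)] mult.assoc)
    also have "\<dots> = (\<Sum>j\<in>UNIV. (\<Sum>i\<in>UNIV. ennreal (\<phi> $ i * P $ i $ j)) * g j)"
      by (subst sum.swap) (simp only: sum_distrib_right)
    also have "\<dots> = (\<Sum>j\<in>UNIV. ennreal (\<phi> $ j) * g j)"
    proof -
      have "(\<Sum>i\<in>UNIV. ennreal (\<phi> $ i * P $ i $ j)) = ennreal (\<Sum>i\<in>UNIV. \<phi> $ i * P $ i $ j)" for j
        using \<phi>nn P_stochastic(1) by (intro sum_ennreal) simp
      then show ?thesis by (simp only: \<phi>P)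
    qed
    finally show ?thesis .
  qed
  have J: "(\<integral>\<^sup>+\<omega>. g (J n \<omega>) \<partial>M) = (\<Sum>j\<in>UNIV. ennreal (\<phi> $ j) * g j)" for n g
  proof (induction n arbitrary: g)
    case 0
    show ?case using init[of "\<lambda>z. g (snd z)"] by (simp only: next_state snd_conv)
  next
    case (Suc n)
    have "(\<integral>\<^sup>+\<omega>. g (J (Suc n) \<omega>) \<partial>M) = (\<integral>\<^sup>+\<omega>. ?K (\<lambda>z. g (snd z)) (J n \<omega>) \<partial>M)"
      using nn_integral_step[of "Suc n" "\<lambda>_ z. g (snd z)"] by simp
    also have "\<dots> = (\<Sum>i\<in>UNIV. ennreal (\<phi> $ i) * ?K (\<lambda>z. g (snd z)) i)" by (rule Suc.IH)
    also have "\<dots> = (\<Sum>j\<in>UNIV. ennreal (\<phi> $ j) * g j)" by (rule next_state)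
    finally show ?case .
  qed
  have "(\<integral>\<^sup>+\<omega>. ennreal (real (N n \<omega>)) \<partial>M) = (\<Sum>i\<in>UNIV. ennreal (\<phi> $ i) * ?K (\<lambda>z. ennreal (real (fst z))) i)"
  proof (cases n)
    case 0
    then show ?thesis using init[of "\<lambda>z. ennreal (real (fst z))"] by simp
  next
    case (Suc m)
    have "(\<integral>\<^sup>+\<omega>. ennreal (real (N (Suc m) \<omega>)) \<partial>M) = (\<integral>\<^sup>+\<omega>. ?K (\<lambda>z. ennreal (real (fst z))) (J m \<omega>) \<partial>M)"
      using nn_integral_step[of "Suc m" "\<lambda>_ z. ennreal (real (fst z))"] by simp
    also have "\<dots> = (\<Sum>i\<in>UNIV. ennreal (\<phi> $ i) * ?K (\<lambda>z. ennreal (real (fst z))) i)" by (rule J)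
    finally show ?thesis unfolding Suc .
  qed
  also have "\<dots> = (\<Sum>i\<in>UNIV. ennreal (\<phi> $ i * (\<Sum>j\<in>UNIV. \<Sum>k. real k * \<Lambda> k $ i $ j)))"
    by (simp only: nn_integral_kernel_fst ennreal_mult[OF \<phi>nn drift_sum_nonneg])
  also have "\<dots> = ennreal lam"
  proof -
    have "(\<Sum>i\<in>UNIV. ennreal (\<phi> $ i * (\<Sum>j\<in>UNIV. \<Sum>k. real k * \<Lambda> k $ i $ j)))
       = ennreal (\<Sum>i\<in>UNIV. \<phi> $ i * (\<Sum>j\<in>UNIV. \<Sum>k. real k * \<Lambda> k $ i $ j))"
      using \<phi>nn drift_sum_nonneg by (intro sum_ennreal) simp
    then show ?thesis by (simp only: lam sum_distrib_left)
  qed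
  finally show ?thesis .
qed

text \<open>Wald's identity for a count that is independent of the summands.\<close>

lemma (in sampled_arrivals) nn_integral_total_arrivals:
  assumes "\<And>n. (\<integral>\<^sup>+\<omega>. ennreal (real (N n \<omega>)) \<partial>M) = ennreal c"
  shows "(\<integral>\<^sup>+\<omega>. (\<Sum>t<Ion \<omega>. ennreal (real (N t \<omega>))) \<partial>M) = ennreal c * (\<integral>\<^sup>+\<omega>. ennreal (real (Ion \<omega>)) \<partial>M)"
proof -
  have "(\<integral>\<^sup>+\<omega>. (\<Sum>t<Ion \<omega>. ennreal (real (N t \<omega>))) \<partial>M)
      = (\<integral>\<^sup>+\<omega>'. (\<integral>\<^sup>+\<omega>. (\<Sum>t<Ion \<omega>'. ennreal (real (N t \<omega>))) \<partial>M) \<partial>M)"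
    using nn_integral_indep[of "\<lambda>n x. \<Sum>t<n. ennreal (real (fst (x t)))"] by simp
  also have "\<dots> = (\<integral>\<^sup>+\<omega>'. ennreal c * ennreal (real (Ion \<omega>')) \<partial>M)"
  proof (intro nn_integral_cong)
    fix \<omega>'
    have "(\<integral>\<^sup>+\<omega>. (\<Sum>t<Ion \<omega>'. ennreal (real (N t \<omega>))) \<partial>M) = (\<Sum>t<Ion \<omega>'. \<integral>\<^sup>+\<omega>. ennreal (real (N t \<omega>)) \<partial>M)"
      by (rule nn_integral_sum) measurable
    then show "(\<integral>\<^sup>+\<omega>. (\<Sum>t<Ion \<omega>'. ennreal (real (N t \<omega>))) \<partial>M) = ennreal c * ennreal (real (Ion \<omega>'))"
      by (simp only: assms sum_constant card_lessThan ennreal_of_nat_eq_real_of_nat mult.commute)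
  qed
  also have "\<dots> = ennreal c * (\<integral>\<^sup>+\<omega>. ennreal (real (Ion \<omega>)) \<partial>M)"
    by (rule nn_integral_cmult) measurable
  finally show ?thesis .
qed

lemma eventually_le_trans_factor:
  fixes f g h :: "'b \<Rightarrow> real"
  assumes fg: "\<And>\<epsilon>. \<epsilon> > 0 \<Longrightarrow> \<forall>\<^sub>F x in F. f x \<le> (1 + \<epsilon>) * g x"
    and gh: "\<And>\<epsilon>. \<epsilon> > 0 \<Longrightarrow> \<forall>\<^sub>F x in F. g x \<le> (1 + \<epsilon>) * h x"
    and h: "\<And>x. h x \<ge> 0" and \<epsilon>: "\<epsilon> > 0"
  shows "\<forall>\<^sub>F x in F. f x \<le> (1 + \<epsilon>) * h x"
proof -
  \<comment> \<open>For e at most 1, \<open>(1 + e)^2 \<le> 1 + 3 e\<close>.\<close>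
  define e where "e = min 1 (\<epsilon> / 3)"
  have e: "e > 0" "e \<le> 1" "e \<le> \<epsilon> / 3" using \<epsilon> by (auto simp: e_def)
  have "e * e \<le> e * 1" using e by (intro mult_left_mono) auto
  moreover have "(1 + e) * (1 + e) = 1 + 2 * e + e * e" by (simp add: algebra_simps)
  ultimately have ee: "(1 + e) * (1 + e) \<le> 1 + \<epsilon>" using e by linarith
  show ?thesis using fg[OF e(1)] gh[OF e(1)]
  proof eventually_elim
    case (elim x)
    have "(1 + e) * g x \<le> (1 + e) * ((1 + e) * h x)" using elim(2) e by (intro mult_left_mono) auto
    also have "\<dots> = ((1 + e) * (1 + e)) * h x" by (simp only: mult.assoc)
    also have "\<dots> \<le> (1 + \<epsilon>) * h x" by (rule mult_right_mono[OF ee h])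
    finally show ?case using elim(1) by linarith
  qed
qed

theorem theorem4p4:
  fixes M :: "'a measure"
    and N :: "nat \<Rightarrow> 'a \<Rightarrow> nat" and J :: "nat \<Rightarrow> 'a \<Rightarrow> 'd::finite"
    and Ion Ioff :: "'a \<Rightarrow> nat"
    and \<alpha> :: "nat \<Rightarrow> real^'d" and \<Lambda> :: "nat \<Rightarrow> real^'d^'d"
    and \<phi> :: "real^'d" and lam :: real
    and MY :: "'b measure" and Y :: "'b \<Rightarrow> real"
    and \<pi> :: "nat \<Rightarrow> nat \<Rightarrow> real"
  assumes M: "prob_space M"
    and meas_N: "\<And>n. N n \<in> M \<rightarrow>\<^sub>M count_space UNIV"
    and meas_J: "\<And>n. J n \<in> M \<rightarrow>\<^sub>M count_space UNIV"
    and meas_Ion: "Ion \<in> M \<rightarrow>\<^sub>M count_space UNIV"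
    and meas_Ioff: "Ioff \<in> M \<rightarrow>\<^sub>M count_space UNIV"
    and Ion_pos: "\<And>\<omega>. \<omega> \<in> space M \<Longrightarrow> Ion \<omega> \<ge> 1"
    and \<alpha>0: "\<alpha> 0 = 0" and \<Lambda>0: "\<Lambda> 0 = 0"
    and init: "\<And>k i. k \<ge> 1 \<Longrightarrow>
        measure M {\<omega> \<in> space M. N 0 \<omega> = k \<and> J 0 \<omega> = i} = \<alpha> k $ i"
    and markov: "\<And>n ks js k j. n \<ge> 1 \<Longrightarrow> k \<ge> 1 \<Longrightarrow>
        measure M {\<omega> \<in> space M. (\<forall>t<n. N t \<omega> = ks t \<and> J t \<omega> = js t) \<and> N n \<omega> = k \<and> J n \<omega> = j}
        = \<Lambda> k $ js (n - 1) $ j * measure M {\<omega> \<in> space M. \<forall>t<n. N t \<omega> = ks t \<and> J t \<omega> = js t}"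
    and \<alpha>_summ: "\<And>i. summable (\<lambda>k. \<alpha> k $ i)"
    and \<alpha>_prob: "prob_vector (\<chi> i. \<Sum>k. \<alpha> k $ i)"
    and \<Lambda>_summ: "\<And>i j. summable (\<lambda>k. \<Lambda> k $ i $ j)"
    and \<Lambda>_stoch: "stochastic_mat (\<chi> i j. \<Sum>k. \<Lambda> k $ i $ j)"
    and \<Lambda>_irred: "irreducible_mat (\<chi> i j. \<Sum>k. \<Lambda> k $ i $ j)"
    and \<phi>_prob: "prob_vector \<phi>"
    and \<phi>_stat: "\<phi> v* (\<chi> i j. \<Sum>k. \<Lambda> k $ i $ j) = \<phi>"
    and lam_summ: "\<And>i j. summable (\<lambda>k. real k * \<Lambda> k $ i $ j)"
    and lam_def: "lam = (\<Sum>i\<in>UNIV. \<Sum>j\<in>UNIV. \<phi> $ i * (\<Sum>k. real k * \<Lambda> k $ i $ j))"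
    and lam_gt1: "lam > 1"
    and MY: "prob_space MY"
    and meas_Y: "Y \<in> borel_measurable MY"
    and Y_nonneg: "\<And>y. y \<in> space MY \<Longrightarrow> Y y \<ge> 0"
    and Y_S: "subexponential MY Y"
    and \<alpha>_tail: "\<And>i. (\<lambda>k::nat. \<Sum>l. \<alpha> (l + k + 1) $ i) \<in> O(\<lambda>k. rv_tail MY Y (real k))"
    and \<Lambda>_tail: "\<And>i j. (\<lambda>k::nat. \<Sum>l. \<Lambda> (l + k + 1) $ i $ j) \<in> O(\<lambda>k. rv_tail MY Y (real k))"
    and stable: "(\<integral>\<^sup>+\<omega>. ennreal (real_of_int (onoff_A N Ion \<omega>)) \<partial>M)
                 < (\<integral>\<^sup>+\<omega>. ennreal (real (Ioff \<omega>)) \<partial>M)"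
    and indep_on: "prob_space.indep_set M
        {Ion -` A \<inter> space M | A. A \<in> sets (count_space UNIV)}
        {(\<lambda>\<omega> n. (N n \<omega>, J n \<omega>)) -` B \<inter> space M | B.
           B \<in> sets (\<Pi>\<^sub>M n\<in>UNIV. count_space UNIV \<Otimes>\<^sub>M count_space UNIV)}"
    and indep_off: "prob_space.indep_set M
        {Ioff -` A \<inter> space M | A. A \<in> sets (count_space UNIV)}
        {(\<lambda>\<omega>. (Ion \<omega>, (\<lambda>n. (N n \<omega>, J n \<omega>)))) -` B \<inter> space M | B.
           B \<in> sets (count_space UNIV \<Otimes>\<^sub>M (\<Pi>\<^sub>M n\<in>UNIV. count_space UNIV \<Otimes>\<^sub>M count_space UNIV))}"
    and Ion_C: "consistent_variation M (\<lambda>\<omega>. real (Ion \<omega>))"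
    and Ion_mean: "(\<integral>\<^sup>+\<omega>. ennreal (real (Ion \<omega>)) \<partial>M) < \<infinity>"
    and Y_Ion: "rv_tail MY Y \<in> o(rv_tail M (\<lambda>\<omega>. real (Ion \<omega>)))"
    and stat: "\<And>K. stationary_queue_dist M K (onoff_A N Ion) Ioff (\<pi> K)"
  shows "(\<lambda>K. loss_probability M K (onoff_A N Ion) Ion (\<pi> K)) \<sim>[at_top]
           (\<lambda>K. (lam - 1) * (\<integral>\<omega>. real (Ion \<omega>) \<partial>M)
                 / ((\<integral>\<omega>. real_of_int (onoff_A N Ion \<omega>) \<partial>M) + (\<integral>\<omega>. real (Ion \<omega>) \<partial>M))
                 * equilibrium_tail M (\<lambda>\<omega>. real (Ion \<omega>)) (real K / (lam - 1)))
       \<and> ((\<forall>k\<ge>1. \<alpha> k = \<phi> v* \<Lambda> k) \<longrightarrow>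
           (\<lambda>K. loss_probability M K (onoff_A N Ion) Ion (\<pi> K)) \<sim>[at_top]
           (\<lambda>K. (lam - 1) / lam * equilibrium_tail M (\<lambda>\<omega>. real (Ion \<omega>)) (real K / (lam - 1))))"
proof -
  interpret B: bmap M N J \<alpha> \<Lambda>
    by (intro bmap.intro bmap_axioms.intro M meas_N meas_J \<alpha>0 \<Lambda>0 init markov \<alpha>_summ \<alpha>_prob
          \<Lambda>_summ \<Lambda>_stoch \<Lambda>_irred lam_summ)
  let ?d = "\<lambda>i. \<Sum>j\<in>UNIV. \<Sum>k. real k * \<Lambda> k $ i $ j"
  have \<phi>1: "(\<Sum>i\<in>UNIV. \<phi> $ i) = 1" using \<phi>_prob by (simp add: prob_vector_def)
  have \<phi>P: "\<phi> v* B.P = \<phi>" using \<phi>_stat by (simp add: B.P_def)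
  have lam: "lam = (\<Sum>i\<in>UNIV. \<phi> $ i * ?d i)" by (simp only: lam_def sum_distrib_left)
  \<comment> \<open>The solvability condition of the Poisson equation: lam is the stationary mean of
    the drift.\<close>
  have \<phi>g: "\<phi> \<bullet> (\<chi> i. ?d i - lam) = 0"
  proof -
    have "\<phi> \<bullet> (\<chi> i. ?d i - lam) = (\<Sum>i\<in>UNIV. \<phi> $ i * ?d i - \<phi> $ i * lam)"
      by (simp add: inner_vec_def right_diff_distrib)
    also have "\<dots> = (\<Sum>i\<in>UNIV. \<phi> $ i * ?d i) - (\<Sum>i\<in>UNIV. \<phi> $ i) * lam"
      by (simp only: sum_subtractf sum_distrib_right)
    finally show ?thesis unfolding lam[symmetric] \<phi>1 by simp
  qed
  have st: "stochastic_mat B.P" and irr: "irreducible_mat B.P"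
    using \<Lambda>_stoch \<Lambda>_irred by (simp_all add: B.P_def)
  obtain h where h: "\<And>i. h $ i - (\<Sum>j\<in>UNIV. B.P $ i $ j * h $ j) = (\<chi> i. ?d i - lam) $ i"
    using poisson_equation_solvable[OF st irr \<phi>_prob \<phi>P \<phi>g] by blast
  interpret S: sampled_arrivals M N J B.kernel "\<lambda>i. h $ i" lam Ion
  proof (intro sampled_arrivals.intro centered_markov_arrivals.intro B.markov_arrivals_axioms
      centered_markov_arrivals_axioms.intro sampled_arrivals_axioms.intro meas_Ion Ion_pos B.AE_N_ge_1 indep_on)
    fix i
    show "B.drift i - lam + measure_pmf.expectation (B.kernel i) (\<lambda>z. h $ snd z) - h $ i = 0"
      using h[of i] unfolding B.kernel_mean(2) B.kernel_expectation_snd by simp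
  qed
  define \<mu> where "\<mu> = lam - 1"
  have \<mu>: "\<mu> > 0" using lam_gt1 by (simp add: \<mu>_def)
  let ?A = "onoff_A N Ion"
  have cv: "cons_var S.Ion_tail" by (rule consistent_variation_imp_cons_var[OF Ion_C])
  have F_pos: "S.Ion_tail x > 0" for x
    using Ion_C by (simp add: consistent_variation_def positive_tail_def)
  have anti: "antimono S.Ion_tail"
    by (intro B.antimono_rv_tail measurable_compose[OF meas_Ion]) simp
  have int_Ion: "integrable M (\<lambda>\<omega>. real (Ion \<omega>))"
    using Ion_mean by (intro integrableI_nonneg) auto
  obtain \<rho> where \<rho>: "\<forall>t y. measure M {\<omega> \<in> space M. real (N t \<omega>) > y} \<le> \<rho> y"
      "\<forall>c>0. \<forall>\<^sub>F y in at_top. \<rho> y \<le> c * S.Ion_tail y"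
    using B.tail_bound[OF cv anti F_pos Y_Ion \<alpha>_tail \<Lambda>_tail] by blast
  have upper: "\<forall>\<^sub>F x in at_top. rv_tail M (\<lambda>\<omega>. real_of_int (onoff_A N Ion \<omega>)) x \<le> (1 + \<epsilon>) * S.Ion_tail (x / \<mu>)"
    if "\<epsilon> > 0" for \<epsilon>
    unfolding \<mu>_def using \<rho> that
    by (intro S.net_tail_upper[OF cv F_pos lam_gt1 int_Ion, where \<rho> = \<rho>]) blast+
  note lower = S.net_tail_lower[OF cv lam_gt1, folded \<mu>_def]

  have A_nonneg: "AE \<omega> in M. ?A \<omega> \<ge> 0"
    using S.AE_N_pos by eventually_elim (auto simp: onoff_A_def Suc_le_eq intro!: sum_nonneg)
  \<comment> \<open>The strict inequality in \<open>stable\<close> bounds the mean of the net input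
    away from infinity.\<close>
  have int_A: "integrable M (\<lambda>\<omega>. real_of_int (?A \<omega>))"
  proof (rule integrableI_nonneg)
    show "AE \<omega> in M. 0 \<le> real_of_int (?A \<omega>)" using A_nonneg by eventually_elim simp
    show "(\<integral>\<^sup>+\<omega>. ennreal (real_of_int (?A \<omega>)) \<partial>M) < \<infinity>"
      using stable by (rule less_le_trans) simp
  qed (rule measurable_compose[OF S.measurable_onoff_A], simp)
  \<comment> \<open>The fluid approximation of the net input, growing by \<open>\<mu>\<close> per
    on-slot. Its tail is asymptotic to that of \<open>?A\<close>, and regularity of
    \<open>Ion\<close> passes through its stop-loss transform \<open>G\<close> to
    \<open>T\<close>.\<close>
  define Z where "Z \<omega> = \<mu> * real (Ion \<omega>)" for \<omega>
  define T where "T = stop_loss M (\<lambda>\<omega>. real_of_int (?A \<omega>))"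
  define G where "G = stop_loss M Z"
  have int_Z: "integrable M Z" unfolding Z_def using int_Ion by simp
  have Z_tail: "rv_tail M Z x = S.Ion_tail (x / \<mu>)" for x
    using \<mu> by (simp add: rv_tail_def Z_def pos_divide_less_eq mult.commute)
  have TG: "\<forall>\<^sub>F x in at_top. T x \<le> (1 + \<epsilon>) * G x" if "\<epsilon> > 0" for \<epsilon>
    unfolding T_def G_def using upper[OF that]
    by (intro B.stop_loss_tail_le[OF int_A int_Z that]) (simp add: Z_tail)
  have GT: "\<forall>\<^sub>F x in at_top. G x \<le> (1 + \<epsilon>) * T x" if "\<epsilon> > 0" for \<epsilon>
    unfolding T_def G_def using lower[OF that]
    by (intro B.stop_loss_tail_le[OF int_Z int_A that]) (simp add: Z_tail)
  have T_nonneg: "T x \<ge> 0" for x unfolding T_def by (rule B.stop_loss_nonneg)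
  have G_pos: "G x > 0" for x
    unfolding G_def using F_pos by (intro B.stop_loss_pos[OF int_Z]) (simp add: positive_tail_def Z_tail)
  have "cons_var (rv_tail M Z)"
    using cons_var_scale[OF cv, of "1 / \<mu>"] \<mu> unfolding Z_tail[abs_def] by simp
  then have "cons_var G" unfolding G_def by (rule B.cons_var_stop_loss[OF int_Z])
  then have cvT: "cons_var T" by (rule cons_var_asymp[OF _ T_nonneg TG GT])
  have antiT: "antimono T" unfolding T_def by (rule B.antimono_stop_loss[OF int_A])
  \<comment> \<open>The comparison with \<open>G\<close> holds only far out; monotonicity of
    \<open>T\<close> carries positivity back to every x.\<close>
  have T_pos: "T x > 0" for x
  proof -
    obtain y where y: "y \<ge> x" "G y \<le> (1 + 1) * T y"
    proof -
      have "\<forall>\<^sub>F y in at_top. G y \<le> (1 + 1) * T y \<and> y \<ge> x"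
        using GT[of 1] eventually_ge_at_top[of x] by (simp add: eventually_conj)
      then show thesis using that eventually_happens[of _ "at_top :: real filter"] by auto
    qed
    have "T y \<le> T x" using antiT y(1) by (simp add: antimono_def)
    moreover have "0 < (1 + 1) * T y" using G_pos[of y] y(2) by (rule less_le_trans)
    then have "0 < T y" by (simp add: zero_less_mult_iff)
    ultimately show ?thesis by simp
  qed
  define V where "V K = (\<Sum>l\<le>K. \<pi> K l * (\<integral>\<omega>. real_of_int (max 0 (int l + ?A \<omega> - int K)) \<partial>M))" for K
  note loss = B.loss_bounds[OF S.measurable_onoff_A meas_Ioff A_nonneg int_A stable stat,
      folded T_def, OF cvT T_pos, folded V_def]
  have TV: "\<forall>\<^sub>F K in sequentially. T (real K) \<le> (1 + \<epsilon>) * V K" if "\<epsilon> > 0" for \<epsilon>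
  proof (intro always_eventually allI)
    fix K
    have "T (real K) \<le> V K" by (rule loss(1)[OF that])
    moreover have "V K \<ge> 0" using calculation T_nonneg[of "real K"] by linarith
    ultimately show "T (real K) \<le> (1 + \<epsilon>) * V K" using that by (simp add: distrib_right add_increasing2)
  qed
  have V_nonneg: "V K \<ge> 0" for K using loss(1)[of 1 K] T_nonneg[of "real K"] by simp
  have seq: "\<forall>\<^sub>F K in sequentially. Q (real K)" if "\<forall>\<^sub>F x in at_top. Q x" for Q
    using that filterlim_real_sequentially by (auto simp: filterlim_iff)
  have VG: "V \<sim>[sequentially] (\<lambda>K. G (real K))"
  proof (rule asymp_equiv_if_ratio_bounds[OF G_pos])
    fix \<epsilon> :: real assume \<epsilon>: "\<epsilon> > 0"
    show "\<forall>\<^sub>F K in sequentially. V K \<le> (1 + \<epsilon>) * G (real K)"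
      by (rule eventually_le_trans_factor[OF loss(2) seq[OF TG] less_imp_le[OF G_pos] \<epsilon>])
    show "\<forall>\<^sub>F K in sequentially. G (real K) \<le> (1 + \<epsilon>) * V K"
      by (rule eventually_le_trans_factor[OF seq[OF GT] TV V_nonneg \<epsilon>])
  qed
  define E where "E = (\<integral>\<omega>. real (Ion \<omega>) \<partial>M)"
  define EA where "EA = (\<integral>\<omega>. real_of_int (?A \<omega>) \<partial>M)"
  have E_pos: "E > 0"
  proof -
    have "(\<integral>\<omega>. 1 \<partial>M) \<le> E"
      unfolding E_def using Ion_pos by (intro integral_mono int_Ion) (auto simp: Suc_le_eq)
    then show ?thesis by (simp add: B.prob_space)
  qed
  have G_eq: "G (real K) = \<mu> * E * equilibrium_tail M (\<lambda>\<omega>. real (Ion \<omega>)) (real K / \<mu>)" for K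
  proof -
    have "E * equilibrium_tail M (\<lambda>\<omega>. real (Ion \<omega>)) (real K / \<mu>) = stop_loss M (\<lambda>\<omega>. real (Ion \<omega>)) (real K / \<mu>)"
      unfolding E_def using E_pos \<mu> by (intro B.stop_loss_equilibrium_tail int_Ion) (simp_all add: E_def)
    moreover have "G (real K) = (\<integral>\<omega>. \<mu> * max 0 (real (Ion \<omega>) - real K / \<mu>) \<partial>M)"
      unfolding G_def stop_loss_def Z_def
      using \<mu> by (intro Bochner_Integration.integral_cong refl) (simp add: max_def field_simps)
    ultimately show ?thesis by (simp add: stop_loss_def)
  qed
  have loss_eq: "loss_probability M K ?A Ion (\<pi> K) = V K / (EA + E)" for K
    unfolding loss_probability_def V_def EA_def E_def using int_A int_Ion by simp
  have part1: "(\<lambda>K. loss_probability M K ?A Ion (\<pi> K)) \<sim>[at_top]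
      (\<lambda>K. \<mu> * E / (EA + E) * equilibrium_tail M (\<lambda>\<omega>. real (Ion \<omega>)) (real K / \<mu>))"
  proof -
    have "(\<lambda>K. V K / (EA + E)) \<sim>[sequentially] (\<lambda>K. G (real K) / (EA + E))"
      by (intro asymp_equiv_intros VG)
    then show ?thesis by (simp only: loss_eq G_eq times_divide_eq_left)
  qed
  have part2: "EA + E = lam * E" if "\<forall>k\<ge>1. \<alpha> k = \<phi> v* \<Lambda> k"
  proof -
    have mean: "(\<integral>\<^sup>+\<omega>. ennreal (real (N n \<omega>)) \<partial>M) = ennreal lam" for n
      using that by (intro B.stationary_mean_arrivals[OF \<phi>_prob \<phi>P lam_def]) auto
    have "ennreal (EA + E) = (\<integral>\<^sup>+\<omega>. ennreal (real_of_int (?A \<omega>) + real (Ion \<omega>)) \<partial>M)"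
      unfolding EA_def E_def Bochner_Integration.integral_add[OF int_A int_Ion, symmetric]
    proof (rule nn_integral_eq_integral[symmetric])
      show "AE \<omega> in M. 0 \<le> real_of_int (?A \<omega>) + real (Ion \<omega>)" using A_nonneg by eventually_elim simp
    qed (intro Bochner_Integration.integrable_add int_A int_Ion)
    \<comment> \<open>The net input removes one service per slot, so adding the length of the
      on-period restores the number of arrivals.\<close>
    also have "\<dots> = (\<integral>\<^sup>+\<omega>. (\<Sum>t<Ion \<omega>. ennreal (real (N t \<omega>))) \<partial>M)"
      by (intro nn_integral_cong) (simp add: S.net_eq sum_subtractf)
    also have "\<dots> = ennreal lam * (\<integral>\<^sup>+\<omega>. ennreal (real (Ion \<omega>)) \<partial>M)"
      by (rule S.nn_integral_total_arrivals[OF mean])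
    also have "(\<integral>\<^sup>+\<omega>. ennreal (real (Ion \<omega>)) \<partial>M) = ennreal E"
      unfolding E_def by (rule nn_integral_eq_integral[OF int_Ion]) simp
    also have "ennreal lam * ennreal E = ennreal (lam * E)"
      using lam_gt1 E_pos by (simp add: ennreal_mult)
    finally show ?thesis
    proof (rule ennreal_inj[THEN iffD1, rotated 2])
      have "EA \<ge> 0" unfolding EA_def using A_nonneg by (intro integral_nonneg_AE) (auto elim: eventually_mono)
      then show "0 \<le> EA + E" using E_pos by simp
      show "0 \<le> lam * E" using E_pos lam_gt1 by simp
    qed
  qed
  show ?thesis
  proof (intro conjI impI)
    show "(\<lambda>K. loss_probability M K ?A Ion (\<pi> K)) \<sim>[at_top]
        (\<lambda>K. (lam - 1) * (\<integral>\<omega>. real (Ion \<omega>) \<partial>M)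
                 / ((\<integral>\<omega>. real_of_int (?A \<omega>) \<partial>M) + (\<integral>\<omega>. real (Ion \<omega>) \<partial>M))
                 * equilibrium_tail M (\<lambda>\<omega>. real (Ion \<omega>)) (real K / (lam - 1)))"
      using part1 by (simp only: \<mu>_def E_def EA_def)
    assume "\<forall>k\<ge>1. \<alpha> k = \<phi> v* \<Lambda> k"
    from part2[OF this] have "\<mu> * E / (EA + E) = (lam - 1) / lam"
      using E_pos by (simp add: \<mu>_def)
    with part1 show "(\<lambda>K. loss_probability M K ?A Ion (\<pi> K)) \<sim>[at_top]
        (\<lambda>K. (lam - 1) / lam * equilibrium_tail M (\<lambda>\<omega>. real (Ion \<omega>)) (real K / (lam - 1)))"
      by (simp only: \<mu>_def)
  qed
qed

end
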